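(* Let $\mathfrak{g}$ be a finite-dimensional semi-simple complex Lie algebra, $\mathfrak{T}=\mathfrak{g}\otimes\mathbb{C}[x]/(x^2)$ the associated Takiff Lie algebra, and let $\chi\colon\overline{Z(\mathfrak{g})}\to\mathbb{C}$ be an algebra homomorphism. Then there exists a unique (up to isomorphism) simple $\mathfrak{T}$-module $V$ which contains the trivial module $L(0)$ as a $\mathfrak{g}$-submodule and on which $\overline{Z(\mathfrak{g})}$ acts via $\chi$. Moreover, $V$ is a $\mathfrak{g}$-Harish-Chandra module. Furthermore, if $\chi$ is not the character by which $\overline{Z(\mathfrak{g})}$ acts on the trivial $\mathfrak{T}$-module, then $V$ is infinite-dimensional.
   Context: The bracket on $\mathfrak{T}$ is $[v\otimes x^i,w\otimes x^j]=[v,w]\otimes x^{i+j}$; $\mathfrak{g}$ is identified with $\mathfrak{g}\otimes 1$ and $\bar{\mathfrak{g}}:=\mathfrak{g}\otimes x$, a commutative ideal. $Z(\mathfrak{T})$ denotes the center of $U(\mathfrak{T})$ and $\overline{Z(\mathfrak{g})}:=Z(\mathfrak{T})\cap U(\bar{\mathfrak{g}})$ (the "purely Takiff part of the center"). A $\mathfrak{T}$-module is a $\mathfrak{g}$-Harish-Chandra module if its restriction to $\mathfrak{g}$ is a direct sum of simple finite-dimensional $\mathfrak{g}$-modules, each isomorphism class occurring with finite multiplicity. *)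

theory Defs
  imports Complex_Main "HOL-Library.Poly_Mapping"
begin

class complex_vector = ab_group_add +
  fixes scaleC :: "complex \<Rightarrow> 'a \<Rightarrow> 'a"  (infixr \<open>*\<^sub>C\<close> 75)
  assumes scaleC_add_right: "a *\<^sub>C (x + y) = a *\<^sub>C x + a *\<^sub>C y"
    and scaleC_add_left: "(a + b) *\<^sub>C x = a *\<^sub>C x + b *\<^sub>C x"
    and scaleC_scaleC: "a *\<^sub>C b *\<^sub>C x = (a * b) *\<^sub>C x"
    and scaleC_one: "1 *\<^sub>C x = x"

global_interpretation complex_vector: vector_space "scaleC :: complex \<Rightarrow> 'a \<Rightarrow> 'a::complex_vector"
  by unfold_locales (rule scaleC_add_right scaleC_add_left scaleC_scaleC scaleC_one)+

instantiation complex :: complex_vector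
begin
definition scaleC_complex :: "complex \<Rightarrow> complex \<Rightarrow> complex"
  where "scaleC_complex c z = c * z"
instance
  by standard (simp_all add: scaleC_complex_def algebra_simps)
end

definition finite_dim :: "'v::complex_vector set \<Rightarrow> bool"
  where "finite_dim V \<longleftrightarrow> (\<exists>B. finite B \<and> complex_vector.span B = V)"


section \<open>Complex Lie algebras\<close>

class complex_lie_algebra = complex_vector +
  fixes bracket :: "'a \<Rightarrow> 'a \<Rightarrow> 'a"
  assumes bracket_add_left: "bracket (x + y) z = bracket x z + bracket y z"
    and bracket_scaleC_left: "bracket (c *\<^sub>C x) z = c *\<^sub>C bracket x z"
    and bracket_add_right: "bracket x (y + z) = bracket x y + bracket x z"
    and bracket_scaleC_right: "bracket x (c *\<^sub>C z) = c *\<^sub>C bracket x z"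
    and bracket_self: "bracket x x = 0"
    and jacobi: "bracket x (bracket y z) + bracket y (bracket z x) + bracket z (bracket x y) = 0"

definition lie_ideal :: "'g::complex_lie_algebra set \<Rightarrow> bool"
  where "lie_ideal I \<longleftrightarrow> complex_vector.subspace I \<and> (\<forall>x. \<forall>y\<in>I. bracket x y \<in> I)"

definition derived :: "'g::complex_lie_algebra set \<Rightarrow> 'g set"
  where "derived L = complex_vector.span {bracket x y | x y. x \<in> L \<and> y \<in> L}"

definition solvable :: "'g::complex_lie_algebra set \<Rightarrow> bool"
  where "solvable L \<longleftrightarrow> (\<exists>n. (derived ^^ n) L = {0})"

text \<open>Semi-simplicity of the whole type: the solvable radical is zero.\<close>

definition semisimple :: "'g::complex_lie_algebra itself \<Rightarrow> bool"
  where "semisimple _ \<longleftrightarrow> (\<forall>I :: 'g set. lie_ideal I \<and> solvable I \<longrightarrow> I = {0})"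


section \<open>The Takiff Lie algebra\<close>

text \<open>
  As a vector space, \<open>g \<otimes> C[x]/(x^2) = (g \<otimes> 1) \<oplus> (g \<otimes> x)\<close>;
  \<open>Takiff v w\<close> stands for \<open>v \<otimes> 1 + w \<otimes> x\<close>.
\<close>

datatype 'g takiff = Takiff (body: 'g) (nil_part: 'g)

instantiation takiff :: (complex_vector) complex_vector
begin
definition zero_takiff :: "'a takiff" where "0 = Takiff 0 0"
definition plus_takiff :: "'a takiff \<Rightarrow> 'a takiff \<Rightarrow> 'a takiff"
  where "s + t = Takiff (body s + body t) (nil_part s + nil_part t)"
definition uminus_takiff :: "'a takiff \<Rightarrow> 'a takiff"
  where "- t = Takiff (- body t) (- nil_part t)"
definition minus_takiff :: "'a takiff \<Rightarrow> 'a takiff \<Rightarrow> 'a takiff"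
  where "s - t = Takiff (body s - body t) (nil_part s - nil_part t)"
definition scaleC_takiff :: "complex \<Rightarrow> 'a takiff \<Rightarrow> 'a takiff"
  where "c *\<^sub>C t = Takiff (c *\<^sub>C body t) (c *\<^sub>C nil_part t)"
instance
  by standard
    (simp_all add: zero_takiff_def plus_takiff_def uminus_takiff_def minus_takiff_def
      scaleC_takiff_def complex_vector.scale_right_distrib complex_vector.scale_left_distrib
      algebra_simps)
end

instantiation takiff :: (complex_lie_algebra) complex_lie_algebra
begin
definition bracket_takiff :: "'a takiff \<Rightarrow> 'a takiff \<Rightarrow> 'a takiff"
  where "bracket s t = Takiff (bracket (body s) (body t))
    (bracket (body s) (nil_part t) + bracket (nil_part s) (body t))"
instance
proof
  fix x y z :: "'a takiff" and c :: complex
  have anti: "bracket b a = - bracket a b" for a b :: 'a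
  proof -
    have "bracket (a + b) (a + b) = bracket a b + bracket b a"
      unfolding bracket_add_left bracket_add_right by (simp add: bracket_self)
    then show ?thesis
      by (simp add: bracket_self eq_neg_iff_add_eq_0 add.commute)
  qed
  show "bracket (x + y) z = bracket x z + bracket y z"
    and "bracket x (y + z) = bracket x y + bracket x z"
    and "bracket (c *\<^sub>C x) z = c *\<^sub>C bracket x z"
    and "bracket x (c *\<^sub>C z) = c *\<^sub>C bracket x z"
    by (simp_all add: bracket_takiff_def plus_takiff_def scaleC_takiff_def bracket_add_left
      bracket_add_right bracket_scaleC_left bracket_scaleC_right complex_vector.scale_right_distrib)
  show "bracket x x = 0"
    by (simp add: bracket_takiff_def zero_takiff_def bracket_self anti[of "nil_part x"])
  have j: "bracket a (bracket b d) = - bracket b (bracket d a) - bracket d (bracket a b)" for a b d :: 'a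
    using jacobi[of a b d] by (simp add: eq_neg_iff_add_eq_0 algebra_simps)
  show "bracket x (bracket y z) + bracket y (bracket z x) + bracket z (bracket x y) = 0"
    using jacobi[of "body x" "body y" "body z"] j[of "body x" "body y" "nil_part z"]
      j[of "body x" "nil_part y" "body z"] j[of "nil_part x" "body y" "body z"]
    by (simp add: bracket_takiff_def zero_takiff_def plus_takiff_def bracket_add_left bracket_add_right)
qed
end

definition takiff_tensor :: "'g::complex_vector \<Rightarrow> nat \<Rightarrow> 'g takiff"
  where "takiff_tensor v i = (if i = 0 then Takiff v 0 else if i = 1 then Takiff 0 v else 0)"

lemma bracket_takiff_tensor:
  "bracket (takiff_tensor v i) (takiff_tensor w j) = takiff_tensor (bracket v w) (i + j)"
proof -
  have zl: "bracket 0 a = 0" and zr: "bracket a 0 = 0" for a :: 'a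
    using bracket_scaleC_left[of 0 a a] bracket_scaleC_right[of a 0 a] by simp_all
  show ?thesis
    by (auto simp: takiff_tensor_def bracket_takiff_def zero_takiff_def zl zr)
qed

definition gbar :: "'g::complex_lie_algebra takiff set"
  where "gbar = range (\<lambda>v. takiff_tensor v 1)"


section \<open>The universal enveloping algebra\<close>

datatype 'a free_monoid = Word (letters: "'a list")

instantiation free_monoid :: (type) monoid_add
begin
definition zero_free_monoid :: "'a free_monoid" where "0 = Word []"
definition plus_free_monoid :: "'a free_monoid \<Rightarrow> 'a free_monoid \<Rightarrow> 'a free_monoid"
  where "v + w = Word (letters v @ letters w)"
instance
  by standard (simp_all add: zero_free_monoid_def plus_free_monoid_def)
end

text \<open>The free associative unital algebra is the monoid algebra of the free monoid.\<close>

type_synonym 'a free_algebra = "'a free_monoid \<Rightarrow>\<^sub>0 complex"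

definition free_const :: "complex \<Rightarrow> 'a free_algebra"
  where "free_const c = Poly_Mapping.single 0 c"

definition free_gen :: "'a \<Rightarrow> 'a free_algebra"
  where "free_gen x = Poly_Mapping.single (Word [x]) 1"

text \<open>
  The first two families of relations turn the free algebra on the underlying set of the Lie
  algebra into its tensor algebra; the third one is the usual enveloping algebra relation.
\<close>

inductive_set uea_ideal :: "'a::complex_lie_algebra free_algebra set" where
  gen_add: "free_gen (x + y) - free_gen x - free_gen y \<in> uea_ideal"
| gen_scaleC: "free_gen (c *\<^sub>C x) - free_const c * free_gen x \<in> uea_ideal"
| gen_bracket: "free_gen x * free_gen y - free_gen y * free_gen x - free_gen (bracket x y) \<in> uea_ideal"
| add: "f \<in> uea_ideal \<Longrightarrow> g \<in> uea_ideal \<Longrightarrow> f + g \<in> uea_ideal"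
| mult_left: "f \<in> uea_ideal \<Longrightarrow> h * f \<in> uea_ideal"
| mult_right: "f \<in> uea_ideal \<Longrightarrow> f * h \<in> uea_ideal"

lemma uea_ideal_zero: "0 \<in> uea_ideal"
  using mult_left[OF gen_add, of 0] by simp

lemma uea_ideal_uminus: "f \<in> uea_ideal \<Longrightarrow> - f \<in> uea_ideal"
  using mult_left[of f "- 1"] by simp

lemma uea_ideal_diff: "f \<in> uea_ideal \<Longrightarrow> g \<in> uea_ideal \<Longrightarrow> f - g \<in> uea_ideal"
  using add[OF _ uea_ideal_uminus] by fastforce

lemma lookup_mult_empty_word:
  fixes f g :: "'a free_algebra"
  shows "Poly_Mapping.lookup (f * g) 0 = Poly_Mapping.lookup f 0 * Poly_Mapping.lookup g 0"
proof -
  have eq: "(0 = l + q) \<longleftrightarrow> (l = 0 \<and> q = 0)" for l q :: "'a free_monoid"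
    by (cases l; cases q) (auto simp: zero_free_monoid_def plus_free_monoid_def)
  have "Poly_Mapping.lookup (f * g) 0 =
      (\<Sum>l. Poly_Mapping.lookup f l * (\<Sum>q. Poly_Mapping.lookup g q when (0 = l + q)))"
    by (simp add: lookup_mult)
  also have "\<dots> = (\<Sum>l. Poly_Mapping.lookup f l * Poly_Mapping.lookup g 0 when l = 0)"
    by (rule Sum_any.cong) (auto simp: eq when_def)
  finally show ?thesis by simp
qed

lemma uea_ideal_proper: "1 \<notin> uea_ideal"
proof -
  have gen: "Poly_Mapping.lookup (free_gen x) 0 = 0" for x :: 'a
    by (simp add: free_gen_def lookup_single zero_free_monoid_def)
  have "Poly_Mapping.lookup f 0 = 0" if "f \<in> uea_ideal" for f :: "'a free_algebra"
    using that by induction (simp_all add: lookup_mult_empty_word lookup_add lookup_minus gen)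
  then show ?thesis by fastforce
qed

quotient_type (overloaded) 'a uea = "'a::complex_lie_algebra free_algebra" / "\<lambda>f g. f - g \<in> uea_ideal"
  morphisms rep_uea abs_uea
proof (rule equivpI)
  show "reflp (\<lambda>f g :: 'a free_algebra. f - g \<in> uea_ideal)"
    by (simp add: reflp_def uea_ideal_zero)
  show "symp (\<lambda>f g :: 'a free_algebra. f - g \<in> uea_ideal)"
    by (rule sympI) (use uea_ideal_uminus in fastforce)
  show "transp (\<lambda>f g :: 'a free_algebra. f - g \<in> uea_ideal)"
  proof (rule transpI)
    fix f g h :: "'a free_algebra"
    assume "f - g \<in> uea_ideal" "g - h \<in> uea_ideal"
    from add[OF this] show "f - h \<in> uea_ideal" by simp
  qed
qed

instantiation uea :: (complex_lie_algebra) ring_1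
begin
lift_definition zero_uea :: "'a uea" is 0 .
lift_definition one_uea :: "'a uea" is 1 .
lift_definition plus_uea :: "'a uea \<Rightarrow> 'a uea \<Rightarrow> 'a uea" is "(+)"
proof -
  fix f f' g g' :: "'a free_algebra"
  assume "f - f' \<in> uea_ideal" "g - g' \<in> uea_ideal"
  from add[OF this] show "f + g - (f' + g') \<in> uea_ideal"
    by (simp add: algebra_simps)
qed
lift_definition uminus_uea :: "'a uea \<Rightarrow> 'a uea" is uminus
  using uea_ideal_uminus by fastforce
lift_definition minus_uea :: "'a uea \<Rightarrow> 'a uea \<Rightarrow> 'a uea" is "(-)"
proof -
  fix f f' g g' :: "'a free_algebra"
  assume "f - f' \<in> uea_ideal" "g - g' \<in> uea_ideal"
  from uea_ideal_diff[OF this] show "f - g - (f' - g') \<in> uea_ideal"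
    by (simp add: algebra_simps)
qed
lift_definition times_uea :: "'a uea \<Rightarrow> 'a uea \<Rightarrow> 'a uea" is "(*)"
proof -
  fix f f' g g' :: "'a free_algebra"
  assume "f - f' \<in> uea_ideal" "g - g' \<in> uea_ideal"
  then have "(f - f') * g + f' * (g - g') \<in> uea_ideal"
    by (intro add mult_left mult_right)
  then show "f * g - f' * g' \<in> uea_ideal"
    by (simp add: algebra_simps)
qed
instance
proof
  show "(0 :: 'a uea) \<noteq> 1"
    by transfer (use uea_ideal_uminus uea_ideal_proper in fastforce)
qed (transfer; simp add: algebra_simps uea_ideal_zero)+
end

instantiation uea :: (complex_lie_algebra) complex_vector
begin
lift_definition scaleC_uea :: "complex \<Rightarrow> 'a uea \<Rightarrow> 'a uea" is "\<lambda>c f. free_const c * f"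
  by (metis mult_left right_diff_distrib)
instance
proof
  show "a *\<^sub>C b *\<^sub>C u = (a * b) *\<^sub>C u" for a b and u :: "'a uea"
    by transfer (simp add: free_const_def mult_single uea_ideal_zero flip: mult.assoc)
qed (transfer; simp add: free_const_def single_add algebra_simps uea_ideal_zero)+
end

lift_definition uea_gen :: "'a::complex_lie_algebra \<Rightarrow> 'a uea" is free_gen .

definition uea_center :: "'a::complex_lie_algebra uea set"
  where "uea_center = {z. \<forall>u. z * u = u * z}"

inductive_set subalgebra_generated :: "'a::complex_lie_algebra uea set \<Rightarrow> 'a uea set" for S where
  base: "u \<in> S \<Longrightarrow> u \<in> subalgebra_generated S"
| one: "1 \<in> subalgebra_generated S"
| add: "u \<in> subalgebra_generated S \<Longrightarrow> v \<in> subalgebra_generated S \<Longrightarrow> u + v \<in> subalgebra_generated S"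
| scaleC: "u \<in> subalgebra_generated S \<Longrightarrow> c *\<^sub>C u \<in> subalgebra_generated S"
| mult: "u \<in> subalgebra_generated S \<Longrightarrow> v \<in> subalgebra_generated S \<Longrightarrow> u * v \<in> subalgebra_generated S"

text \<open>
  \<open>U(gbar)\<close> is regarded as usual as a subalgebra of the enveloping algebra of the Takiff algebra.
\<close>

definition takiff_center :: "'g::complex_lie_algebra takiff uea set"
  where "takiff_center = uea_center \<inter> subalgebra_generated (uea_gen ` gbar)"

text \<open>Unital algebra homomorphisms \<open>takiff_center \<rightarrow> C\<close>; values off the domain are irrelevant.\<close>

definition takiff_character :: "('g::complex_lie_algebra takiff uea \<Rightarrow> complex) \<Rightarrow> bool"
  where "takiff_character \<chi> \<longleftrightarrow> \<chi> 1 = 1 \<and>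
    (\<forall>z\<in>takiff_center. \<forall>w\<in>takiff_center. \<chi> (z + w) = \<chi> z + \<chi> w \<and> \<chi> (z * w) = \<chi> z * \<chi> w) \<and>
    (\<forall>c. \<forall>z\<in>takiff_center. \<chi> (c *\<^sub>C z) = c * \<chi> z)"


section \<open>Modules\<close>

text \<open>
  A module is a subspace \<open>V\<close> of an ambient complex vector space with an action \<open>\<rho>\<close>;
  the values of \<open>\<rho>\<close> off \<open>V\<close> are irrelevant. Hence a submodule is a subset that is a module for
  the same \<open>\<rho>\<close>. The type \<open>'l uea\<close> is large enough to carry, up to isomorphism, every cyclic
  module: a quotient by a left ideal is linearly isomorphic to a complement of that ideal.
\<close>

definition lie_module :: "'v::complex_vector set \<Rightarrow> ('l::complex_lie_algebra \<Rightarrow> 'v \<Rightarrow> 'v) \<Rightarrow> bool"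
  where "lie_module V \<rho> \<longleftrightarrow> complex_vector.subspace V \<and>
    (\<forall>x. \<forall>v\<in>V. \<rho> x v \<in> V) \<and>
    (\<forall>x. \<forall>v\<in>V. \<forall>w\<in>V. \<rho> x (v + w) = \<rho> x v + \<rho> x w) \<and>
    (\<forall>x c. \<forall>v\<in>V. \<rho> x (c *\<^sub>C v) = c *\<^sub>C \<rho> x v) \<and>
    (\<forall>x y. \<forall>v\<in>V. \<rho> (x + y) v = \<rho> x v + \<rho> y v) \<and>
    (\<forall>x c. \<forall>v\<in>V. \<rho> (c *\<^sub>C x) v = c *\<^sub>C \<rho> x v) \<and>
    (\<forall>x y. \<forall>v\<in>V. \<rho> (bracket x y) v = \<rho> x (\<rho> y v) - \<rho> y (\<rho> x v))"

definition lie_submodule ::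
    "'v::complex_vector set \<Rightarrow> 'v set \<Rightarrow> ('l::complex_lie_algebra \<Rightarrow> 'v \<Rightarrow> 'v) \<Rightarrow> bool"
  where "lie_submodule W V \<rho> \<longleftrightarrow> W \<subseteq> V \<and> lie_module W \<rho>"

definition simple_module :: "'v::complex_vector set \<Rightarrow> ('l::complex_lie_algebra \<Rightarrow> 'v \<Rightarrow> 'v) \<Rightarrow> bool"
  where "simple_module V \<rho> \<longleftrightarrow> lie_module V \<rho> \<and> V \<noteq> {0} \<and>
    (\<forall>W. lie_submodule W V \<rho> \<longrightarrow> W = {0} \<or> W = V)"

definition module_iso ::
    "'v::complex_vector set \<Rightarrow> ('l::complex_lie_algebra \<Rightarrow> 'v \<Rightarrow> 'v) \<Rightarrow>
     'w::complex_vector set \<Rightarrow> ('l \<Rightarrow> 'w \<Rightarrow> 'w) \<Rightarrow> bool"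
  where "module_iso V \<rho> W \<sigma> \<longleftrightarrow> (\<exists>f. bij_betw f V W \<and>
    (\<forall>v\<in>V. \<forall>w\<in>V. f (v + w) = f v + f w) \<and>
    (\<forall>c. \<forall>v\<in>V. f (c *\<^sub>C v) = c *\<^sub>C f v) \<and>
    (\<forall>x. \<forall>v\<in>V. f (\<rho> x v) = \<sigma> x (f v)))"

text \<open>The trivial module, of any Lie algebra, lives on \<open>UNIV :: complex set\<close>.\<close>

definition trivial_action :: "'l::complex_lie_algebra \<Rightarrow> complex \<Rightarrow> complex"
  where "trivial_action x z = 0"

definition restrict_to_g :: "('g::complex_lie_algebra takiff \<Rightarrow> 'v \<Rightarrow> 'v) \<Rightarrow> 'g \<Rightarrow> 'v \<Rightarrow> 'v"
  where "restrict_to_g \<rho> x = \<rho> (takiff_tensor x 0)"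

definition free_act ::
    "('l::complex_lie_algebra \<Rightarrow> 'v::complex_vector \<Rightarrow> 'v) \<Rightarrow> 'l free_algebra \<Rightarrow> 'v \<Rightarrow> 'v"
  where "free_act \<rho> f v =
    (\<Sum>w\<in>Poly_Mapping.keys f. Poly_Mapping.lookup f w *\<^sub>C foldr \<rho> (letters w) v)"

text \<open>
  The extension of a Lie algebra action to the enveloping algebra. On a module it does not depend
  on the representative, see \<open>uea_act_abs\<close> below.
\<close>

definition uea_act ::
    "('l::complex_lie_algebra \<Rightarrow> 'v::complex_vector \<Rightarrow> 'v) \<Rightarrow> 'l uea \<Rightarrow> 'v \<Rightarrow> 'v"
  where "uea_act \<rho> u v = free_act \<rho> (rep_uea u) v"

definition acts_via ::
    "('g::complex_lie_algebra takiff uea \<Rightarrow> complex) \<Rightarrow> 'v::complex_vector set \<Rightarrow>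
     ('g takiff \<Rightarrow> 'v \<Rightarrow> 'v) \<Rightarrow> bool"
  where "acts_via \<chi> V \<rho> \<longleftrightarrow> (\<forall>z\<in>takiff_center. \<forall>v\<in>V. uea_act \<rho> z v = \<chi> z *\<^sub>C v)"

definition contains_trivial ::
    "'v::complex_vector set \<Rightarrow> ('g::complex_lie_algebra takiff \<Rightarrow> 'v \<Rightarrow> 'v) \<Rightarrow> bool"
  where "contains_trivial V \<rho> \<longleftrightarrow> (\<exists>W. lie_submodule W V (restrict_to_g \<rho>) \<and>
    module_iso W (restrict_to_g \<rho>) (UNIV :: complex set) trivial_action)"

definition internal_direct_sum :: "'v::complex_vector set set \<Rightarrow> 'v set \<Rightarrow> bool"
  where "internal_direct_sum \<W> V \<longleftrightarrow> complex_vector.span (\<Union>\<W>) = V \<and>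
    (\<forall>W\<in>\<W>. W \<inter> complex_vector.span (\<Union>(\<W> - {W})) = {0})"

definition harish_chandra ::
    "'v::complex_vector set \<Rightarrow> ('g::complex_lie_algebra takiff \<Rightarrow> 'v \<Rightarrow> 'v) \<Rightarrow> bool"
  where "harish_chandra V \<rho> \<longleftrightarrow> lie_module V \<rho> \<and> (\<exists>\<W>. internal_direct_sum \<W> V \<and>
    (\<forall>W\<in>\<W>. simple_module W (restrict_to_g \<rho>) \<and> finite_dim W \<and>
      finite {W'\<in>\<W>. module_iso W' (restrict_to_g \<rho>) W (restrict_to_g \<rho>)}))"


subsection \<open>The action of the enveloping algebra is well defined\<close>

context
  fixes V :: "'v::complex_vector set" and \<rho> :: "'l::complex_lie_algebra \<Rightarrow> 'v \<Rightarrow> 'v"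
  assumes V: "lie_module V \<rho>"
begin

lemma foldr_mem: "v \<in> V \<Longrightarrow> foldr \<rho> xs v \<in> V"
  using V by (induction xs) (auto simp: lie_module_def)

lemma foldr_add: "v \<in> V \<Longrightarrow> w \<in> V \<Longrightarrow> foldr \<rho> xs (v + w) = foldr \<rho> xs v + foldr \<rho> xs w"
  using V by (induction xs) (auto simp: lie_module_def foldr_mem)

lemma foldr_scaleC: "v \<in> V \<Longrightarrow> foldr \<rho> xs (c *\<^sub>C v) = c *\<^sub>C foldr \<rho> xs v"
  using V by (induction xs) (auto simp: lie_module_def foldr_mem)

lemma free_act_mem: "v \<in> V \<Longrightarrow> free_act \<rho> f v \<in> V"
  using V unfolding free_act_def lie_module_def
  by (intro complex_vector.subspace_sum complex_vector.subspace_scale foldr_mem) auto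

lemma free_act_superset:
  assumes "finite A" "Poly_Mapping.keys f \<subseteq> A"
  shows "free_act \<rho> f v = (\<Sum>w\<in>A. Poly_Mapping.lookup f w *\<^sub>C foldr \<rho> (letters w) v)"
  unfolding free_act_def using assms
  by (intro sum.mono_neutral_left) (auto simp: in_keys_iff)

lemma free_act_add: "free_act \<rho> (f + g) v = free_act \<rho> f v + free_act \<rho> g v"
proof -
  let ?A = "Poly_Mapping.keys f \<union> Poly_Mapping.keys g"
  have "free_act \<rho> h v = (\<Sum>w\<in>?A. Poly_Mapping.lookup h w *\<^sub>C foldr \<rho> (letters w) v)"
    if "h \<in> {f, g, f + g}" for h
    using that keys_add[of f g] by (intro free_act_superset) auto
  then show ?thesis
    by (simp add: lookup_add scaleC_add_left sum.distrib)
qed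

lemma free_act_diff: "free_act \<rho> (f - g) v = free_act \<rho> f v - free_act \<rho> g v"
  using free_act_add[of "f - g" g v] by (simp add: algebra_simps)

lemma free_act_single: "free_act \<rho> (Poly_Mapping.single w c) v = c *\<^sub>C foldr \<rho> (letters w) v"
  by (simp add: free_act_def)

lemma free_act_add_arg:
  "v \<in> V \<Longrightarrow> w \<in> V \<Longrightarrow> free_act \<rho> f (v + w) = free_act \<rho> f v + free_act \<rho> f w"
  by (simp add: free_act_def foldr_add scaleC_add_right sum.distrib)

lemma free_algebra_induct [case_names single add]:
  assumes "\<And>w c. P (Poly_Mapping.single w c)" "\<And>f g. P f \<Longrightarrow> P g \<Longrightarrow> P (f + g)"
  shows "P (f :: 'l free_algebra)"
proof (induction f rule: update_induct)
  case const
  show ?case using assms(1)[of 0 0] by simp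
next
  case (update f a b)
  have "Poly_Mapping.update a b f = f + Poly_Mapping.single a b"
    using update(1)
    by (intro poly_mapping_eqI) (auto simp: lookup_add lookup_single lookup_update in_keys_iff)
  then show ?case using assms update by metis
qed

lemma free_act_mult:
  assumes "v \<in> V"
  shows "free_act \<rho> (f * g) v = free_act \<rho> f (free_act \<rho> g v)"
proof (induction f rule: free_algebra_induct)
  case (single a c)
  show ?case
  proof (induction g rule: free_algebra_induct)
    case (single b d)
    show ?case
      by (simp add: mult_single free_act_single plus_free_monoid_def foldr_scaleC foldr_mem assms
        scaleC_scaleC)
  next
    case (add g h)
    then show ?case
      by (simp add: distrib_left free_act_add free_act_add_arg free_act_mem assms)
  qed
next
  case (add f h)
  then show ?case by (simp add: distrib_right free_act_add)
qed

lemma free_act_ideal: "f \<in> uea_ideal \<Longrightarrow> v \<in> V \<Longrightarrow> free_act \<rho> f v = 0"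
proof (induction arbitrary: v rule: uea_ideal.induct)
  case (mult_left f h)
  have "free_act \<rho> h 0 = 0"
    using free_act_add_arg[of 0 0 h] V by (simp add: lie_module_def complex_vector.subspace_0)
  then show ?case using mult_left by (simp add: free_act_mult)
qed (use V in \<open>auto simp: lie_module_def free_act_add free_act_diff free_act_mult free_act_mem
      free_act_single free_gen_def free_const_def zero_free_monoid_def scaleC_one\<close>)

lemma uea_act_abs: "v \<in> V \<Longrightarrow> uea_act \<rho> (abs_uea f) v = free_act \<rho> f v"
proof -
  assume "v \<in> V"
  have "f - rep_uea (abs_uea f) \<in> uea_ideal"
    by (rule rep_abs_rsp[OF Quotient3_uea]) (simp add: uea_ideal_zero)
  then have "free_act \<rho> (f - rep_uea (abs_uea f)) v = 0"
    using \<open>v \<in> V\<close> by (rule free_act_ideal)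
  then show ?thesis by (simp add: uea_act_def free_act_diff)
qed

lemma uea_act_gen: "v \<in> V \<Longrightarrow> uea_act \<rho> (uea_gen x) v = \<rho> x v"
  by (simp add: uea_gen.abs_eq uea_act_abs free_gen_def free_act_single scaleC_one)

end

end

theory Submission
  imports Defs "HOL-Library.Function_Algebras" "HOL-Computational_Algebra.Fundamental_Theorem_Algebra"
    "HOL-Analysis.Continuum_Not_Denumerable"
begin

text \<open>
  Let \<open>S\<close> be the commutative subalgebra generated by \<open>gbar\<close>. It is a Takiff module on which \<open>g\<close> acts by
  commutators and \<open>gbar\<close> by multiplication, and it is locally finite over \<open>g\<close>; no PBW theorem is needed. By
  Weyl's theorem \<open>S = S\<^sup>g \<oplus> g S\<close> with a Reynolds projection \<open>R\<close> onto \<open>S\<^sup>g\<close>, which is the purely Takiff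
  part of the center. The elements \<open>f\<close> with \<open>\<chi> (R (f h)) = 0\<close> for all \<open>h\<close> form a maximal \<open>g\<close>-stable
  ideal \<open>M\<close>, and \<open>V = S/M\<close>. In any simple module of the required kind, generated by a \<open>g\<close>-invariant vector
  \<open>w\<close>, the annihilator of \<open>w\<close> in \<open>S\<close> is again \<open>M\<close>, whence uniqueness. Multiplicities are finite because
  a character of \<open>S\<close> that kills \<open>M\<close> embeds \<open>Hom\<^sub>g(L, V)\<close> into the dual of \<open>L\<close>. If \<open>V\<close> has finite dimension,
  then \<open>gbar\<close> acts by nilpotent operators, so this character, and with it \<open>\<chi>\<close>, is trivial on \<open>gbar\<close>.
\<close>

section \<open>Linear algebra\<close>

text \<open>The bridge from an arbitrary module to \<open>S\<close> is the orbit map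
  \<open>f \<mapsto> f w\<close>. Since \<open>g\<close> kills \<open>w\<close>, one has
  \<open>x (f w) = (ad x f) w\<close>, so the map is a homomorphism of Takiff modules; its image is
  a nonzero submodule and its kernel an \<open>ad\<close>-stable ideal. This is why the
  classification takes place inside \<open>S\<close>, of which three features enter: it is
  commutative, generated by \<open>gbar\<close>, and exhausted by finite-dimensional
  \<open>ad\<close>-stable subspaces.

  The obstacle is that semisimplicity is given as the absence of nonzero solvable ideals, whereas
  the Reynolds projection rests on complete reducibility. Cartan's criterion, with its eigenspaces
  and traces, and the Casimir operators bridge this gap.

  The character of \<open>S\<close> that kills \<open>M\<close> cannot be read off from
  \<open>\<chi>\<close>, which lives on invariants only. It comes from the size of the field:
  \<open>S\<close> has countable dimension and the complex numbers are uncountable. Its kernel is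
  usually not \<open>g\<close>-stable, and the largest \<open>g\<close>-stable ideal inside the
  kernel is \<open>M\<close>; so this single functional detects every nonzero
  \<open>g\<close>-submodule of \<open>V\<close>.\<close>

abbreviation "cspan \<equiv> complex_vector.span"
abbreviation "csubspace \<equiv> complex_vector.subspace"
abbreviation "cindependent \<equiv> complex_vector.independent"
abbreviation "cdim \<equiv> complex_vector.dim"

interpretation cv_pair: vector_space_pair
  "scaleC :: complex \<Rightarrow> 'a \<Rightarrow> 'a::complex_vector" "scaleC :: complex \<Rightarrow> 'b \<Rightarrow> 'b::complex_vector"
  by unfold_locales

lemma subspace_lincomb:
  assumes "csubspace V" "\<And>i. i \<in> A \<Longrightarrow> g i \<in> V"
  shows "(\<Sum>i\<in>A. c i *\<^sub>C g i) \<in> V"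
  by (rule complex_vector.subspace_sum[OF assms(1)]) (use assms in \<open>auto intro: complex_vector.subspace_scale\<close>)

text \<open>More unknowns (\<open>A\<close>) than equations (\<open>F\<close>): Gaussian elimination
  by induction on the equations. The coefficients are bare functions, so the lemma also applies to
  coordinates of a family of vectors in which repetitions may occur.\<close>

lemma homogeneous_system:
  fixes a :: "'i \<Rightarrow> 'j \<Rightarrow> complex"
  assumes "finite F" "finite A" "card F < card A"
  shows "\<exists>c. (\<exists>i\<in>A. c i \<noteq> 0) \<and> (\<forall>j\<in>F. (\<Sum>i\<in>A. c i * a i j) = 0)"
  using assms
proof (induction F arbitrary: A a rule: finite_induct)
  case empty
  then obtain i where "i \<in> A" by fastforce
  then show ?case by (intro exI[of _ "\<lambda>_. 1"]) auto
next
  case (insert k F)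
  show ?case
  proof (cases "\<forall>i\<in>A. a i k = 0")
    case True
    have "card F < card A" using insert by simp
    from insert.IH[OF insert.prems(1) this, of a] obtain c where
      "\<exists>i\<in>A. c i \<noteq> 0" "\<forall>j\<in>F. (\<Sum>i\<in>A. c i * a i j) = 0" by blast
    then show ?thesis using True by (intro exI[of _ c]) auto
  next
    case False
    then obtain l where l: "l \<in> A" "a l k \<noteq> 0" by blast
    \<comment> \<open>Equation \<open>j\<close> minus the multiple of equation \<open>k\<close> that
      removes the unknown \<open>l\<close>.\<close>
    define b where "b i j = a i j - a i k / a l k * a l j" for i j
    have "card F < card (A - {l})" using insert l by simp
    from insert.IH[OF _ this, of b] insert.prems obtain c where
      c: "\<exists>i\<in>A - {l}. c i \<noteq> 0" "\<forall>j\<in>F. (\<Sum>i\<in>A - {l}. c i * b i j) = 0"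
      by auto
    \<comment> \<open>The removed unknown gets the value that equation \<open>k\<close> forces on
      it.\<close>
    define d where "d = c(l := - (\<Sum>i\<in>A - {l}. c i * a i k) / a l k)"
    have eq: "(\<Sum>i\<in>A. d i * a i j) = (\<Sum>i\<in>A - {l}. c i * b i j)" for j
    proof -
      have "(\<Sum>i\<in>A. d i * a i j) = d l * a l j + (\<Sum>i\<in>A - {l}. c i * a i j)"
        using insert.prems(1) l by (subst sum.remove[of _ l]) (auto simp: d_def intro!: sum.cong)
      also have "\<dots> = (\<Sum>i\<in>A - {l}. c i * b i j)"
        by (simp add: d_def b_def sum_subtractf right_diff_distrib sum_distrib_right sum_divide_distrib
            mult.assoc)
      finally show ?thesis .
    qed
    have "(\<Sum>i\<in>A - {l}. c i * b i k) = 0"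
      using l by (simp add: b_def)
    moreover have "\<exists>i\<in>A. d i \<noteq> 0" using c(1) by (auto simp: d_def)
    ultimately show ?thesis using c(2) by (intro exI[of _ d]) (auto simp: eq)
  qed
qed

section \<open>Bases and dimension of finite-dimensional subspaces\<close>

lemma finite_dim_basis:
  assumes "finite_dim V"
  obtains B where "finite B" "cindependent B" "cspan B = V" "card B = cdim V"
proof -
  obtain F where F: "finite F" "cspan F = V" using assms by (auto simp: finite_dim_def)
  obtain B where B: "B \<subseteq> F" "cindependent B" "F \<subseteq> cspan B"
    by (rule complex_vector.maximal_independent_subset)
  have "cspan B = V"
    using B F by (metis complex_vector.span_eq complex_vector.span_superset subset_trans)
  moreover have "finite B" using B F finite_subset by blast
  ultimately show ?thesis using B complex_vector.dim_span_eq_card_independent that by metis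
qed

lemma finite_dim_subspace: "finite_dim V \<Longrightarrow> csubspace V"
  unfolding finite_dim_def by (metis complex_vector.subspace_span)

lemma finite_dim_span: "finite B \<Longrightarrow> finite_dim (cspan B)"
  unfolding finite_dim_def by blast

lemma subspace_basis:
  assumes "finite_dim V" "csubspace U" "U \<subseteq> V"
  obtains B where "finite B" "cindependent B" "cspan B = U" "card B = cdim U"
proof -
  obtain C where C: "finite C" "cspan C = V" using assms by (auto simp: finite_dim_def)
  obtain B where B: "B \<subseteq> U" "cindependent B" "U \<subseteq> cspan B"
    by (rule complex_vector.maximal_independent_subset)
  have sp: "cspan B = U" using B assms
    by (simp add: complex_vector.span_subspace)
  have "finite B" using complex_vector.independent_span_bound[OF C(1) B(2)] B C assms by blast
  then show ?thesis using B sp complex_vector.dim_span_eq_card_independent that by metis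
qed

lemma finite_dim_subset:
  assumes "finite_dim V" "csubspace U" "U \<subseteq> V"
  shows "finite_dim U"
  using subspace_basis[OF assms] unfolding finite_dim_def by metis

lemma dim_strict_mono:
  assumes "finite_dim V" "csubspace U" "U \<subset> V"
  shows "cdim U < cdim V"
proof -
  obtain B where B: "finite B" "cindependent B" "cspan B = U" "card B = cdim U"
    using subspace_basis[of V U] assms by blast
  obtain C where C: "finite C" "cindependent C" "cspan C = V" "card C = cdim V"
    using finite_dim_basis assms by blast
  obtain v where v: "v \<in> V" "v \<notin> U" using assms by blast
  have ins: "cindependent (insert v B)"
    using B v by (intro complex_vector.independent_insertI) auto
  have "insert v B \<subseteq> cspan C" using B C v assms complex_vector.span_superset by blast
  from complex_vector.independent_span_bound[OF C(1) ins this] have "card (insert v B) \<le> card C" by blast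
  moreover have "v \<notin> B" using v B complex_vector.span_base by blast
  ultimately show ?thesis using B C by simp
qed

text \<open>The values on a basis turn the functionals into a homogeneous system; independence of
  \<open>B\<close> makes a nontrivial solution a nonzero vector.\<close>

lemma common_zero:
  assumes "finite F" "finite B" "card F < card B" "cindependent B"
    and lin: "\<And>\<phi> u v. \<phi> \<in> F \<Longrightarrow> u \<in> cspan B \<Longrightarrow> v \<in> cspan B \<Longrightarrow> \<phi> (u + v) = \<phi> u + \<phi> v"
      "\<And>\<phi> c v. \<phi> \<in> F \<Longrightarrow> v \<in> cspan B \<Longrightarrow> \<phi> (c *\<^sub>C v) = c * \<phi> v"
  shows "\<exists>v\<in>cspan B. v \<noteq> 0 \<and> (\<forall>\<phi>\<in>F. \<phi> v = (0::complex))"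
proof -
  obtain c where c: "\<exists>i\<in>B. c i \<noteq> 0" "\<forall>\<phi>\<in>F. (\<Sum>b\<in>B. c b * \<phi> b) = 0"
    using homogeneous_system[OF assms(1-3), of "\<lambda>b \<phi>. \<phi> b"] by blast
  let ?v = "\<Sum>b\<in>B. c b *\<^sub>C b"
  have "?v \<noteq> 0"
    using c(1) complex_vector.independentD[OF assms(4,2) order_refl, of c] by auto
  moreover have "?v \<in> cspan B"
    by (rule subspace_lincomb) (auto intro: complex_vector.span_base)
  moreover have "\<phi> ?v = 0" if "\<phi> \<in> F" for \<phi>
  proof -
    have z: "\<phi> 0 = 0" using lin(2)[OF that complex_vector.span_zero, of 0] by simp
    have "\<phi> (\<Sum>b\<in>B'. c b *\<^sub>C b) = (\<Sum>b\<in>B'. c b * \<phi> b)" if "B' \<subseteq> B" for B'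
      using finite_subset[OF that assms(2)] that
    proof (induction B' rule: finite_induct)
      case empty
      then show ?case using z by simp
    next
      case (insert b B')
      have b: "b \<in> cspan B" using insert by (auto intro: complex_vector.span_base)
      moreover have "c b *\<^sub>C b \<in> cspan B" using b by (rule complex_vector.span_scale)
      moreover have "(\<Sum>b\<in>B'. c b *\<^sub>C b) \<in> cspan B"
        using insert by (intro subspace_lincomb) (auto intro: complex_vector.span_base)
      ultimately show ?case using insert lin(1)[OF \<open>\<phi> \<in> F\<close>] lin(2)[OF \<open>\<phi> \<in> F\<close>] by simp
    qed
    then show ?thesis using c that by simp
  qed
  ultimately show ?thesis by blast
qed

text \<open>Linearity relative to a carrier: the action of a module is meaningful on its carrier
  only, so linearity on the whole type cannot be assumed.\<close>

definition lin_on :: "'v::complex_vector set \<Rightarrow> ('v \<Rightarrow> 'w::complex_vector) \<Rightarrow> bool"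
  where "lin_on V f \<longleftrightarrow> (\<forall>v\<in>V. \<forall>w\<in>V. f (v + w) = f v + f w) \<and> (\<forall>c. \<forall>v\<in>V. f (c *\<^sub>C v) = c *\<^sub>C f v)"

lemma lin_on_add: "lin_on V f \<Longrightarrow> v \<in> V \<Longrightarrow> w \<in> V \<Longrightarrow> f (v + w) = f v + f w"
  and lin_on_scale: "lin_on V f \<Longrightarrow> v \<in> V \<Longrightarrow> f (c *\<^sub>C v) = c *\<^sub>C f v"
  unfolding lin_on_def by auto

lemma lin_on_subset: "lin_on V f \<Longrightarrow> U \<subseteq> V \<Longrightarrow> lin_on U f"
  unfolding lin_on_def by blast

lemma lin_on_zero: "lin_on V f \<Longrightarrow> csubspace V \<Longrightarrow> f 0 = 0"
  using lin_on_scale[of V f 0 0] complex_vector.subspace_0 by fastforce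

lemma lin_on_diff: "lin_on V f \<Longrightarrow> csubspace V \<Longrightarrow> v \<in> V \<Longrightarrow> w \<in> V \<Longrightarrow> f (v - w) = f v - f w"
  using lin_on_add[of V f "v - w" w] complex_vector.subspace_diff by fastforce

lemma lin_on_sum:
  assumes "lin_on V f" "csubspace V" "\<And>i. i \<in> A \<Longrightarrow> g i \<in> V"
  shows "f (\<Sum>i\<in>A. g i) = (\<Sum>i\<in>A. f (g i))"
  using assms(3)
proof (induction A rule: infinite_finite_induct)
  case (insert i A)
  then have "(\<Sum>i\<in>A. g i) \<in> V" using assms(2) by (auto intro: complex_vector.subspace_sum)
  then show ?case using insert assms(1) by (simp add: lin_on_add)
qed (use assms lin_on_zero in auto)

lemma lin_on_sum_scale:
  assumes "lin_on V f" "csubspace V" "\<And>i. i \<in> A \<Longrightarrow> g i \<in> V"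
  shows "f (\<Sum>i\<in>A. c i *\<^sub>C g i) = (\<Sum>i\<in>A. c i *\<^sub>C f (g i))"
  using assms lin_on_sum[OF assms(1,2), of A "\<lambda>i. c i *\<^sub>C g i"]
  by (simp add: complex_vector.subspace_scale lin_on_scale)

lemma lin_on_image_subspace:
  assumes "lin_on V f" "csubspace V"
  shows "csubspace (f ` V)"
proof (rule complex_vector.subspaceI)
  show "0 \<in> f ` V" using lin_on_zero[OF assms] complex_vector.subspace_0[OF assms(2)] by force
  fix x y c assume "x \<in> f ` V" "y \<in> f ` V"
  then obtain v w where vw: "v \<in> V" "w \<in> V" "x = f v" "y = f w" by blast
  then show "x + y \<in> f ` V"
    using lin_on_add[OF assms(1)] complex_vector.subspace_add[OF assms(2), of v w] by (metis image_eqI)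
  show "c *\<^sub>C x \<in> f ` V"
    using vw lin_on_scale[OF assms(1)] complex_vector.subspace_scale[OF assms(2), of v c] by (metis image_eqI)
qed

lemma lin_on_ext_span:
  assumes "lin_on (cspan B) f" "lin_on (cspan B) g" "\<And>b. b \<in> B \<Longrightarrow> f b = g b" "v \<in> cspan B"
  shows "f v = g v"
proof -
  have "v \<in> cspan B \<and> f v = g v"
    using assms(4)
  proof (induction rule: complex_vector.span_induct_alt)
    case base
    show ?case using lin_on_zero[OF assms(1)] lin_on_zero[OF assms(2)] by (simp add: complex_vector.span_zero)
  next
    case (step c x y)
    have x: "x \<in> cspan B" using step(1) by (rule complex_vector.span_base)
    then have "c *\<^sub>C x \<in> cspan B" by (rule complex_vector.span_scale)
    then show ?case
      using x step assms(3)[OF step(1)] lin_on_add[OF assms(1)] lin_on_scale[OF assms(1) x]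
        lin_on_add[OF assms(2)] lin_on_scale[OF assms(2) x] complex_vector.span_add by metis
  qed
  then show ?thesis ..
qed

lemma lin_on_comp:
  "lin_on V f \<Longrightarrow> f ` V \<subseteq> W \<Longrightarrow> lin_on W g \<Longrightarrow> lin_on V (\<lambda>v. g (f v))"
  unfolding lin_on_def image_subset_iff by simp

lemma lin_on_plus: "lin_on V f \<Longrightarrow> lin_on V g \<Longrightarrow> lin_on V (\<lambda>v. f v + g v)"
  unfolding lin_on_def by (simp add: scaleC_add_right)

lemma lin_on_minus_fun: "lin_on V f \<Longrightarrow> lin_on V g \<Longrightarrow> lin_on V (\<lambda>v. f v - g v)"
  unfolding lin_on_def by (simp add: complex_vector.scale_right_diff_distrib)

lemma lin_on_scale_fun: "lin_on V f \<Longrightarrow> lin_on V (\<lambda>v. c *\<^sub>C f v)"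
  unfolding lin_on_def by (simp add: scaleC_add_right scaleC_scaleC mult.commute)

lemma lin_on_ident: "lin_on V (\<lambda>v. v)"
  unfolding lin_on_def by simp

lemma linear_lin_on: "Vector_Spaces.linear scaleC scaleC f \<Longrightarrow> lin_on V f"
  unfolding lin_on_def by (simp add: cv_pair.linear_add cv_pair.linear_scale)

text \<open>If the image were proper, its basis \<open>C\<close> would be smaller than
  \<open>B\<close>. The \<open>C\<close>-coordinates of the vectors \<open>f b\<close> then give
  fewer equations than unknowns, and a nontrivial solution is a nonzero vector of the
  kernel.\<close>

lemma injective_endo_surj:
  assumes "finite_dim V" "lin_on V f" "f ` V \<subseteq> V" "\<And>v. v \<in> V \<Longrightarrow> f v = 0 \<Longrightarrow> v = 0"
  shows "f ` V = V"
proof (rule ccontr)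
  assume "f ` V \<noteq> V"
  have sV: "csubspace V" using assms finite_dim_subspace by blast
  obtain B where B: "finite B" "cindependent B" "cspan B = V" "card B = cdim V"
    using finite_dim_basis assms by blast
  have BV: "B \<subseteq> V" using B complex_vector.span_superset by blast
  obtain C where C: "finite C" "cindependent C" "cspan C = f ` V" "card C = cdim (f ` V)"
    using subspace_basis[OF assms(1) lin_on_image_subspace[OF assms(2) sV] assms(3)] by blast
  have lt: "card C < card B"
    using B C dim_strict_mono[of V "f ` V"] assms lin_on_image_subspace[OF assms(2) sV] \<open>f ` V \<noteq> V\<close> by auto
  obtain c where c: "\<exists>b\<in>B. c b \<noteq> 0"
    "\<forall>d\<in>C. (\<Sum>b\<in>B. c b * complex_vector.representation C (f b) d) = 0"
    using homogeneous_system[OF C(1) B(1) lt, of "\<lambda>b d. complex_vector.representation C (f b) d"] by blast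
  let ?v = "\<Sum>b\<in>B. c b *\<^sub>C b"
  have fb: "f b = (\<Sum>d\<in>C. complex_vector.representation C (f b) d *\<^sub>C d)" if "b \<in> B" for b
    using complex_vector.sum_representation_eq[OF C(2) _ C(1), of "f b"] C(3) BV that by auto
  have "f ?v = (\<Sum>b\<in>B. c b *\<^sub>C f b)"
    by (rule lin_on_sum_scale[OF assms(2) sV]) (use BV in auto)
  also have "\<dots> = (\<Sum>b\<in>B. \<Sum>d\<in>C. (c b * complex_vector.representation C (f b) d) *\<^sub>C d)"
    by (rule sum.cong[OF refl], subst fb) (auto simp: complex_vector.scale_sum_right scaleC_scaleC)
  also have "\<dots> = (\<Sum>d\<in>C. (\<Sum>b\<in>B. c b * complex_vector.representation C (f b) d) *\<^sub>C d)"
    by (subst sum.swap) (simp add: complex_vector.scale_sum_left)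
  also have "\<dots> = 0" using c(2) by simp
  finally have "f ?v = 0" .
  moreover have "?v \<in> V" using BV sV by (intro subspace_lincomb) auto
  ultimately have "?v = 0" using assms by blast
  then show False using c(1) complex_vector.independentD[OF B(2,1) order_refl, of c] by auto
qed

text \<open>A quotient inside the same type: the complement \<open>C\<close> stands for
  \<open>S/M\<close> and \<open>\<pi>\<close> for the class map. \<open>\<pi>\<close> is linear on
  the whole type, but its kernel and its values are controlled on \<open>S\<close> only.\<close>

lemma complement_projection:
  fixes S :: "'v::complex_vector set"
  assumes "csubspace M" "csubspace S" "M \<subseteq> S"
  obtains C \<pi> where "csubspace C" "C \<subseteq> S" "Vector_Spaces.linear scaleC scaleC \<pi>"
    "\<And>v. v \<in> S \<Longrightarrow> \<pi> v \<in> C" "\<And>v. v \<in> C \<Longrightarrow> \<pi> v = v" "\<And>v. v \<in> S \<Longrightarrow> v - \<pi> v \<in> M"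
    "\<And>v. v \<in> S \<Longrightarrow> \<pi> v = 0 \<longleftrightarrow> v \<in> M"
proof -
  obtain A where A: "A \<subseteq> M" "cindependent A" "M \<subseteq> cspan A"
    by (rule complex_vector.maximal_independent_subset)
  obtain B where B: "A \<subseteq> B" "B \<subseteq> S" "cindependent B" "S \<subseteq> cspan B"
    using complex_vector.maximal_independent_subset_extend[OF _ A(2)] A assms by (metis subset_trans)
  obtain \<pi> :: "'v \<Rightarrow> 'v" where \<pi>: "Vector_Spaces.linear scaleC scaleC \<pi>" "\<And>b. b \<in> B \<Longrightarrow> \<pi> b = (if b \<in> A then 0 else b)"
    using cv_pair.linear_independent_extend[OF B(3), of "\<lambda>b. if b \<in> A then 0 else b"] by metis
  define C where "C = cspan (B - A)"
  have spA: "cspan A = M" and spB: "cspan B = S"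
    by (rule complex_vector.span_subspace[OF A(1,3) assms(1)])
      (rule complex_vector.span_subspace[OF B(2,4) assms(2)])
  have 1: "C \<subseteq> S" unfolding C_def using spB complex_vector.span_mono by blast
  have 2: "\<pi> v = v" if "v \<in> C" for v
    by (rule lin_on_ext_span[of "B - A", OF linear_lin_on[OF \<pi>(1)] lin_on_ident])
      (use that \<pi> in \<open>auto simp: C_def\<close>)
  have 3: "\<pi> v = 0" if "v \<in> M" for v
    using that cv_pair.linear_eq_0_on_span[OF \<pi>(1), of A v] \<pi>(2) B(1) spA by (auto simp: subset_iff)
  have 4: "v - \<pi> v \<in> M \<and> \<pi> v \<in> C" if "v \<in> S" for v
    using that unfolding spB[symmetric]
  proof (induction rule: complex_vector.span_induct_alt)
    case base
    then show ?case using cv_pair.linear_0[OF \<pi>(1)] assms C_def complex_vector.subspace_0 by auto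
  next
    case (step c x y)
    have "x - \<pi> x \<in> M \<and> \<pi> x \<in> C"
      using \<pi>(2)[OF step(1)] A(1) assms step(1)
      by (auto simp: C_def complex_vector.subspace_0 complex_vector.span_zero intro: complex_vector.span_base)
    moreover have eq: "c *\<^sub>C x + y - \<pi> (c *\<^sub>C x + y) = c *\<^sub>C (x - \<pi> x) + (y - \<pi> y)"
      by (simp add: cv_pair.linear_add[OF \<pi>(1)] cv_pair.linear_scale[OF \<pi>(1)] complex_vector.scale_right_diff_distrib)
    moreover have "\<pi> (c *\<^sub>C x + y) = c *\<^sub>C \<pi> x + \<pi> y"
      by (simp add: cv_pair.linear_add[OF \<pi>(1)] cv_pair.linear_scale[OF \<pi>(1)])
    moreover have "csubspace C" by (simp add: C_def)
    ultimately show ?case using step.IH assms(1) unfolding eq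
      by (simp add: complex_vector.subspace_add complex_vector.subspace_scale)
  qed
  have 5: "\<pi> v = 0 \<longleftrightarrow> v \<in> M" if "v \<in> S" for v
    using 4[OF that] 3 by auto
  show ?thesis using that[of C \<pi>] 1 2 4 5 \<pi>(1) by (simp add: C_def)
qed

section \<open>Traces of operators\<close>

definition trace_on :: "'v::complex_vector set \<Rightarrow> ('v \<Rightarrow> 'v) \<Rightarrow> complex"
  where "trace_on B f = (\<Sum>b\<in>B. complex_vector.representation B (f b) b)"

lemma trace_on_cong: "(\<And>b. b \<in> B \<Longrightarrow> f b = g b) \<Longrightarrow> trace_on B f = trace_on B g"
  unfolding trace_on_def by simp

lemma trace_on_add:
  assumes "cindependent B" "f ` B \<subseteq> cspan B" "g ` B \<subseteq> cspan B"
  shows "trace_on B (\<lambda>v. f v + g v) = trace_on B f + trace_on B g"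
  unfolding trace_on_def sum.distrib[symmetric]
  by (rule sum.cong) (use assms in \<open>auto simp: complex_vector.representation_add image_subset_iff\<close>)

lemma trace_on_diff:
  assumes "cindependent B" "f ` B \<subseteq> cspan B" "g ` B \<subseteq> cspan B"
  shows "trace_on B (\<lambda>v. f v - g v) = trace_on B f - trace_on B g"
  unfolding trace_on_def sum_subtractf[symmetric]
  by (rule sum.cong) (use assms in \<open>auto simp: complex_vector.representation_diff image_subset_iff\<close>)

lemma trace_on_scale:
  assumes "cindependent B" "f ` B \<subseteq> cspan B"
  shows "trace_on B (\<lambda>v. c *\<^sub>C f v) = c * trace_on B f"
  unfolding trace_on_def sum_distrib_left
  by (rule sum.cong) (use assms in \<open>auto simp: complex_vector.representation_scale image_subset_iff\<close>)

text \<open>Both traces are the same double sum of products of matrix entries of \<open>f\<close>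
  and \<open>g\<close>. The two spaces may differ: with an inclusion as one of the maps, the lemma
  yields independence of the basis and the passage from a space to the image of the
  operator.\<close>

lemma trace_on_comp_commute:
  assumes B: "finite B" "cindependent B" and C: "finite C" "cindependent C"
    and f: "lin_on (cspan B) f" "f ` cspan B \<subseteq> cspan C"
    and g: "lin_on (cspan C) g" "g ` cspan C \<subseteq> cspan B"
  shows "trace_on B (\<lambda>v. g (f v)) = trace_on C (\<lambda>v. f (g v))"
proof -
  let ?r = "complex_vector.representation B" and ?q = "complex_vector.representation C"
  have 1: "?r (g (f b)) b = (\<Sum>c\<in>C. ?q (f b) c * ?r (g c) b)" if "b \<in> B" for b
  proof -
    have fb: "f b \<in> cspan C" using that f complex_vector.span_base by blast
    have "g (f b) = g (\<Sum>c\<in>C. ?q (f b) c *\<^sub>C c)"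
      using complex_vector.sum_representation_eq[OF C(2) fb C(1)] by simp
    also have "\<dots> = (\<Sum>c\<in>C. ?q (f b) c *\<^sub>C g c)"
      by (rule lin_on_sum_scale[OF g(1)]) (auto intro: complex_vector.span_base)
    finally show ?thesis
      using g by (simp add: complex_vector.representation_sum[OF B(2)] complex_vector.representation_scale[OF B(2)]
          complex_vector.span_scale complex_vector.span_base image_subset_iff)
  qed
  have 2: "?q (f (g c)) c = (\<Sum>b\<in>B. ?r (g c) b * ?q (f b) c)" if "c \<in> C" for c
  proof -
    have gc: "g c \<in> cspan B" using that g complex_vector.span_base by blast
    have "f (g c) = f (\<Sum>b\<in>B. ?r (g c) b *\<^sub>C b)"
      using complex_vector.sum_representation_eq[OF B(2) gc B(1)] by simp
    also have "\<dots> = (\<Sum>b\<in>B. ?r (g c) b *\<^sub>C f b)"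
      by (rule lin_on_sum_scale[OF f(1)]) (auto intro: complex_vector.span_base)
    finally show ?thesis
      using f by (simp add: complex_vector.representation_sum[OF C(2)] complex_vector.representation_scale[OF C(2)]
          complex_vector.span_scale complex_vector.span_base image_subset_iff)
  qed
  have "trace_on B (\<lambda>v. g (f v)) = (\<Sum>b\<in>B. \<Sum>c\<in>C. ?q (f b) c * ?r (g c) b)"
    unfolding trace_on_def using 1 by simp
  also have "\<dots> = (\<Sum>c\<in>C. \<Sum>b\<in>B. ?r (g c) b * ?q (f b) c)"
    by (subst sum.swap) (simp add: mult.commute)
  finally show ?thesis unfolding trace_on_def using 2 by simp
qed

text \<open>Composing \<open>f\<close> with the inclusion of its image shows that the trace on the
  space equals the trace on the image, where the nilpotency exponent has dropped by one.\<close>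

lemma trace_on_nilpotent:
  assumes "finite B" "cindependent B" "lin_on (cspan B) f" "f ` cspan B \<subseteq> cspan B"
    and "\<And>v. v \<in> cspan B \<Longrightarrow> (f ^^ n) v = 0"
  shows "trace_on B f = 0"
  using assms
proof (induction n arbitrary: B)
  case 0
  then have "B = {}"
    by (metis complex_vector.dependent_zero complex_vector.span_base empty_iff equals0I funpow_0)
  then show ?case by (simp add: trace_on_def)
next
  case (Suc n)
  let ?W = "f ` cspan B"
  obtain C where C: "finite C" "cindependent C" "cspan C = ?W" 
    using subspace_basis[OF finite_dim_span[OF Suc.prems(1)] lin_on_image_subspace[OF Suc.prems(3)] Suc.prems(4)]
    by (metis complex_vector.subspace_span)
  have "trace_on B (\<lambda>v. f v) = trace_on C (\<lambda>v. f v)"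
    by (rule trace_on_comp_commute[of B C f "\<lambda>v. v"])
      (use Suc.prems C in \<open>auto simp: lin_on_ident\<close>)
  also have "\<dots> = 0"
  proof (rule Suc.IH)
    show "lin_on (cspan C) (\<lambda>v. f v)" using lin_on_subset[OF Suc.prems(3), of "cspan C"] Suc.prems(4) C(3) by auto
    show "f ` cspan C \<subseteq> cspan C" unfolding C(3) by (rule image_mono[OF Suc.prems(4)])
    show "(f ^^ n) v = 0" if "v \<in> cspan C" for v
      using that C Suc.prems(5) by (auto simp: funpow_swap1)
  qed (use C in auto)
  finally show ?case .
qed

subsection \<open>Polynomials in an operator\<close>

definition op_eval :: "('v::complex_vector \<Rightarrow> 'v) \<Rightarrow> complex poly \<Rightarrow> 'v \<Rightarrow> 'v"
  where "op_eval f p v = (\<Sum>i\<le>degree p. coeff p i *\<^sub>C (f ^^ i) v)"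

lemma op_eval_bound:
  assumes "degree p \<le> N"
  shows "op_eval f p v = (\<Sum>i\<le>N. coeff p i *\<^sub>C (f ^^ i) v)"
  unfolding op_eval_def using assms
  by (intro sum.mono_neutral_left) (auto simp: coeff_eq_0)

lemma op_eval_const: "op_eval f [:a:] v = a *\<^sub>C v"
  by (simp add: op_eval_def)

lemma op_eval_add: "op_eval f (p + q) v = op_eval f p v + op_eval f q v"
proof -
  let ?N = "max (degree p) (degree q)"
  show ?thesis
    by (simp add: op_eval_bound[of _ ?N] degree_add_le scaleC_add_left sum.distrib)
qed

lemma op_eval_smult: "op_eval f (smult a p) v = a *\<^sub>C op_eval f p v"
  by (simp add: op_eval_bound[of _ "degree p"] complex_vector.scale_sum_right scaleC_scaleC)

lemma op_eval_sum: "op_eval f (\<Sum>i\<in>A. p i) v = (\<Sum>i\<in>A. op_eval f (p i) v)"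
proof (induction A rule: infinite_finite_induct)
  case (insert i A)
  then show ?case by (simp add: op_eval_add)
qed (simp_all add: op_eval_def)

context
  fixes V :: "'v::complex_vector set" and f
  assumes V: "csubspace V" and f: "lin_on V f" "f ` V \<subseteq> V"
begin

lemma funpow_mem: "v \<in> V \<Longrightarrow> (f ^^ n) v \<in> V"
  using f by (induction n) auto

lemma lin_on_funpow: "lin_on V (f ^^ n)"
  using f unfolding lin_on_def by (induction n) (auto simp: funpow_mem)

lemma op_eval_mem: "v \<in> V \<Longrightarrow> op_eval f p v \<in> V"
  unfolding op_eval_def using V funpow_mem
  by (intro complex_vector.subspace_sum complex_vector.subspace_scale) auto

lemma lin_on_op_eval: "lin_on V (op_eval f p)"
  using lin_on_funpow unfolding lin_on_def op_eval_def
  by (simp add: scaleC_add_right sum.distrib complex_vector.scale_sum_right scaleC_scaleC mult.commute)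

lemma op_eval_pCons:
  assumes "v \<in> V"
  shows "op_eval f (pCons a q) v = a *\<^sub>C v + f (op_eval f q v)"
proof -
  have "f (op_eval f q v) = (\<Sum>i\<le>degree q. coeff q i *\<^sub>C f ((f ^^ i) v))"
    unfolding op_eval_def using assms funpow_mem by (intro lin_on_sum_scale[OF f(1) V]) auto
  then show ?thesis
    using op_eval_bound[of "pCons a q" "Suc (degree q)" f v]
    by (simp add: sum.atMost_Suc_shift degree_pCons_le del: sum.atMost_Suc)
qed

lemma op_eval_linear_factor:
  assumes "v \<in> V"
  shows "op_eval f ([:- c, 1:] * q) v = f (op_eval f q v) - c *\<^sub>C op_eval f q v"
proof -
  have eq: "[:- c, 1:] * q = pCons 0 q + smult (- c) q" by simp
  show ?thesis
    unfolding eq op_eval_add op_eval_smult op_eval_pCons[OF assms] by simp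
qed

lemma op_eval_shift: "v \<in> V \<Longrightarrow> op_eval f q (f v) = f (op_eval f q v)"
  unfolding op_eval_def
  by (subst lin_on_sum_scale[OF f(1) V]) (auto simp: funpow_mem funpow_swap1)

lemma op_eval_linear_factor':
  assumes "v \<in> V"
  shows "op_eval f ([:- c, 1:] * q) v = op_eval f q (f v - c *\<^sub>C v)"
proof -
  have "f v \<in> V" "c *\<^sub>C v \<in> V" using assms f V complex_vector.subspace_scale by auto
  then show ?thesis
    using assms lin_on_diff[OF lin_on_op_eval V] lin_on_scale[OF lin_on_op_eval]
    by (simp add: op_eval_linear_factor op_eval_shift del: mult_pCons_left)
qed

text \<open>Over the complex numbers \<open>p\<close> splits into linear factors, and each
  \<open>f - c\<close> can be cancelled because it is injective modulo \<open>G\<close>. The lemma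
  is applied with \<open>G\<close> the sum of the generalized eigenspaces and with \<open>G\<close>
  a proper ideal of the commutative algebra.\<close>

lemma op_eval_cancel:
  assumes "p \<noteq> 0" "v \<in> V" "op_eval f p v \<in> G" "csubspace G"
    and cancel: "\<And>c u. u \<in> V \<Longrightarrow> f u - c *\<^sub>C u \<in> G \<Longrightarrow> u \<in> G"
  shows "v \<in> G"
  using assms(1,3)
proof (induction "degree p" arbitrary: p rule: less_induct)
  case less
  show ?case
  proof (cases "degree p = 0")
    case True
    then obtain a where "p = [:a:]" by (rule degree_eq_zeroE)
    then have a: "a *\<^sub>C v \<in> G" "a \<noteq> 0" using less by (simp_all add: op_eval_const)
    then have "(1 / a) *\<^sub>C a *\<^sub>C v \<in> G" using assms complex_vector.subspace_scale by blast
    then show ?thesis using a by simp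
  next
    case False
    then have "\<not> constant (poly p)" by (simp add: constant_degree)
    then obtain c where "poly p c = 0" using fundamental_theorem_of_algebra by blast
    then obtain q where q: "p = [:- c, 1:] * q" using poly_eq_0_iff_dvd by blast
    then have "q \<noteq> 0" using less by auto
    then have "degree q < degree p" using q degree_mult_eq[of "[:- c, 1:]" q] by simp
    moreover have "op_eval f q v \<in> G"
      using less.prems(2) cancel[of "op_eval f q v" c] assms(2) op_eval_mem
      by (simp add: q op_eval_linear_factor del: mult_pCons_left)
    ultimately show ?thesis using less.hyps \<open>q \<noteq> 0\<close> by blast
  qed
qed

end

section \<open>Generalized eigenspaces\<close>

abbreviation shift :: "('v::complex_vector \<Rightarrow> 'v) \<Rightarrow> complex \<Rightarrow> 'v \<Rightarrow> 'v"
  where "shift f c \<equiv> \<lambda>u. f u - c *\<^sub>C u"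

text \<open>The exponent may depend on \<open>v\<close>, so nothing is presupposed about the
  dimension of \<open>V\<close>.\<close>

definition gen_eig :: "'v::complex_vector set \<Rightarrow> ('v \<Rightarrow> 'v) \<Rightarrow> complex \<Rightarrow> 'v set"
  where "gen_eig V f c = {v \<in> V. \<exists>n. (shift f c ^^ n) v = 0}"

lemma nilpotent_uniform:
  assumes "finite C" "lin_on (cspan C) f" "f ` cspan C \<subseteq> cspan C"
    and "\<And>c. c \<in> C \<Longrightarrow> \<exists>n. (f ^^ n) c = 0"
  obtains n where "\<And>v. v \<in> cspan C \<Longrightarrow> (f ^^ n) v = 0"
proof -
  have z: "(f ^^ k) 0 = 0" for k
    using lin_on_zero[OF lin_on_funpow[OF _ assms(2,3)]] by simp
  obtain n where n: "\<And>c. c \<in> C \<Longrightarrow> (f ^^ n c) c = 0" using assms(4) by metis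
  \<comment> \<open>A common bound for all exponents; as a sum it also makes sense for empty
    \<open>C\<close>.\<close>
  define m where "m = sum n C"
  have "(f ^^ m) c = 0" if "c \<in> C" for c
  proof -
    have "n c \<le> m" unfolding m_def using that assms(1) by (intro member_le_sum) auto
    then have "(f ^^ m) c = (f ^^ (m - n c)) ((f ^^ n c) c)"
      using funpow_add[of "m - n c" "n c" f] by simp
    then show ?thesis using n[OF that] z by simp
  qed
  then have "(f ^^ m) v = 0" if "v \<in> cspan C" for v
    using lin_on_ext_span[of C "f ^^ m" "\<lambda>_. 0" v] lin_on_funpow[OF _ assms(2,3)] that
    by (auto simp: lin_on_def)
  then show ?thesis using that by blast
qed

context
  fixes V :: "'v::complex_vector set" and f
  assumes V: "csubspace V" and f: "lin_on V f" "f ` V \<subseteq> V"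
begin

lemma lin_on_shift: "lin_on V (shift f c)"
  by (intro lin_on_minus_fun lin_on_scale_fun lin_on_ident f)

lemma shift_mem: "v \<in> V \<Longrightarrow> f v - c *\<^sub>C v \<in> V"
  using V f complex_vector.subspace_diff complex_vector.subspace_scale by blast

lemma shift_image: "shift f c ` V \<subseteq> V"
  using shift_mem by auto

lemma gen_eig_subset: "gen_eig V f c \<subseteq> V"
  by (auto simp: gen_eig_def)

lemma gen_eig_subspace: "csubspace (gen_eig V f c)"
proof (rule complex_vector.subspaceI)
  note lin = lin_on_funpow[OF V lin_on_shift shift_image]
  show "0 \<in> gen_eig V f c"
    using V by (auto simp: gen_eig_def complex_vector.subspace_0 intro: exI[of _ 0])
  fix x y a assume "x \<in> gen_eig V f c" "y \<in> gen_eig V f c"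
  then obtain m n where xy: "x \<in> V" "y \<in> V" "(shift f c ^^ m) x = 0" "(shift f c ^^ n) y = 0"
    by (auto simp: gen_eig_def)
  have z: "(shift f c ^^ k) 0 = 0" for k
    using lin_on_zero[OF lin V] .
  have "(shift f c ^^ (n + m)) x = 0" and "(shift f c ^^ (m + n)) y = 0"
    by (simp_all only: funpow_add o_apply xy z)
  then have "(shift f c ^^ (m + n)) x = 0" "(shift f c ^^ (m + n)) y = 0"
    by (simp_all only: add.commute)
  then show "x + y \<in> gen_eig V f c"
    using xy lin_on_add[OF lin, of x y] complex_vector.subspace_add[OF V]
    unfolding gen_eig_def by (metis (mono_tags, lifting) add_0 mem_Collect_eq)
  show "a *\<^sub>C x \<in> gen_eig V f c"
    using xy lin_on_scale[OF lin, of x] complex_vector.subspace_scale[OF V]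
    unfolding gen_eig_def by (metis (mono_tags, lifting) complex_vector.scale_zero_right mem_Collect_eq)
qed

lemma gen_eig_shift: "f v - c *\<^sub>C v \<in> gen_eig V f c \<Longrightarrow> v \<in> V \<Longrightarrow> v \<in> gen_eig V f c"
proof -
  assume "f v - c *\<^sub>C v \<in> gen_eig V f c" "v \<in> V"
  then obtain n where "(shift f c ^^ n) (shift f c v) = 0" "v \<in> V" by (auto simp: gen_eig_def)
  then have "(shift f c ^^ Suc n) v = 0" "v \<in> V" by (simp_all only: funpow_Suc_right o_apply)
  then show ?thesis unfolding gen_eig_def by blast
qed

lemma gen_eig_invariant:
  assumes "v \<in> gen_eig V f c"
  shows "f v \<in> gen_eig V f c"
proof -
  obtain n where n: "(shift f c ^^ n) v = 0" "v \<in> V" using assms by (auto simp: gen_eig_def)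
  have "(shift f c ^^ n) (f v - c *\<^sub>C v) = (shift f c ^^ Suc n) v"
    by (simp only: funpow_Suc_right o_apply)
  also have "\<dots> = 0" using n lin_on_zero[OF f(1) V] by simp
  finally have "f v - c *\<^sub>C v \<in> gen_eig V f c"
    using n shift_mem by (auto simp: gen_eig_def)
  then have "(f v - c *\<^sub>C v) + c *\<^sub>C v \<in> gen_eig V f c"
    by (intro complex_vector.subspace_add[OF gen_eig_subspace] complex_vector.subspace_scale[OF gen_eig_subspace] assms)
  then show ?thesis by simp
qed

lemma gen_eig_shift_mem: "v \<in> gen_eig V f c \<Longrightarrow> f v - d *\<^sub>C v \<in> gen_eig V f c"
  by (intro complex_vector.subspace_diff[OF gen_eig_subspace] complex_vector.subspace_scale[OF gen_eig_subspace]
      gen_eig_invariant)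

text \<open>Induction on the exponent that kills \<open>v\<close>, stated so that the exponent no
  longer appears: the property passes from \<open>(f - c) v\<close> to \<open>v\<close>.\<close>

lemma gen_eig_induct [consumes 1, case_names zero step]:
  assumes "v \<in> gen_eig V f c" "P 0"
    and "\<And>v. v \<in> gen_eig V f c \<Longrightarrow> P (f v - c *\<^sub>C v) \<Longrightarrow> P v"
  shows "P v"
proof -
  obtain n where n: "(shift f c ^^ n) v = 0" using assms by (auto simp: gen_eig_def)
  show ?thesis using n assms(1)
  proof (induction n arbitrary: v)
    case 0
    then show ?case using assms(2) by simp
  next
    case (Suc n)
    have "f v - c *\<^sub>C v \<in> gen_eig V f c"
      using Suc.prems by (intro gen_eig_shift_mem)
    moreover have "(shift f c ^^ n) (f v - c *\<^sub>C v) = 0"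
      using Suc.prems(1) by (simp only: funpow_Suc_right o_apply)
    ultimately show ?case using Suc assms(3) by blast
  qed
qed

text \<open>Here \<open>f - d\<close> is the nonzero scalar \<open>c - d\<close> plus a locally
  nilpotent operator, hence invertible. The preimage is built by induction: if \<open>h\<close> is
  one for \<open>(f - c) v\<close>, then \<open>(v - h) / (c - d)\<close> is one for
  \<open>v\<close>.\<close>

lemma gen_eig_shift_surj:
  assumes "v \<in> gen_eig V f c" "c \<noteq> d"
  shows "\<exists>h\<in>gen_eig V f c. f h - d *\<^sub>C h = v"
  using assms(1)
proof (induction rule: gen_eig_induct)
  case zero
  show ?case
    using lin_on_zero[OF f(1) V] complex_vector.subspace_0[OF gen_eig_subspace] by (intro bexI[of _ 0]) auto
next
  case (step v)
  then obtain h where h: "h \<in> gen_eig V f c" "f h - d *\<^sub>C h = f v - c *\<^sub>C v" by blast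
  let ?k = "(1 / (c - d)) *\<^sub>C (v - h)"
  have "v \<in> V" "h \<in> V" using h(1) step(1) by (auto simp: gen_eig_def)
  then have vh: "v \<in> V" "h \<in> V" "v - h \<in> V" using complex_vector.subspace_diff[OF V] by auto
  have "?k \<in> gen_eig V f c"
    using h step by (intro complex_vector.subspace_diff[OF gen_eig_subspace] complex_vector.subspace_scale[OF gen_eig_subspace])
  moreover have "f ?k - d *\<^sub>C ?k = (1 / (c - d)) *\<^sub>C ((f v - d *\<^sub>C v) - (f h - d *\<^sub>C h))"
    using lin_on_scale[OF f(1) vh(3)] lin_on_diff[OF f(1) V vh(1,2)]
    by (simp add: complex_vector.scale_right_diff_distrib scaleC_scaleC mult.commute)
  moreover have "(f v - d *\<^sub>C v) - (f h - d *\<^sub>C h) = (c - d) *\<^sub>C v"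
    unfolding h by (simp add: complex_vector.scale_left_diff_distrib)
  ultimately show ?case using assms(2) by (intro bexI[of _ ?k]) (simp_all add: scaleC_scaleC scaleC_one)
qed

lemma gen_eig_eigenvalue:
  assumes "v \<in> gen_eig V f c" "f v = d *\<^sub>C v" "v \<noteq> 0"
  shows "c = d"
proof -
  obtain n where n: "(shift f c ^^ n) v = 0" "v \<in> V" using assms by (auto simp: gen_eig_def)
  have "(shift f c ^^ n) v = (d - c) ^ n *\<^sub>C v"
  proof (induction n)
    case (Suc n)
    have "(shift f c ^^ Suc n) v = f ((d - c) ^ n *\<^sub>C v) - c *\<^sub>C (d - c) ^ n *\<^sub>C v" using Suc by simp
    also have "\<dots> = (d - c) ^ Suc n *\<^sub>C v"
      using n(2) assms(2) by (simp add: lin_on_scale[OF f(1)] scaleC_scaleC algebra_simps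
          complex_vector.scale_left_diff_distrib)
    finally show ?case .
  qed (simp add: scaleC_one)
  then show ?thesis using n assms(3) by simp
qed

lemma gen_eig_shift_inj:
  assumes "v \<in> gen_eig V f c" "(shift f d ^^ n) v = 0" "c \<noteq> d"
  shows "v = 0"
  using assms(1,2)
proof (induction n arbitrary: v)
  case (Suc n)
  have "f v - d *\<^sub>C v \<in> gen_eig V f c"
    using Suc.prems by (intro gen_eig_shift_mem)
  moreover have "(shift f d ^^ n) (f v - d *\<^sub>C v) = 0"
    using Suc.prems(2) by (simp only: funpow_Suc_right o_apply)
  ultimately have "f v - d *\<^sub>C v = 0" by (rule Suc.IH)
  then show ?case using gen_eig_eigenvalue[OF Suc.prems(1), of d] assms(3) by auto
qed simp

text \<open>A power of \<open>f - d\<close> that kills \<open>u d\<close> shortens the relation; it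
  preserves the other eigenspaces and is injective on them.\<close>

lemma gen_eig_independent:
  fixes c :: complex
  assumes "finite F" "\<And>c. c \<in> F \<Longrightarrow> u c \<in> gen_eig V f c" "(\<Sum>c\<in>F. u c) = 0" "c \<in> F"
  shows "u c = 0"
  using assms
proof (induction F arbitrary: u c rule: finite_induct)
  case (insert d F)
  obtain n where n: "(shift f d ^^ n) (u d) = 0" using insert.prems by (auto simp: gen_eig_def)
  have mem: "u c \<in> V" if "c \<in> insert d F" for c using insert.prems(1) that gen_eig_subset by blast
  note lin = lin_on_funpow[OF V lin_on_shift shift_image]
  have shiftG: "(shift f d ^^ k) w \<in> gen_eig V f a" if "w \<in> gen_eig V f a" for k w a
    using that by (induction k) (auto intro: gen_eig_shift_mem)
  have "(\<Sum>c\<in>F. (shift f d ^^ n) (u c)) = (shift f d ^^ n) (\<Sum>c\<in>insert d F. u c)"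
    using insert n mem by (subst lin_on_sum[OF lin V]) auto
  also have "\<dots> = 0" unfolding insert.prems(2) using lin_on_zero[OF lin V] .
  finally have "(\<Sum>c\<in>F. (shift f d ^^ n) (u c)) = 0" .
  then have "(shift f d ^^ n) (u c) = 0" if "c \<in> F" for c
    using insert.IH[of "\<lambda>c. (shift f d ^^ n) (u c)" c] that insert.prems(1) shiftG by blast
  then have F: "u c = 0" if "c \<in> F" for c
    using that insert gen_eig_shift_inj[where v = "u c" and c = c and d = d and n = n] by auto
  then have "u d = 0" using insert by simp
  then show ?case using F insert.prems by blast
qed simp

text \<open>Every \<open>v\<close> is killed by a nonzero polynomial in \<open>f\<close>, whose
  linear factors can be cancelled modulo the span \<open>G\<close> of the eigenspaces: if
  \<open>(f - d) u\<close> lies in \<open>G\<close>, then some \<open>h\<close> in \<open>G\<close>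
  has the same image up to an element of the eigenspace of \<open>d\<close>, and this puts
  \<open>h - u\<close> into that eigenspace.\<close>

lemma gen_eig_span:
  assumes "finite_dim V"
  shows "cspan (\<Union>c. gen_eig V f c) = V"
proof
  let ?G = "cspan (\<Union>c. gen_eig V f c)"
  show GV: "?G \<subseteq> V"
    by (rule complex_vector.span_minimal) (use gen_eig_subset V in auto)
  have G0: "gen_eig V f c \<subseteq> ?G" for c
    using complex_vector.span_superset[of "\<Union>c. gen_eig V f c"] by blast
  \<comment> \<open>On \<open>G\<close> the operator \<open>f - d\<close> is onto up to the
    eigenspace of \<open>d\<close>: it is invertible on every other eigenspace, and the component in
    the eigenspace of \<open>d\<close> itself is left as the error.\<close>
  have solve: "\<exists>h\<in>?G. (f h - d *\<^sub>C h) - g \<in> gen_eig V f d" if "g \<in> ?G" for g d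
    using that
  proof (induction rule: complex_vector.span_induct_alt)
    case base
    show ?case using complex_vector.subspace_0[OF gen_eig_subspace] lin_on_zero[OF f(1) V]
      by (intro bexI[of _ 0]) (auto simp: complex_vector.span_zero)
  next
    case (step a x y)
    obtain k where k: "k \<in> ?G" "(f k - d *\<^sub>C k) - x \<in> gen_eig V f d"
    proof -
      obtain c where c: "x \<in> gen_eig V f c" using step(1) by blast
      show ?thesis
      proof (cases "c = d")
        case True
        then have "(f 0 - d *\<^sub>C 0) - x \<in> gen_eig V f d"
          using c lin_on_zero[OF f(1) V] complex_vector.subspace_neg[OF gen_eig_subspace] by auto
        then show ?thesis using that complex_vector.span_zero by blast
      next
        case False
        then obtain h where "h \<in> gen_eig V f c" "f h - d *\<^sub>C h = x" using gen_eig_shift_surj[OF c] by blast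
        then show ?thesis using that[of h] G0 complex_vector.subspace_0[OF gen_eig_subspace] by auto
      qed
    qed
    obtain h where h: "h \<in> ?G" "(f h - d *\<^sub>C h) - y \<in> gen_eig V f d" using step by blast
    have "k \<in> V" "h \<in> V" "a *\<^sub>C k \<in> V" using k h GV V complex_vector.subspace_scale by auto
    then have "(f (a *\<^sub>C k + h) - d *\<^sub>C (a *\<^sub>C k + h)) - (a *\<^sub>C x + y)
        = a *\<^sub>C ((f k - d *\<^sub>C k) - x) + ((f h - d *\<^sub>C h) - y)"
      by (simp add: lin_on_add[OF f(1)] lin_on_scale[OF f(1)] scaleC_add_right
          complex_vector.scale_right_diff_distrib scaleC_scaleC mult.commute)
    also have "\<dots> \<in> gen_eig V f d"
      using k h by (intro complex_vector.subspace_add[OF gen_eig_subspace] complex_vector.subspace_scale[OF gen_eig_subspace])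
    finally show ?case
      using k h by (intro bexI[of _ "a *\<^sub>C k + h"]) (auto intro: complex_vector.span_add complex_vector.span_scale)
  qed
  show "V \<subseteq> ?G"
  proof
    fix v assume v: "v \<in> V"
    obtain B where B: "finite B" "cindependent B" "cspan B = V"
      using finite_dim_basis[OF assms] by metis
    let ?r = "complex_vector.representation B"
    \<comment> \<open>The \<open>card B + 1\<close> vectors \<open>v, f v, ...\<close> have only
      \<open>card B\<close> coordinates, so some nontrivial combination of them vanishes; its
      coefficients form \<open>p\<close>.\<close>
    obtain c where c: "\<exists>i\<le>card B. c i \<noteq> 0" "\<forall>b\<in>B. (\<Sum>i\<le>card B. c i * ?r ((f ^^ i) v) b) = 0"
      using homogeneous_system[OF B(1), of "{..card B}" "\<lambda>i b. ?r ((f ^^ i) v) b"] by auto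
    define p where "p = (\<Sum>i\<le>card B. monom (c i) i)"
    have "op_eval f (monom a i) v = a *\<^sub>C (f ^^ i) v" for a i
      by (simp add: op_eval_bound[of _ i] degree_monom_le if_distrib[of "\<lambda>x. x *\<^sub>C _"] cong: if_cong)
    then have "op_eval f p v = (\<Sum>i\<le>card B. c i *\<^sub>C (f ^^ i) v)"
      by (simp add: p_def op_eval_sum)
    also have "\<dots> = (\<Sum>i\<le>card B. \<Sum>b\<in>B. (c i * ?r ((f ^^ i) v) b) *\<^sub>C b)"
    proof (rule sum.cong[OF refl])
      fix i
      have "(f ^^ i) v \<in> cspan B" using B v funpow_mem[OF V f] by simp
      then have "c i *\<^sub>C (f ^^ i) v = c i *\<^sub>C (\<Sum>b\<in>B. ?r ((f ^^ i) v) b *\<^sub>C b)"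
        using complex_vector.sum_representation_eq[OF B(2) _ B(1)] by simp
      then show "c i *\<^sub>C (f ^^ i) v = (\<Sum>b\<in>B. (c i * ?r ((f ^^ i) v) b) *\<^sub>C b)"
        by (simp add: complex_vector.scale_sum_right scaleC_scaleC)
    qed
    also have "\<dots> = (\<Sum>b\<in>B. (\<Sum>i\<le>card B. c i * ?r ((f ^^ i) v) b) *\<^sub>C b)"
      by (subst sum.swap) (simp add: complex_vector.scale_sum_left)
    also have "\<dots> = 0" using c(2) by simp
    finally have p0: "op_eval f p v = 0" .
    have pn: "p \<noteq> 0"
    proof -
      obtain i where i: "i \<le> card B" "c i \<noteq> 0" using c by blast
      then have "coeff p i = c i" by (simp add: p_def coeff_sum)
      then show ?thesis using i by auto
    qed
    show "v \<in> ?G"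
    proof (rule op_eval_cancel[OF V f pn v])
      show "op_eval f p v \<in> ?G" by (simp add: p0 complex_vector.span_zero)
      show "csubspace ?G" by simp
      fix d u assume u: "u \<in> V" "f u - d *\<^sub>C u \<in> ?G"
      then obtain h where h: "h \<in> ?G" "(f h - d *\<^sub>C h) - (f u - d *\<^sub>C u) \<in> gen_eig V f d"
        using solve by blast
      have "h \<in> V" using h GV by blast
      then have "f (h - u) - d *\<^sub>C (h - u) \<in> gen_eig V f d"
        using h u by (simp add: lin_on_diff[OF f(1) V] complex_vector.scale_right_diff_distrib algebra_simps)
      then have "h - u \<in> ?G"
        using gen_eig_shift \<open>h \<in> V\<close> u V complex_vector.subspace_diff G0 by blast
      then have "h - (h - u) \<in> ?G" using h(1) complex_vector.span_diff by blast
      then show "u \<in> ?G" by simp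
    qed
  qed
qed

lemma nilpotent_of_gen_eig:
  assumes "finite_dim V" "\<And>c v. v \<in> gen_eig V f c \<Longrightarrow> v \<noteq> 0 \<Longrightarrow> c = 0"
  shows "gen_eig V f 0 = V"
proof -
  have "(\<Union>c. gen_eig V f c) \<subseteq> gen_eig V f 0"
    using assms(2) complex_vector.subspace_0[OF gen_eig_subspace] by blast
  then have "cspan (\<Union>c. gen_eig V f c) \<subseteq> gen_eig V f 0"
    using gen_eig_subspace complex_vector.span_minimal by blast
  then show ?thesis using gen_eig_span[OF assms(1)] gen_eig_subset by blast
qed

end

lemma gen_eig_zero: "gen_eig V f 0 = {v \<in> V. \<exists>n. (f ^^ n) v = 0}"
  by (simp add: gen_eig_def)

lemma trace_on_basis_independent:
  assumes "finite B" "cindependent B" "finite C" "cindependent C" "cspan B = cspan C"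
    and "lin_on (cspan B) f" "f ` cspan B \<subseteq> cspan B"
  shows "trace_on B f = trace_on C f"
  using trace_on_comp_commute[of B C f "\<lambda>v. v"] assms by (simp add: lin_on_ident)

text \<open>
  The operator \<open>s\<close> replaces the polynomial in the semisimple part of \<open>f\<close> that takes every
  eigenvalue to its complex conjugate in the usual proof of Cartan's criterion.
\<close>

lemma conjugate_operator:
  assumes V: "finite_dim V" and f: "lin_on V f" "f ` V \<subseteq> V"
  obtains s where "lin_on V s" "s ` V \<subseteq> V" "\<And>c v. v \<in> gen_eig V f c \<Longrightarrow> s v = cnj c *\<^sub>C v"
    "\<And>B. finite B \<Longrightarrow> cindependent B \<Longrightarrow> cspan B = V \<Longrightarrow> trace_on B (\<lambda>v. f (s v)) = 0 \<Longrightarrow> gen_eig V f 0 = V"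
proof -
  have sV: "csubspace V" using V by (rule finite_dim_subspace)
  let ?G = "gen_eig V f"
  obtain C where C: "C \<subseteq> (\<Union>c. ?G c)" "cindependent C" "(\<Union>c. ?G c) \<subseteq> cspan C"
    by (rule complex_vector.maximal_independent_subset)
  have spC: "cspan C = V"
    using complex_vector.span_mono[OF C(1)] complex_vector.span_minimal[OF C(3)] gen_eig_span[OF sV f V] by auto
  have CV: "C \<subseteq> V" using complex_vector.span_superset[of C] spC by simp
  have fC: "finite C"
    using finite_dim_basis[OF V] complex_vector.independent_span_bound[OF _ C(2)] CV by metis
  obtain e where e: "\<And>c. c \<in> C \<Longrightarrow> c \<in> ?G (e c)" using C(1) by (metis UN_E subsetD)
  obtain s where s: "Vector_Spaces.linear scaleC scaleC s" "\<And>c. c \<in> C \<Longrightarrow> s c = cnj (e c) *\<^sub>C c"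
    using cv_pair.linear_independent_extend[OF C(2), of "\<lambda>c. cnj (e c) *\<^sub>C c"] by metis
  obtain d where d: "Vector_Spaces.linear scaleC scaleC d" "\<And>c. c \<in> C \<Longrightarrow> d c = e c *\<^sub>C c"
    using cv_pair.linear_independent_extend[OF C(2), of "\<lambda>c. e c *\<^sub>C c"] by metis
  \<comment> \<open>An operator that is scalar on the basis vectors of each eigenvalue is scalar on
    the whole generalized eigenspace: the components of \<open>v\<close> along other eigenvalues
    vanish by \<open>gen_eig_independent\<close>.\<close>
  have eig: "t v = \<phi> c *\<^sub>C v"
    if t: "Vector_Spaces.linear scaleC scaleC t" "\<And>c. c \<in> C \<Longrightarrow> t c = \<phi> (e c) *\<^sub>C c"
      and v: "v \<in> ?G c" for t :: "'a \<Rightarrow> 'a" and \<phi> v c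
  proof -
    let ?r = "complex_vector.representation C v"
    define F where "F = insert c (e ` C)"
    define w where "w \<mu> = (\<Sum>b\<in>{b \<in> C. e b = \<mu>}. ?r b *\<^sub>C b)" for \<mu>
    have fF: "finite F" using fC by (simp add: F_def)
    have "v \<in> V" using v by (simp add: gen_eig_def)
    then have "v = (\<Sum>b\<in>C. ?r b *\<^sub>C b)"
      using complex_vector.sum_representation_eq[OF C(2) _ fC] spC by simp
    also have "\<dots> = (\<Sum>\<mu>\<in>F. w \<mu>)"
      unfolding w_def by (rule sum.group[symmetric]) (use fC fF in \<open>auto simp: F_def\<close>)
    finally have vw: "v = (\<Sum>\<mu>\<in>F. w \<mu>)" .
    have wG: "w \<mu> \<in> ?G \<mu>" for \<mu>
      unfolding w_def using e by (intro subspace_lincomb gen_eig_subspace[OF sV f]) auto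
    have "w \<mu> - (if \<mu> = c then v else 0) = 0" if "\<mu> \<in> F" for \<mu>
    proof (rule gen_eig_independent[OF sV f fF _ _ that])
      show "w \<mu> - (if \<mu> = c then v else 0) \<in> ?G \<mu>" for \<mu>
        using wG v complex_vector.subspace_diff[OF gen_eig_subspace[OF sV f]] by auto
      have "(\<Sum>\<mu>\<in>F. w \<mu> - (if \<mu> = c then v else 0)) = v - (\<Sum>\<mu>\<in>F. if \<mu> = c then v else 0)"
        unfolding sum_subtractf by (simp add: vw[symmetric])
      also have "\<dots> = 0" using fF by (simp add: F_def)
      finally show "(\<Sum>\<mu>\<in>F. w \<mu> - (if \<mu> = c then v else 0)) = 0" .
    qed
    then have w: "w \<mu> = (if \<mu> = c then v else 0)" if "\<mu> \<in> F" for \<mu> using that by fastforce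
    have "c \<in> F" by (simp add: F_def)
    have "t v = t (w c)" using w[OF \<open>c \<in> F\<close>] by simp
    also have "\<dots> = (\<Sum>b\<in>{b \<in> C. e b = c}. ?r b *\<^sub>C t b)"
      unfolding w_def by (rule lin_on_sum_scale[OF linear_lin_on[OF t(1)] complex_vector.subspace_UNIV]) simp
    also have "\<dots> = \<phi> c *\<^sub>C w c"
      unfolding w_def using t(2) by (simp add: complex_vector.scale_sum_right scaleC_scaleC mult.commute)
    finally show ?thesis using w[OF \<open>c \<in> F\<close>] by simp
  qed
  have sG: "s v = cnj c *\<^sub>C v" if "v \<in> ?G c" for v c
    using eig[of s cnj, OF s(1) _ that] s(2) by simp
  have dG: "d v = c *\<^sub>C v" if "v \<in> ?G c" for v c
    using eig[of d "\<lambda>c. c", OF d(1) _ that] d(2) by simp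
  have tV: "t ` V \<subseteq> V" if "Vector_Spaces.linear scaleC scaleC t" "\<And>c. c \<in> C \<Longrightarrow> t c \<in> V" for t :: "'a \<Rightarrow> 'a"
  proof -
    have "t ` V \<subseteq> cspan (t ` C)"
      by (rule cv_pair.linear_spans_image[OF that(1)]) (simp add: spC)
    also have "\<dots> \<subseteq> V" by (rule complex_vector.span_minimal[OF _ sV]) (use that(2) in auto)
    finally show ?thesis .
  qed
  have sI: "s ` V \<subseteq> V" and dI: "d ` V \<subseteq> V"
    using CV sV s(2) d(2) by (auto intro!: tV[OF s(1)] tV[OF d(1)] complex_vector.subspace_scale simp del: image_subset_iff)
  have nil: "gen_eig V f 0 = V"
    if B: "finite B" "cindependent B" "cspan B = V" and tr: "trace_on B (\<lambda>v. f (s v)) = 0" for B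
  proof -
    \<comment> \<open>\<open>d\<close> is the semisimple part of \<open>f\<close>. On the eigenspace
      of \<open>c\<close> the difference \<open>f s - d s\<close> equals \<open>cnj c\<close> times
      \<open>f - c\<close>, so it is nilpotent and has trace zero.\<close>
    let ?N = "\<lambda>v. f (s v) - d (s v)"
    have ls: "lin_on V s" and ld: "lin_on V d" using s d linear_lin_on by auto
    have lfs: "lin_on V (\<lambda>v. f (s v))" and lds: "lin_on V (\<lambda>v. d (s v))"
      using lin_on_comp[OF ls sI] f ld by auto
    have fs: "(\<lambda>v. f (s v)) ` V \<subseteq> V" and ds: "(\<lambda>v. d (s v)) ` V \<subseteq> V" using sI dI f by auto
    have lN: "lin_on V ?N" using lfs lds by (rule lin_on_minus_fun)
    have N: "?N ` V \<subseteq> V" using fs ds complex_vector.subspace_diff[OF sV] by auto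
    have NC: "\<exists>n. (?N ^^ n) b = 0" if "b \<in> C" for b
    proof -
      have "b \<in> ?G (e b)" using e that by blast
      then show ?thesis
      proof (rule gen_eig_induct[OF sV f])
        show "\<exists>n. (?N ^^ n) 0 = 0" by (intro exI[of _ 0]) simp
      next
        fix v assume step: "v \<in> ?G (e b)" "\<exists>n. (?N ^^ n) (f v - e b *\<^sub>C v) = 0"
        then obtain n where n: "(?N ^^ n) (f v - e b *\<^sub>C v) = 0" by blast
        have fv: "f v - e b *\<^sub>C v \<in> V" "v \<in> V"
          using step(1) shift_mem[OF sV f] by (auto simp: gen_eig_def)
        have "?N v = cnj (e b) *\<^sub>C (f v - e b *\<^sub>C v)"
          using sG[OF step(1)] dG[OF step(1)] fv(2) by (simp add: lin_on_scale[OF f(1)] lin_on_scale[OF ld]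
              complex_vector.scale_right_diff_distrib)
        then have "(?N ^^ Suc n) v = (?N ^^ n) (cnj (e b) *\<^sub>C (f v - e b *\<^sub>C v))"
          by (simp only: funpow_Suc_right o_apply)
        also have "\<dots> = 0"
          using lin_on_scale[OF lin_on_funpow[OF sV lN N] fv(1), of n] n by simp
        finally show "\<exists>n. (?N ^^ n) v = 0" by blast
      qed
    qed
    obtain n where "\<And>v. v \<in> V \<Longrightarrow> (?N ^^ n) v = 0"
      using nilpotent_uniform[of C ?N] fC lN N NC spC by metis
    then have trN: "trace_on C ?N = 0"
      using trace_on_nilpotent[of C ?N n] fC C(2) lN N spC by metis
    have "trace_on C (\<lambda>v. f (s v)) = 0"
      using trace_on_basis_independent[OF B(1,2) fC C(2), of "\<lambda>v. f (s v)"] tr lfs fs spC B by simp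
    moreover have "trace_on C ?N = trace_on C (\<lambda>v. f (s v)) - trace_on C (\<lambda>v. d (s v))"
      by (rule trace_on_diff[OF C(2), unfolded spC]) (rule order_trans[OF image_mono[OF CV]], fact)+
    ultimately have "trace_on C (\<lambda>v. d (s v)) = 0" using trN by simp
    \<comment> \<open>The trace of \<open>d s\<close> is the sum of the squared moduli of the
      eigenvalues with multiplicity, and it vanishes only if every eigenvalue is zero.\<close>
    moreover have "trace_on C (\<lambda>v. d (s v)) = (\<Sum>b\<in>C. e b * cnj (e b))"
      unfolding trace_on_def
    proof (rule sum.cong[OF refl])
      fix b assume b: "b \<in> C"
      have "d (s b) = (e b * cnj (e b)) *\<^sub>C b"
        using s(2)[OF b] d(2)[OF b] CV b by (simp add: lin_on_scale[OF ld] subset_iff scaleC_scaleC mult.commute)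
      then show "complex_vector.representation C (d (s b)) b = e b * cnj (e b)"
        using b C(2) by (simp add: complex_vector.representation_scale complex_vector.span_base complex_vector.representation_basis)
    qed
    ultimately have "(\<Sum>b\<in>C. complex_of_real ((cmod (e b))\<^sup>2)) = 0"
      unfolding complex_norm_square by simp
    then have "complex_of_real (\<Sum>b\<in>C. (cmod (e b))\<^sup>2) = 0" by (simp only: of_real_sum)
    then have "(\<Sum>b\<in>C. (cmod (e b))\<^sup>2) = 0" by (simp only: of_real_eq_0_iff)
    then have "\<forall>b\<in>C. (cmod (e b))\<^sup>2 = 0" using fC by (subst (asm) sum_nonneg_eq_0_iff) auto
    then have "d b = 0" if "b \<in> C" for b using d(2) that by simp
    then have d0: "d v = 0" if "v \<in> V" for v
      using cv_pair.linear_eq_0_on_span[OF d(1), of C v] spC that by blast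
    show ?thesis
    proof (rule nilpotent_of_gen_eig[OF sV f V])
      fix c v assume v: "v \<in> ?G c" "v \<noteq> 0"
      then have "c *\<^sub>C v = 0" using dG[OF v(1)] d0 by (simp add: gen_eig_def)
      then show "c = 0" using v by simp
    qed
  qed
  show ?thesis
    using that[of s] linear_lin_on[OF s(1)] sI sG nil by blast
qed

section \<open>Lie algebras and their modules\<close>

lemma bracket_zero_left [simp]: "bracket 0 (x :: 'g::complex_lie_algebra) = 0"
  and bracket_zero_right [simp]: "bracket (x :: 'g::complex_lie_algebra) 0 = 0"
  using bracket_scaleC_left[of 0 x x] bracket_scaleC_right[of x 0 x] by simp_all

lemma bracket_anticommute: "bracket y x = - bracket x (y :: 'g::complex_lie_algebra)"
proof -
  have "bracket (x + y) (x + y) = bracket x y + bracket y x"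
    unfolding bracket_add_left bracket_add_right by (simp add: bracket_self)
  then show ?thesis by (simp add: bracket_self eq_neg_iff_add_eq_0 add.commute)
qed

lemma bracket_minus_right: "bracket x (- y) = - bracket x (y :: 'g::complex_lie_algebra)"
  using bracket_scaleC_right[of x "-1" y] by simp

lemma bracket_bracket:
  "bracket (bracket x y) z = bracket x (bracket y z) - bracket y (bracket x (z :: 'g::complex_lie_algebra))"
proof -
  have a: "bracket z (bracket x y) = - bracket (bracket x y) z" by (rule bracket_anticommute)
  have b: "bracket y (bracket z x) = - bracket y (bracket x z)"
    by (simp add: bracket_anticommute[of z x] bracket_minus_right)
  show ?thesis using jacobi[of x y z] unfolding a b by (simp add: algebra_simps)
qed

lemma lie_moduleD:
  assumes "lie_module V \<rho>"
  shows lie_module_subspace: "csubspace V"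
    and lie_module_lin: "lin_on V (\<rho> x)"
    and lie_module_image: "\<rho> x ` V \<subseteq> V"
    and lie_module_mem: "v \<in> V \<Longrightarrow> \<rho> x v \<in> V"
    and lie_module_add: "v \<in> V \<Longrightarrow> \<rho> (x + y) v = \<rho> x v + \<rho> y v"
    and lie_module_scale: "v \<in> V \<Longrightarrow> \<rho> (c *\<^sub>C x) v = c *\<^sub>C \<rho> x v"
    and lie_module_bracket: "v \<in> V \<Longrightarrow> \<rho> (bracket x y) v = \<rho> x (\<rho> y v) - \<rho> y (\<rho> x v)"
  using assms unfolding lie_module_def lin_on_def by auto

lemma lie_module_zero: "lie_module V \<rho> \<Longrightarrow> v \<in> V \<Longrightarrow> \<rho> 0 v = 0"
  using lie_module_scale[of V \<rho> v 0 0] by simp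

lemma lie_module_zero_arg: "lie_module V \<rho> \<Longrightarrow> \<rho> x 0 = 0"
  using lin_on_zero[OF lie_module_lin lie_module_subspace] by blast

lemma lie_module_diff: "lie_module V \<rho> \<Longrightarrow> v \<in> V \<Longrightarrow> \<rho> (x - y) v = \<rho> x v - \<rho> y v"
  using lie_module_add[of V \<rho> v "x - y" y] by simp

lemma lie_module_lincomb:
  assumes "lie_module V \<rho>" "v \<in> V"
  shows "\<rho> (\<Sum>i\<in>A. c i *\<^sub>C x i) v = (\<Sum>i\<in>A. c i *\<^sub>C \<rho> (x i) v)"
  by (induction A rule: infinite_finite_induct)
    (simp_all add: lie_module_add[OF assms] lie_module_scale[OF assms] lie_module_zero[OF assms])

lemma lie_ideal_subspace: "lie_ideal I \<Longrightarrow> csubspace I"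
  and lie_ideal_bracket: "lie_ideal I \<Longrightarrow> y \<in> I \<Longrightarrow> bracket x y \<in> I"
  by (auto simp: lie_ideal_def)

lemma lie_ideal_adjoint:
  assumes "lie_ideal I"
  shows "lie_module I bracket"
  using assms unfolding lie_module_def lie_ideal_def
  by (auto simp: bracket_add_left bracket_add_right bracket_scaleC_left bracket_scaleC_right bracket_bracket)

lemma lie_ideal_UNIV: "lie_ideal UNIV"
  by (simp add: lie_ideal_def)

lemma adjoint_module: "lie_module (UNIV :: 'g::complex_lie_algebra set) bracket"
  by (rule lie_ideal_adjoint[OF lie_ideal_UNIV])

lemma derived_subset: "lie_ideal I \<Longrightarrow> derived I \<subseteq> I"
  unfolding derived_def
  by (rule complex_vector.span_minimal) (auto intro: lie_ideal_bracket lie_ideal_subspace)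

lemma derived_lie_ideal:
  assumes "lie_ideal I"
  shows "lie_ideal (derived I)"
  unfolding lie_ideal_def
proof (intro conjI allI ballI)
  show "csubspace (derived I)" by (simp add: derived_def)
  fix z y assume "y \<in> derived I"
  then show "bracket z y \<in> derived I"
    unfolding derived_def
  proof (induction rule: complex_vector.span_induct_alt)
    case base
    then show ?case by (simp add: complex_vector.span_zero)
  next
    case (step c x y)
    then obtain a b where ab: "x = bracket a b" "a \<in> I" "b \<in> I" by blast
    let ?S = "{bracket x y |x y. x \<in> I \<and> y \<in> I}"
    have "bracket z x = bracket (bracket z a) b + bracket a (bracket z b)"
      using ab bracket_bracket[of z a b] by simp
    moreover have "bracket (bracket z a) b \<in> cspan ?S" "bracket a (bracket z b) \<in> cspan ?S"
      using ab lie_ideal_bracket[OF assms] by (auto intro!: complex_vector.span_base)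
    ultimately have "bracket z x \<in> cspan ?S" by (simp add: complex_vector.span_add)
    then show ?case
      using step by (simp add: bracket_add_right bracket_scaleC_right complex_vector.span_add complex_vector.span_scale)
  qed
qed

text \<open>The identity behind it is
  \<open>(x - (c + a)) y v = ((ad x - a) y) v + y ((x - c) v)\<close>. Hence an induction on the
  exponent of \<open>y\<close> with an inner one on the exponent of \<open>v\<close>; neither has to
  be a true eigenvector.\<close>

lemma gen_eig_weight:
  assumes V: "lie_module V \<rho>" and I: "lie_ideal I"
    and y: "y \<in> gen_eig I (bracket x) a" and v: "v \<in> gen_eig V (\<rho> x) c"
  shows "\<rho> y v \<in> gen_eig V (\<rho> x) (c + a)"
proof -
  note sV = lie_module_subspace[OF V] and lV = lie_module_lin[OF V] and iV = lie_module_image[OF V]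
  note adI = lie_ideal_adjoint[OF I]
  note sI = lie_module_subspace[OF adI] and lI = lie_module_lin[OF adI] and iI = lie_module_image[OF adI]
  note GS = gen_eig_subspace[OF sV lV iV]
  have "\<forall>v\<in>gen_eig V (\<rho> x) c. \<rho> y v \<in> gen_eig V (\<rho> x) (c + a)"
    using y
  proof (rule gen_eig_induct[OF sI lI iI])
    show "\<forall>v\<in>gen_eig V (\<rho> x) c. \<rho> 0 v \<in> gen_eig V (\<rho> x) (c + a)"
      using lie_module_zero[OF V] complex_vector.subspace_0[OF GS] by (simp add: gen_eig_def)
  next
    fix y assume y: "y \<in> gen_eig I (bracket x) a"
      and IH: "\<forall>v\<in>gen_eig V (\<rho> x) c. \<rho> (bracket x y - a *\<^sub>C y) v \<in> gen_eig V (\<rho> x) (c + a)"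
    show "\<forall>v\<in>gen_eig V (\<rho> x) c. \<rho> y v \<in> gen_eig V (\<rho> x) (c + a)"
    proof
      fix v assume "v \<in> gen_eig V (\<rho> x) c"
      then show "\<rho> y v \<in> gen_eig V (\<rho> x) (c + a)"
      proof (rule gen_eig_induct[OF sV lV iV])
        show "\<rho> y 0 \<in> gen_eig V (\<rho> x) (c + a)"
          using lie_module_zero_arg[OF V] complex_vector.subspace_0[OF GS] by simp
      next
        fix v assume v: "v \<in> gen_eig V (\<rho> x) c"
          and IHv: "\<rho> y (\<rho> x v - c *\<^sub>C v) \<in> gen_eig V (\<rho> x) (c + a)"
        have vV: "v \<in> V" "\<rho> x v \<in> V" "c *\<^sub>C v \<in> V"
          using v lie_module_mem[OF V] complex_vector.subspace_scale[OF sV] by (auto simp: gen_eig_def)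
        have "\<rho> x (\<rho> y v) - (c + a) *\<^sub>C \<rho> y v
            = \<rho> (bracket x y - a *\<^sub>C y) v + \<rho> y (\<rho> x v - c *\<^sub>C v)"
          using vV by (simp add: lie_module_diff[OF V] lie_module_bracket[OF V] lie_module_scale[OF V]
              lin_on_diff[OF lV sV] lin_on_scale[OF lV] scaleC_add_left)
        also have "\<dots> \<in> gen_eig V (\<rho> x) (c + a)"
          using IH v IHv by (intro complex_vector.subspace_add[OF GS]) auto
        finally show "\<rho> y v \<in> gen_eig V (\<rho> x) (c + a)"
          using gen_eig_shift[OF sV lV iV] lie_module_mem[OF V] vV by blast
      qed
    qed
  qed
  then show ?thesis using v by blast
qed

section \<open>Trace forms\<close>

definition trace_form :: "'v::complex_vector set \<Rightarrow> ('g \<Rightarrow> 'v \<Rightarrow> 'v) \<Rightarrow> 'g \<Rightarrow> 'g \<Rightarrow> complex"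
  where "trace_form B \<rho> x y = trace_on B (\<lambda>v. \<rho> x (\<rho> y v))"

context
  fixes B :: "'v::complex_vector set" and \<rho> :: "'g::complex_lie_algebra \<Rightarrow> 'v \<Rightarrow> 'v"
  assumes B: "finite B" "cindependent B" and V: "lie_module (cspan B) \<rho>"
begin

lemma trace_form_add: "trace_form B \<rho> (x + y) z = trace_form B \<rho> x z + trace_form B \<rho> y z"
  unfolding trace_form_def
  by (subst trace_on_add[OF B(2), symmetric])
    (auto intro!: trace_on_cong simp: lie_module_mem[OF V] complex_vector.span_base lie_module_add[OF V])

lemma trace_form_scale: "trace_form B \<rho> (c *\<^sub>C x) z = c * trace_form B \<rho> x z"
  unfolding trace_form_def
  by (subst trace_on_scale[OF B(2), symmetric])
    (auto intro!: trace_on_cong simp: lie_module_mem[OF V] complex_vector.span_base lie_module_scale[OF V])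

lemma trace_form_commute: "trace_form B \<rho> x y = trace_form B \<rho> y x"
  unfolding trace_form_def
  by (rule trace_on_comp_commute[OF B B]) (use lie_module_lin[OF V] lie_module_image[OF V] in auto)

text \<open>After both brackets are expanded, all that remains is the cyclic exchange of
  \<open>\<rho> z\<close> with the product of \<open>\<rho> x\<close> and
  \<open>\<rho> y\<close>.\<close>

lemma trace_form_bracket: "trace_form B \<rho> (bracket z x) y = - trace_form B \<rho> x (bracket z y)"
proof -
  have m: "v \<in> cspan B \<Longrightarrow> \<rho> x v \<in> cspan B" for x v using lie_module_mem[OF V] .
  have b: "v \<in> B \<Longrightarrow> v \<in> cspan B" for v by (rule complex_vector.span_base)
  have 1: "trace_form B \<rho> (bracket z x) y
      = trace_on B (\<lambda>v. \<rho> z (\<rho> x (\<rho> y v))) - trace_on B (\<lambda>v. \<rho> x (\<rho> z (\<rho> y v)))"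
    unfolding trace_form_def
    by (subst trace_on_diff[OF B(2), symmetric])
      (auto intro!: trace_on_cong simp: m b lie_module_bracket[OF V])
  have 2: "trace_form B \<rho> x (bracket z y)
      = trace_on B (\<lambda>v. \<rho> x (\<rho> z (\<rho> y v))) - trace_on B (\<lambda>v. \<rho> x (\<rho> y (\<rho> z v)))"
    unfolding trace_form_def
    by (subst trace_on_diff[OF B(2), symmetric])
      (auto intro!: trace_on_cong simp: m b lie_module_bracket[OF V] lin_on_diff[OF lie_module_lin[OF V]])
  have "trace_on B (\<lambda>v. \<rho> z (\<rho> x (\<rho> y v))) = trace_on B (\<lambda>v. \<rho> x (\<rho> y (\<rho> z v)))"
  proof (rule trace_on_comp_commute[OF B B, of "\<lambda>v. \<rho> x (\<rho> y v)" "\<rho> z"])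
    show "lin_on (cspan B) (\<lambda>v. \<rho> x (\<rho> y v))"
      by (rule lin_on_comp[OF lie_module_lin[OF V] lie_module_image[OF V] lie_module_lin[OF V]])
  qed (use m lie_module_lin[OF V] in auto)
  then show ?thesis using 1 2 by simp
qed

lemma trace_form_add_right: "trace_form B \<rho> z (x + y) = trace_form B \<rho> z x + trace_form B \<rho> z y"
  by (simp add: trace_form_commute[of z] trace_form_add)

lemma trace_form_scale_right: "trace_form B \<rho> z (c *\<^sub>C x) = c * trace_form B \<rho> z x"
  by (simp add: trace_form_commute[of z] trace_form_scale)

lemma trace_form_zero: "trace_form B \<rho> 0 x = 0" "trace_form B \<rho> x 0 = 0"
  using trace_form_scale[of 0 0 x] trace_form_scale_right[of x 0 0] by simp_all

text \<open>The set is the orthogonal space of the ideal \<open>P\<close>; invariance moves the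
  bracket onto the argument from \<open>P\<close>, which absorbs it.\<close>

lemma trace_form_radical_ideal:
  assumes "lie_ideal P"
  shows "lie_ideal {x. (\<forall>y\<in>P. trace_form B \<rho> x y = 0)}"
  unfolding lie_ideal_def
  using lie_ideal_bracket[OF assms]
  by (auto intro!: complex_vector.subspaceI simp: trace_form_add trace_form_scale trace_form_zero trace_form_bracket)

end

section \<open>Cartan's criterion\<close>

lemma lie_ideal_Int: "lie_ideal I \<Longrightarrow> lie_ideal J \<Longrightarrow> lie_ideal (I \<inter> J)"
  unfolding lie_ideal_def by (auto intro: complex_vector.subspace_inter)

text \<open>For \<open>x\<close> a sum of brackets \<open>[a, b]\<close> and \<open>s\<close> the
  conjugate operator of \<open>\<rho> x\<close>, the trace of \<open>[a, b] s\<close> is that of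
  \<open>a [b, s]\<close>, and \<open>[b, s]\<close> acts as an element of \<open>I\<close>. The
  trace therefore vanishes by hypothesis, and \<open>conjugate_operator\<close> turns this into
  nilpotency of \<open>\<rho> x\<close>.\<close>

lemma cartan_nilpotent:
  fixes \<rho> :: "'g::complex_lie_algebra \<Rightarrow> 'v::complex_vector \<Rightarrow> 'v"
  assumes B: "finite B" "cindependent B" and V: "lie_module (cspan B) \<rho>"
    and I: "lie_ideal I" "finite_dim I"
    and tr: "\<And>a b. a \<in> I \<Longrightarrow> b \<in> I \<Longrightarrow> trace_form B \<rho> a b = 0"
    and x: "x \<in> derived I"
  shows "gen_eig (cspan B) (\<rho> x) 0 = cspan B"
proof -
  let ?V = "cspan B"
  note sV = lie_module_subspace[OF V] and lV = lie_module_lin[OF V] and iV = lie_module_image[OF V]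
  note mV = lie_module_mem[OF V]
  have fV: "finite_dim ?V" using B finite_dim_span by blast
  have xI: "x \<in> I" using x derived_subset[OF I(1)] by blast
  obtain s where s: "lin_on ?V s" "s ` ?V \<subseteq> ?V" "\<And>c v. v \<in> gen_eig ?V (\<rho> x) c \<Longrightarrow> s v = cnj c *\<^sub>C v"
    "trace_on B (\<lambda>v. \<rho> x (s v)) = 0 \<Longrightarrow> gen_eig ?V (\<rho> x) 0 = ?V"
    by (rule conjugate_operator[OF fV lV iV]) (use B in blast)
  have ms: "v \<in> ?V \<Longrightarrow> s v \<in> ?V" for v using s(2) by blast
  note adI = lie_ideal_adjoint[OF I(1)]
  note spanI = gen_eig_span[OF lie_module_subspace[OF adI] lie_module_lin[OF adI] lie_module_image[OF adI] I(2)]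
  note spanV = gen_eig_span[OF sV lV iV fV]
  \<comment> \<open>If \<open>y\<close> has weight \<open>a\<close> under \<open>ad x\<close>, then
    \<open>\<rho> y\<close> raises the weights of \<open>\<rho> x\<close> by \<open>a\<close>; as
    \<open>cnj\<close> is additive, the commutator of \<open>s\<close> with \<open>\<rho> y\<close>
    is \<open>cnj a\<close> times \<open>\<rho> y\<close>. So \<open>b'\<close> comes from the
    weight components of \<open>b\<close>, which stay in \<open>I\<close>.\<close>
  have comm: "\<exists>b'\<in>I. \<forall>v\<in>?V. s (\<rho> b v) - \<rho> b (s v) = \<rho> b' v" if "b \<in> I" for b
  proof -
    have "b \<in> cspan (\<Union>c. gen_eig I (bracket x) c)" using that by (simp only: spanI)
    then show ?thesis
    proof (induction rule: complex_vector.span_induct_alt)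
      case base
      show ?case
        by (intro bexI[of _ 0]) (auto simp: lie_module_zero[OF V] ms lin_on_zero[OF s(1)]
            complex_vector.subspace_0[OF lie_ideal_subspace[OF I(1)]])
    next
      case (step k y b)
      then obtain a where y: "y \<in> gen_eig I (bracket x) a" by blast
      obtain b' where b': "b' \<in> I" "\<And>v. v \<in> ?V \<Longrightarrow> s (\<rho> b v) - \<rho> b (s v) = \<rho> b' v"
        using step.IH by blast
      have eqy: "s (\<rho> y v) - \<rho> y (s v) = cnj a *\<^sub>C \<rho> y v" if "v \<in> ?V" for v
      proof (rule lin_on_ext_span[where B = "\<Union>c. gen_eig ?V (\<rho> x) c" and f = "\<lambda>v. s (\<rho> y v) - \<rho> y (s v)"
          and g = "\<lambda>v. cnj a *\<^sub>C \<rho> y v"])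
        show "lin_on (cspan (\<Union>c. gen_eig ?V (\<rho> x) c)) (\<lambda>v. s (\<rho> y v) - \<rho> y (s v))"
          unfolding spanV by (intro lin_on_minus_fun lin_on_comp[OF lV iV s(1)] lin_on_comp[OF s(1,2) lV])
        show "lin_on (cspan (\<Union>c. gen_eig ?V (\<rho> x) c)) (\<lambda>v. cnj a *\<^sub>C \<rho> y v)"
          unfolding spanV by (intro lin_on_scale_fun lV)
        show "v \<in> cspan (\<Union>c. gen_eig ?V (\<rho> x) c)" using that by (simp only: spanV)
      next
        fix v assume "v \<in> (\<Union>c. gen_eig ?V (\<rho> x) c)"
        then obtain c where v: "v \<in> gen_eig ?V (\<rho> x) c" by blast
        then have vV: "v \<in> ?V" by (simp add: gen_eig_def)
        show "s (\<rho> y v) - \<rho> y (s v) = cnj a *\<^sub>C \<rho> y v"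
          using s(3)[OF gen_eig_weight[OF V I(1) y v]] s(3)[OF v] vV
          by (simp add: lin_on_scale[OF lV] scaleC_add_left)
      qed
      have yI: "y \<in> I" using y by (simp add: gen_eig_def)
      show ?case
      proof (intro bexI[of _ "k *\<^sub>C cnj a *\<^sub>C y + b'"] ballI)
        show "k *\<^sub>C cnj a *\<^sub>C y + b' \<in> I"
          by (intro complex_vector.subspace_add complex_vector.subspace_scale lie_ideal_subspace[OF I(1)] yI b')
        fix v assume v: "v \<in> ?V"
        have "s (k *\<^sub>C \<rho> y v) = k *\<^sub>C s (\<rho> y v)" "s (k *\<^sub>C \<rho> y v + \<rho> b v) = s (k *\<^sub>C \<rho> y v) + s (\<rho> b v)"
          using v by (auto intro!: lin_on_scale[OF s(1)] lin_on_add[OF s(1)] mV complex_vector.span_scale)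
        then have "s (\<rho> (k *\<^sub>C y + b) v) - \<rho> (k *\<^sub>C y + b) (s v)
            = k *\<^sub>C (s (\<rho> y v) - \<rho> y (s v)) + (s (\<rho> b v) - \<rho> b (s v))"
          using v ms by (simp add: lie_module_add[OF V] lie_module_scale[OF V] complex_vector.scale_right_diff_distrib)
        also have "\<dots> = \<rho> (k *\<^sub>C cnj a *\<^sub>C y + b') v"
          using v eqy b' by (simp add: lie_module_add[OF V] lie_module_scale[OF V])
        finally show "s (\<rho> (k *\<^sub>C y + b) v) - \<rho> (k *\<^sub>C y + b) (s v) = \<rho> (k *\<^sub>C cnj a *\<^sub>C y + b') v" .
      qed
    qed
  qed
  have bB: "v \<in> B \<Longrightarrow> v \<in> ?V" for v by (rule complex_vector.span_base)
  \<comment> \<open>\<open>s\<close> stays attached to the fixed \<open>x\<close> while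
    \<open>z\<close> runs over the derived ideal, which makes the claim linear in
    \<open>z\<close>.\<close>
  have tr0: "trace_on B (\<lambda>v. \<rho> z (s v)) = 0" if "z \<in> derived I" for z
    using that unfolding derived_def
  proof (induction rule: complex_vector.span_induct_alt)
    case base
    have "trace_on B (\<lambda>v. \<rho> 0 (s v)) = trace_on B (\<lambda>v. 0 *\<^sub>C v)"
      by (rule trace_on_cong) (simp add: lie_module_zero[OF V] ms bB)
    also have "\<dots> = 0" by (subst trace_on_scale[OF B(2)]) (auto intro: bB)
    finally show ?case .
  next
    case (step k y z)
    then obtain a b where ab: "y = bracket a b" "a \<in> I" "b \<in> I" by blast
    obtain b' where b': "b' \<in> I" "\<And>v. v \<in> ?V \<Longrightarrow> s (\<rho> b v) - \<rho> b (s v) = \<rho> b' v"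
      using comm[OF ab(3)] by blast
    have "trace_on B (\<lambda>v. \<rho> b (\<rho> a (s v))) = trace_on B (\<lambda>v. \<rho> a (s (\<rho> b v)))"
    proof (rule trace_on_comp_commute[OF B B, of "\<lambda>v. \<rho> a (s v)" "\<rho> b"])
      show "lin_on ?V (\<lambda>v. \<rho> a (s v))" by (rule lin_on_comp[OF s(1,2) lV])
    qed (use mV ms lV in auto)
    also have "\<dots> = trace_on B (\<lambda>v. \<rho> a (\<rho> b (s v)) + \<rho> a (\<rho> b' v))"
    proof (rule trace_on_cong)
      fix v assume "v \<in> B"
      then have v: "v \<in> ?V" by (rule bB)
      have "s (\<rho> b v) = \<rho> b (s v) + \<rho> b' v" using b'(2)[OF v] by (simp add: algebra_simps)
      then show "\<rho> a (s (\<rho> b v)) = \<rho> a (\<rho> b (s v)) + \<rho> a (\<rho> b' v)"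
        using v ms mV by (simp add: lin_on_add[OF lV])
    qed
    also have "\<dots> = trace_on B (\<lambda>v. \<rho> a (\<rho> b (s v))) + trace_form B \<rho> a b'"
      unfolding trace_form_def by (rule trace_on_add[OF B(2)]) (auto simp: mV ms bB)
    finally have eq: "trace_on B (\<lambda>v. \<rho> b (\<rho> a (s v))) = trace_on B (\<lambda>v. \<rho> a (\<rho> b (s v)))"
      using tr[OF ab(2) b'(1)] by simp
    have "trace_on B (\<lambda>v. \<rho> y (s v)) = trace_on B (\<lambda>v. \<rho> a (\<rho> b (s v)) - \<rho> b (\<rho> a (s v)))"
      by (rule trace_on_cong) (simp add: ab lie_module_bracket[OF V] ms bB)
    also have "\<dots> = 0"
      by (subst trace_on_diff[OF B(2)]) (auto simp: mV ms bB eq)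
    finally have y0: "trace_on B (\<lambda>v. \<rho> y (s v)) = 0" .
    have "trace_on B (\<lambda>v. \<rho> (k *\<^sub>C y + z) (s v)) = trace_on B (\<lambda>v. k *\<^sub>C \<rho> y (s v) + \<rho> z (s v))"
      by (rule trace_on_cong) (simp add: lie_module_add[OF V] lie_module_scale[OF V] ms bB)
    also have "\<dots> = k * trace_on B (\<lambda>v. \<rho> y (s v)) + trace_on B (\<lambda>v. \<rho> z (s v))"
      by (subst trace_on_add[OF B(2)]; (subst trace_on_scale[OF B(2)])?)
        (auto simp: mV ms bB complex_vector.span_scale)
    finally show ?case using y0 step by simp
  qed
  show ?thesis using s(4) tr0[OF x] by blast
qed

section \<open>Semisimple Lie algebras\<close>

text \<open>Engel's theorem for the adjoint action on \<open>V/U\<close>, with the pair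
  \<open>U \<subset> V\<close> in place of the quotient. By induction, with \<open>K/L\<close> as
  the module, a maximal proper subalgebra \<open>L\<close> of \<open>K\<close> is normalized by some
  \<open>y\<close> of \<open>K\<close> outside it, so \<open>K\<close> is spanned by
  \<open>L\<close> and \<open>y\<close>. On the vectors killed by \<open>L\<close> modulo
  \<open>U\<close>, which the induction hypothesis supplies as well, \<open>y\<close> still acts
  nilpotently.\<close>

lemma engel:
  fixes J :: "'g::complex_lie_algebra set"
  assumes "finite_dim J" "csubspace K" "K \<subseteq> J" "\<And>x y. x \<in> K \<Longrightarrow> y \<in> K \<Longrightarrow> bracket x y \<in> K"
    and "\<And>x v. x \<in> K \<Longrightarrow> v \<in> J \<Longrightarrow> \<exists>n. (bracket x ^^ n) v = 0"
    and "csubspace U" "csubspace V" "U \<subset> V" "V \<subseteq> J"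
    and "\<And>x v. x \<in> K \<Longrightarrow> v \<in> V \<Longrightarrow> bracket x v \<in> V"
    and "\<And>x v. x \<in> K \<Longrightarrow> v \<in> U \<Longrightarrow> bracket x v \<in> U"
  shows "\<exists>v\<in>V - U. \<forall>x\<in>K. bracket x v \<in> U"
  using assms(2-)
proof (induction "cdim K" arbitrary: K U V rule: less_induct)
  case less
  show ?case
  proof (cases "K = {0}")
    case True
    obtain v where "v \<in> V - U" using less.prems by blast
    then show ?thesis using True complex_vector.subspace_0[OF less.prems(5)] by auto
  next
    case False
    have fK: "finite_dim K" using finite_dim_subset[OF assms(1)] less.prems by blast
    \<comment> \<open>Proper subalgebras of \<open>K\<close>; \<open>L\<close> is one of maximal
      dimension.\<close>
    define P where "P L \<longleftrightarrow> csubspace L \<and> L \<subset> K \<and> (\<forall>x\<in>L. \<forall>y\<in>L. bracket x y \<in> L)" for L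
    have "P {0}" using False complex_vector.subspace_0[OF less.prems(1)] by (auto simp: P_def)
    moreover have "\<forall>L. P L \<longrightarrow> cdim L < Suc (cdim K)"
      using dim_strict_mono[OF fK] by (auto simp: P_def less_Suc_eq)
    ultimately obtain L where L: "P L" and max: "\<And>L'. P L' \<Longrightarrow> cdim L' \<le> cdim L"
      using ex_has_greatest_nat[of P "{0}" cdim "Suc (cdim K)"] by (metis le_less_linear less_Suc_eq_le nat_less_le)
    have Lp: "csubspace L" "L \<subset> K" "\<And>x y. x \<in> L \<Longrightarrow> y \<in> L \<Longrightarrow> bracket x y \<in> L"
      using L by (auto simp: P_def)
    have dimL: "cdim L < cdim K" using dim_strict_mono[OF fK] Lp by blast
    have LJ: "L \<subseteq> J" and LK: "L \<subseteq> K" using Lp less.prems(2) by auto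
    have nilL: "\<exists>n. (bracket x ^^ n) v = 0" if "x \<in> L" "v \<in> J" for x v
      using less.prems(4) that LK by blast
    obtain y where y: "y \<in> K - L" "\<forall>x\<in>L. bracket x y \<in> L"
    proof -
      have "\<exists>v\<in>K - L. \<forall>x\<in>L. bracket x v \<in> L"
        by (rule less.hyps[OF dimL Lp(1) LJ Lp(3) nilL Lp(1) less.prems(1) Lp(2) less.prems(2)])
          (use LK less.prems(3) Lp(3) in auto)
      then show ?thesis using that by blast
    qed
    define L' where "L' = cspan (insert y L)"
    have L'mem: "z \<in> L' \<longleftrightarrow> (\<exists>k. z - k *\<^sub>C y \<in> L)" for z
      unfolding L'_def complex_vector.span_insert complex_vector.span_eq_iff[THEN iffD2, OF Lp(1)] by simp
    have L'sub: "L' \<subseteq> K" unfolding L'_def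
      by (rule complex_vector.span_minimal) (use y LK less.prems(1) in auto)
    have clos: "bracket u w \<in> L'" if uw: "u \<in> L'" "w \<in> L'" for u w
    proof -
      obtain k l where kl: "u - k *\<^sub>C y \<in> L" "w - l *\<^sub>C y \<in> L" using uw L'mem by blast
      define a b where "a = u - k *\<^sub>C y" and "b = w - l *\<^sub>C y"
      have ab: "u = a + k *\<^sub>C y" "w = b + l *\<^sub>C y" "a \<in> L" "b \<in> L" using kl by (auto simp: a_def b_def)
      have "bracket u w = bracket a b + l *\<^sub>C bracket a y - k *\<^sub>C bracket b y"
        unfolding ab by (simp add: bracket_add_left bracket_add_right bracket_scaleC_left bracket_scaleC_right
            bracket_self bracket_anticommute[of y b] )
      also have "\<dots> \<in> L"
        using y ab Lp by (intro complex_vector.subspace_diff complex_vector.subspace_add complex_vector.subspace_scale) auto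
      finally show ?thesis unfolding L'_def by (intro complex_vector.span_base) simp
    qed
    have "L' = K"
    proof (rule ccontr)
      assume "L' \<noteq> K"
      then have "P L'" using L'sub clos unfolding P_def by (auto simp: L'_def)
      then have "cdim L' \<le> cdim L" by (rule max)
      moreover have "L \<subset> L'" using y complex_vector.span_superset[of "insert y L"] by (auto simp: L'_def)
      moreover have "finite_dim L'" using finite_dim_subset[OF fK _ L'sub] by (simp add: L'_def)
      ultimately show False using dim_strict_mono[of L' L] Lp(1) by auto
    qed
    \<comment> \<open>\<open>y\<close> preserves \<open>W\<close> because it normalizes
      \<open>L\<close>. Among the iterates of \<open>y\<close> on a vector of \<open>W\<close>
      outside \<open>U\<close>, the last one outside \<open>U\<close> is killed by all of
      \<open>K\<close> modulo \<open>U\<close>.\<close>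
    define W where "W = {v \<in> V. \<forall>x\<in>L. bracket x v \<in> U}"
    obtain v where v: "v \<in> V - U" "\<forall>x\<in>L. bracket x v \<in> U"
    proof -
      have "\<exists>v\<in>V - U. \<forall>x\<in>L. bracket x v \<in> U"
        by (rule less.hyps[OF dimL Lp(1) LJ Lp(3) nilL less.prems(5-8)])
          (use LK less.prems(9,10) in auto)
      then show ?thesis using that by blast
    qed
    have yK: "y \<in> K" using y by blast
    have "v \<in> W" using v by (simp add: W_def)
    have Wy: "bracket y w \<in> W" if "w \<in> W" for w
      unfolding W_def
    proof (intro CollectI conjI ballI)
      show "bracket y w \<in> V" using that less.prems(9)[OF yK] by (simp add: W_def)
      fix x assume x: "x \<in> L"
      have "bracket x (bracket y w) = bracket (bracket x y) w + bracket y (bracket x w)"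
        by (simp add: bracket_bracket)
      also have "\<dots> \<in> U"
        using that x y less.prems(10)[OF yK] by (intro complex_vector.subspace_add[OF less.prems(5)]) (auto simp: W_def)
      finally show "bracket x (bracket y w) \<in> U" .
    qed
    obtain n where n: "(bracket y ^^ n) v = 0" using less.prems(4)[OF yK] v less.prems(8) by blast
    have "\<exists>w\<in>W - U. bracket y w \<in> U"
      using n \<open>v \<in> W\<close> v(1)
    proof (induction n arbitrary: v)
      case 0
      then show ?case using complex_vector.subspace_0[OF less.prems(5)] by auto
    next
      case (Suc n)
      show ?case
      proof (cases "bracket y v \<in> U")
        case True
        then show ?thesis using Suc by blast
      next
        case False
        have "(bracket y ^^ n) (bracket y v) = 0"
          using Suc.prems(1) by (simp only: funpow_Suc_right o_apply)
        then show ?thesis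
          using Suc.IH[of "bracket y v"] Wy[OF Suc.prems(2)] False by (auto simp: W_def)
      qed
    qed
    then obtain w where w: "w \<in> W" "w \<notin> U" "bracket y w \<in> U" by blast
    have "bracket x w \<in> U" if xK: "x \<in> K" for x
    proof -
      obtain k where k: "x - k *\<^sub>C y \<in> L" using xK L'mem[of x] unfolding \<open>L' = K\<close> by blast
      have "bracket x w = bracket ((x - k *\<^sub>C y) + k *\<^sub>C y) w" by simp
      also have "\<dots> = bracket (x - k *\<^sub>C y) w + k *\<^sub>C bracket y w"
        by (simp only: bracket_add_left bracket_scaleC_left)
      also have "\<dots> \<in> U"
        using k w by (intro complex_vector.subspace_add complex_vector.subspace_scale less.prems(5)) (auto simp: W_def)
      finally show ?thesis .
    qed
    then show ?thesis using w by (auto simp: W_def)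
  qed
qed

lemma abelian_ideal_zero:
  fixes Z :: "'g::complex_lie_algebra set"
  assumes "semisimple TYPE('g)" "lie_ideal Z" "\<And>x y. x \<in> Z \<Longrightarrow> y \<in> Z \<Longrightarrow> bracket x y = 0"
  shows "Z = {0}"
proof -
  have "{bracket x y |x y. x \<in> Z \<and> y \<in> Z} \<subseteq> {0}" using assms(3) by auto
  then have "derived Z \<subseteq> {0}"
    unfolding derived_def by (rule complex_vector.span_minimal) simp
  then have "derived Z = {0}"
    using complex_vector.subspace_0[of "derived Z"] by (auto simp: derived_def)
  then have "solvable Z" unfolding solvable_def by (intro exI[of _ 1]) simp
  then show ?thesis using assms by (auto simp: semisimple_def)
qed

text \<open>Cartan's criterion for an ideal on which the representation is faithful. Elements of the
  derived ideal \<open>D\<close> act nilpotently on \<open>V\<close>, hence also by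
  \<open>ad\<close> on \<open>J\<close>; by Engel a nonzero \<open>D\<close> has a nonzero center,
  which is an abelian ideal of the whole algebra. So \<open>D\<close> vanishes, \<open>J\<close> is
  abelian, and semisimplicity applies once more.\<close>

lemma ideal_with_zero_trace_form:
  fixes \<rho> :: "'g::complex_lie_algebra \<Rightarrow> 'v::complex_vector \<Rightarrow> 'v"
  assumes fd: "finite_dim (UNIV :: 'g set)" and ss: "semisimple TYPE('g)"
    and B: "finite B" "cindependent B" and V: "lie_module (cspan B) \<rho>"
    and J: "lie_ideal J"
    and tr: "\<And>a b. a \<in> J \<Longrightarrow> b \<in> J \<Longrightarrow> trace_form B \<rho> a b = 0"
    and faithful: "\<And>x. x \<in> J \<Longrightarrow> (\<forall>v\<in>cspan B. \<rho> x v = 0) \<Longrightarrow> x = 0"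
  shows "J = {0}"
proof -
  let ?V = "cspan B" and ?D = "derived J"
  note sV = lie_module_subspace[OF V] and lV = lie_module_lin[OF V] and iV = lie_module_image[OF V]
  note adJ = lie_ideal_adjoint[OF J]
  note sJ = lie_module_subspace[OF adJ] and lJ = lie_module_lin[OF adJ] and iJ = lie_module_image[OF adJ]
  have fJ: "finite_dim J" using finite_dim_subset[OF fd lie_ideal_subspace[OF J]] by simp
  have DJ: "?D \<subseteq> J" by (rule derived_subset[OF J])
  have D: "lie_ideal ?D" by (rule derived_lie_ideal[OF J])
  have nil: "gen_eig J (bracket x) 0 = J" if x: "x \<in> ?D" for x
  proof (rule nilpotent_of_gen_eig[OF sJ lJ iJ fJ])
    fix c y assume y: "y \<in> gen_eig J (bracket x) c" "y \<noteq> 0"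
    have V0: "gen_eig ?V (\<rho> x) 0 = ?V" by (rule cartan_nilpotent[OF B V J fJ tr x])
    show "c = 0"
    proof (rule ccontr)
      assume "c \<noteq> 0"
      \<comment> \<open>\<open>\<rho> y\<close> shifts the only weight \<open>0\<close> of
        \<open>\<rho> x\<close> to \<open>c\<close>; as \<open>c\<close> is nonzero, it annihilates
        everything, against faithfulness.\<close>
      have "\<rho> y v = 0" if "v \<in> ?V" for v
      proof -
        have "\<rho> y v \<in> gen_eig ?V (\<rho> x) c" using gen_eig_weight[OF V J y(1), of v 0] that V0 by simp
        moreover have "\<rho> y v \<in> gen_eig ?V (\<rho> x) 0" using V0 lie_module_mem[OF V that] by simp
        then obtain n where "(shift (\<rho> x) 0 ^^ n) (\<rho> y v) = 0" by (auto simp: gen_eig_def)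
        ultimately show ?thesis using gen_eig_shift_inj[OF sV lV iV] \<open>c \<noteq> 0\<close> by blast
      qed
      moreover have "y \<in> J" using y by (simp add: gen_eig_def)
      ultimately show False using faithful y by blast
    qed
  qed
  have "?D = {0}"
  proof (rule ccontr)
    assume ne: "?D \<noteq> {0}"
    have "\<exists>v\<in>?D - {0}. \<forall>x\<in>?D. bracket x v \<in> {0}"
    proof (rule engel[OF fJ lie_ideal_subspace[OF D] DJ])
      show "\<exists>n. (bracket x ^^ n) v = 0" if "x \<in> ?D" "v \<in> J" for x v
        using nil[OF that(1)] that(2) by (auto simp: gen_eig_zero)
      show "{0} \<subset> ?D" using ne complex_vector.subspace_0[OF lie_ideal_subspace[OF D]] by auto
    qed (use lie_ideal_bracket[OF D] lie_ideal_subspace[OF D] DJ in auto)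
    then obtain v where v: "v \<in> ?D" "v \<noteq> 0" "\<forall>x\<in>?D. bracket x v = 0" by blast
    let ?Z = "{v \<in> ?D. \<forall>x\<in>?D. bracket x v = 0}"
    have "lie_ideal ?Z"
      unfolding lie_ideal_def
    proof (intro conjI allI ballI)
      show "csubspace ?Z" using lie_ideal_subspace[OF D]
        by (auto intro!: complex_vector.subspaceI simp: bracket_add_right bracket_scaleC_right
            complex_vector.subspace_0 complex_vector.subspace_add complex_vector.subspace_scale)
      fix z y assume y: "y \<in> ?Z"
      have "bracket x (bracket z y) = 0" if x: "x \<in> ?D" for x
      proof -
        have "bracket x z \<in> ?D"
          using lie_ideal_bracket[OF D x, of z] bracket_anticommute[of x z]
            complex_vector.subspace_neg[OF lie_ideal_subspace[OF D]] by simp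
        then have "bracket (bracket x z) y = 0" using y by blast
        then show ?thesis using y x by (simp add: bracket_bracket)
      qed
      then show "bracket z y \<in> ?Z" using y lie_ideal_bracket[OF D] by blast
    qed
    then have "?Z = {0}" by (rule abelian_ideal_zero[OF ss]) auto
    then show False using v by blast
  qed
  moreover have "bracket x y \<in> ?D" if "x \<in> J" "y \<in> J" for x y
    unfolding derived_def using that by (auto intro!: complex_vector.span_base)
  ultimately show ?thesis by (intro abelian_ideal_zero[OF ss J]) auto
qed

section \<open>The Killing form\<close>

lemma center_zero:
  fixes x :: "'g::complex_lie_algebra"
  assumes "semisimple TYPE('g)" "\<And>y. bracket x y = 0"
  shows "x = 0"
proof -
  let ?Z = "{x :: 'g. \<forall>y. bracket x y = 0}"
  have "lie_ideal ?Z"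
    unfolding lie_ideal_def
    by (auto intro!: complex_vector.subspaceI simp: bracket_add_left bracket_scaleC_left bracket_bracket)
  then have "?Z = {0}" by (rule abelian_ideal_zero[OF assms(1)]) auto
  then show ?thesis using assms(2) by blast
qed

context
  fixes B :: "'g::complex_lie_algebra set"
  assumes fd: "finite_dim (UNIV :: 'g set)" and ss: "semisimple TYPE('g)"
    and B: "finite B" "cindependent B" "cspan B = UNIV"
begin

abbreviation "killing \<equiv> trace_form B bracket"

lemma killing_module: "lie_module (cspan B) bracket"
  using adjoint_module B by simp

text \<open>The adjoint representation is faithful because the center vanishes, so Cartan's
  criterion applies to it.\<close>

lemma ideal_zero_of_killing:
  assumes "lie_ideal J" "\<And>a b. a \<in> J \<Longrightarrow> b \<in> J \<Longrightarrow> killing a b = 0"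
  shows "J = {0}"
  by (rule ideal_with_zero_trace_form[OF fd ss B(1,2) killing_module assms])
    (use B center_zero[OF ss] in auto)

lemma killing_nondegenerate:
  assumes "\<And>y. killing x y = 0"
  shows "x = 0"
  using ideal_zero_of_killing[OF trace_form_radical_ideal[OF B(1,2) killing_module lie_ideal_UNIV]] assms by auto

text \<open>Orthogonality to \<open>K\<close> amounts to \<open>dim K\<close> linear equations in a
  space of larger dimension.\<close>

lemma killing_perp_nonzero:
  assumes "csubspace K" "K \<noteq> UNIV"
  shows "\<exists>x. x \<noteq> 0 \<and> (\<forall>k\<in>K. killing x k = 0)"
proof -
  obtain C where C: "finite C" "cindependent C" "cspan C = K" "card C = cdim K"
    using subspace_basis[OF fd assms(1)] by auto
  have "cdim K < cdim (UNIV :: 'g set)" using dim_strict_mono[OF fd assms(1)] assms(2) by auto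
  moreover have "cdim (UNIV :: 'g set) = card B"
    using complex_vector.dim_span_eq_card_independent[OF B(2)] B(3) by simp
  ultimately have "card ((\<lambda>b x. killing x b) ` C) < card B"
    using C card_image_le[OF C(1), of "\<lambda>b x. killing x b"] by simp
  then have "\<exists>x\<in>cspan B. x \<noteq> 0 \<and> (\<forall>\<phi>\<in>(\<lambda>b x. killing x b) ` C. \<phi> x = 0)"
    using C(1) B(1,2)
    by (intro common_zero) (auto simp: trace_form_add[OF B(1,2) killing_module] trace_form_scale[OF B(1,2) killing_module])
  then obtain x where x: "x \<noteq> 0" "\<forall>b\<in>C. killing x b = 0" by auto
  have "killing x k = 0" if "k \<in> K" for k
    using that unfolding C(3)[symmetric]
  proof (induction rule: complex_vector.span_induct_alt)
    case base
    show ?case using trace_form_zero[OF B(1,2) killing_module] by simp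
  next
    case (step c y z)
    then show ?case using x by (simp add: trace_form_add_right[OF B(1,2) killing_module]
          trace_form_scale_right[OF B(1,2) killing_module])
  qed
  then show ?thesis using x by blast
qed

text \<open>An \<open>x\<close> orthogonal to all brackets has
  \<open>killing [y, x] z = - killing x [y, z] = 0\<close>, so \<open>[y, x]\<close> vanishes by
  nondegeneracy and \<open>x\<close> is central, hence zero.\<close>

lemma perfect: "derived (UNIV :: 'g set) = UNIV"
proof (rule ccontr)
  assume "derived (UNIV :: 'g set) \<noteq> UNIV"
  then obtain x where x: "x \<noteq> 0" "\<forall>k\<in>derived UNIV. killing x k = 0"
    using killing_perp_nonzero[of "derived UNIV"] by (auto simp: derived_def)
  have "bracket y x = 0" for y
  proof (rule killing_nondegenerate)
    fix z
    have "bracket y z \<in> derived UNIV" by (auto simp: derived_def intro!: complex_vector.span_base)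
    then show "killing (bracket y x) z = 0"
      using x(2) by (simp add: trace_form_bracket[OF B(1,2) killing_module])
  qed
  then have "bracket x y = 0" for y using bracket_anticommute[of x y] by simp
  then show False using center_zero[OF ss] x by blast
qed

text \<open>The trace form of \<open>\<rho>\<close> degenerates on the kernel \<open>K\<close> of
  \<open>\<rho>\<close>. The remedy is the Killing-orthogonal ideal \<open>P\<close> of
  \<open>K\<close>: it meets \<open>K\<close> in zero, so \<open>\<rho>\<close> is faithful on it,
  and Cartan's criterion makes the trace form nondegenerate there. The Casimir operator is built on
  this ideal.\<close>

lemma nondegenerate_ideal:
  fixes \<rho> :: "'g \<Rightarrow> 'v::complex_vector \<Rightarrow> 'v"
  assumes C: "finite C" "cindependent C" and V: "lie_module (cspan C) \<rho>"
    and nontrivial: "\<exists>x. \<exists>v\<in>cspan C. \<rho> x v \<noteq> 0"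
  obtains P where "lie_ideal P" "P \<noteq> {0}"
    "\<And>x. x \<in> P \<Longrightarrow> (\<And>y. y \<in> P \<Longrightarrow> trace_form C \<rho> x y = 0) \<Longrightarrow> x = 0"
proof -
  define K where "K = {x. \<forall>v\<in>cspan C. \<rho> x v = 0}"
  have "lie_ideal K"
    unfolding lie_ideal_def K_def
    by (auto intro!: complex_vector.subspaceI simp: lie_module_zero[OF V] lie_module_add[OF V]
        lie_module_scale[OF V] lie_module_bracket[OF V] lie_module_mem[OF V] lie_module_zero_arg[OF V])
  define P where "P = {x. \<forall>k\<in>K. killing x k = 0}"
  have P: "lie_ideal P"
    unfolding P_def by (rule trace_form_radical_ideal[OF B(1,2) killing_module \<open>lie_ideal K\<close>])
  have KP: "K \<inter> P = {0}"
    by (rule ideal_zero_of_killing[OF lie_ideal_Int[OF \<open>lie_ideal K\<close> P]]) (auto simp: P_def)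
  have "K \<noteq> UNIV" using nontrivial by (auto simp: K_def)
  then have P0: "P \<noteq> {0}"
    using killing_perp_nonzero[OF lie_ideal_subspace[OF \<open>lie_ideal K\<close>]] by (auto simp: P_def)
  define J where "J = P \<inter> {x. \<forall>y\<in>P. trace_form C \<rho> x y = 0}"
  have J: "lie_ideal J"
    unfolding J_def by (rule lie_ideal_Int[OF P trace_form_radical_ideal[OF C V P]])
  have "J = {0}"
  proof (rule ideal_with_zero_trace_form[OF fd ss C V J])
    show "trace_form C \<rho> a b = 0" if "a \<in> J" "b \<in> J" for a b using that by (simp add: J_def)
    show "x = 0" if "x \<in> J" "\<forall>v\<in>cspan C. \<rho> x v = 0" for x
    proof -
      have "x \<in> K \<inter> P" using that by (simp add: J_def K_def)
      then show ?thesis using KP by simp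
    qed
  qed
  then show ?thesis using that[OF P P0] by (auto simp: J_def)
qed

end

section \<open>The Casimir operator\<close>

text \<open>\<open>d\<close> is the basis of \<open>P\<close> dual to \<open>E\<close> under the
  trace form of \<open>cspan C\<close>. The operator commutes with the action on every module for
  \<open>\<rho>\<close>, also on those larger than \<open>cspan C\<close>; this lets it act on an
  extension. The values \<open>1\<close> fix its trace on \<open>cspan C\<close> as
  \<open>card E\<close>.\<close>

lemma casimir:
  fixes \<rho> :: "'g::complex_lie_algebra \<Rightarrow> 'v::complex_vector \<Rightarrow> 'v"
  assumes C: "finite C" "cindependent C" and W: "lie_module (cspan C) \<rho>"
    and P: "lie_ideal P" "P \<noteq> {0}" "finite_dim P"
    and nd: "\<And>x. x \<in> P \<Longrightarrow> (\<And>y. y \<in> P \<Longrightarrow> trace_form C \<rho> x y = 0) \<Longrightarrow> x = 0"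
  obtains E d where "finite E" "E \<noteq> {}" "\<And>b. b \<in> E \<Longrightarrow> trace_form C \<rho> b (d b) = 1"
    "\<And>V z v. lie_module V \<rho> \<Longrightarrow> v \<in> V \<Longrightarrow>
      \<rho> z (\<Sum>b\<in>E. \<rho> b (\<rho> (d b) v)) = (\<Sum>b\<in>E. \<rho> b (\<rho> (d b) (\<rho> z v)))"
proof -
  let ?t = "trace_form C \<rho>"
  note tl = trace_form_add[OF C W] trace_form_scale[OF C W] trace_form_add_right[OF C W] trace_form_scale_right[OF C W]
    trace_form_zero[OF C W]
  note sP = lie_ideal_subspace[OF P(1)]
  have tsuml: "?t (\<Sum>i\<in>A. c i *\<^sub>C x i) y = (\<Sum>i\<in>A. c i * ?t (x i) y)" for A c and x :: "'g \<Rightarrow> 'g" and y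
    by (induction A rule: infinite_finite_induct) (simp_all add: tl)
  have tsumr: "?t y (\<Sum>i\<in>A. c i *\<^sub>C x i) = (\<Sum>i\<in>A. c i * ?t y (x i))" for A c and x :: "'g \<Rightarrow> 'g" and y
    by (induction A rule: infinite_finite_induct) (simp_all add: tl)
  obtain E where E: "finite E" "cindependent E" "cspan E = P" using finite_dim_basis[OF P(3)] by metis
  have EP: "b \<in> E \<Longrightarrow> b \<in> P" for b using E(3) complex_vector.span_base by blast
  have ndr: "x = 0" if x: "x \<in> P" "\<And>b. b \<in> E \<Longrightarrow> ?t b x = 0" for x
  proof (rule nd[OF x(1)])
    fix y assume "y \<in> P"
    then have "y = (\<Sum>b\<in>E. complex_vector.representation E y b *\<^sub>C b)"
      using complex_vector.sum_representation_eq[OF E(2) _ E(1)] E(3) by simp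
    then have "?t y x = (\<Sum>b\<in>E. complex_vector.representation E y b * ?t b x)"
      using tsuml[of "complex_vector.representation E y" "\<lambda>b. b" E x] by simp
    then show "?t x y = 0" using x(2) by (simp add: trace_form_commute[OF C W, of x])
  qed
  have "\<exists>e\<in>P. \<forall>b'\<in>E. ?t b' e = (if b' = b then 1 else 0)" if b: "b \<in> E" for b
  proof -
    \<comment> \<open>One more unknown than equations: besides the coefficients of \<open>x\<close>
      on \<open>E\<close>, the index \<open>None\<close> stands for the value that \<open>x\<close>
      takes against \<open>b\<close>. If that value were zero, \<open>x\<close> would be orthogonal
      to \<open>P\<close>.\<close>
    define a where "a i j = (case i of None \<Rightarrow> (if j = b then - 1 else 0) | Some b' \<Rightarrow> ?t j b')" for i j
    have "card E < card (insert None (Some ` E))"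
      using E(1) by (subst card_insert_disjoint) (auto simp: card_image)
    then obtain c where c: "\<exists>i\<in>insert None (Some ` E). c i \<noteq> 0"
      "\<forall>j\<in>E. (\<Sum>i\<in>insert None (Some ` E). c i * a i j) = 0"
      using homogeneous_system[OF E(1), of "insert None (Some ` E)" a] E(1) by blast
    define x where "x = (\<Sum>b'\<in>E. c (Some b') *\<^sub>C b')"
    have xP: "x \<in> P" unfolding x_def using EP by (intro subspace_lincomb sP)
    have tx: "?t j x = (if j = b then c None else 0)" if "j \<in> E" for j
    proof -
      have "0 = c None * a None j + (\<Sum>b'\<in>E. c (Some b') * a (Some b') j)"
        using c(2) that E(1) by (simp add: sum.reindex)
      also have "(\<Sum>b'\<in>E. c (Some b') * a (Some b') j) = ?t j x"
        unfolding x_def tsumr by (simp add: a_def)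
      finally show ?thesis by (auto simp: a_def)
    qed
    have "c None \<noteq> 0"
    proof
      assume c0: "c None = 0"
      then have "x = 0" using ndr[OF xP] tx by simp
      then have "\<forall>b'\<in>E. c (Some b') = 0"
        using complex_vector.independentD[OF E(2,1) order_refl, of "\<lambda>b'. c (Some b')"] by (simp add: x_def)
      then show False using c(1) c0 by auto
    qed
    then show ?thesis
      using tx complex_vector.subspace_scale[OF sP xP, of "1 / c None"]
      by (intro bexI[of _ "(1 / c None) *\<^sub>C x"]) (auto simp: tl)
  qed
  then obtain d where d: "\<And>b. b \<in> E \<Longrightarrow> d b \<in> P" "\<And>b b'. b \<in> E \<Longrightarrow> b' \<in> E \<Longrightarrow> ?t b' (d b) = (if b' = b then 1 else 0)"
    by metis
  \<comment> \<open>Dual bases give two expansions of \<open>u\<close>: along \<open>E\<close> with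
    coefficients \<open>?t u (d b)\<close>, and along \<open>d\<close> with coefficients
    \<open>?t b u\<close> (\<open>exp2\<close>).\<close>
  have exp1: "u = (\<Sum>b\<in>E. ?t u (d b) *\<^sub>C b)" if "u \<in> P" for u
  proof -
    let ?r = "complex_vector.representation E u"
    have u: "u = (\<Sum>b\<in>E. ?r b *\<^sub>C b)"
      using complex_vector.sum_representation_eq[OF E(2) _ E(1)] E(3) that by simp
    have "?t u (d b) = ?r b" if "b \<in> E" for b
    proof -
      have "?t u (d b) = (\<Sum>b'\<in>E. ?r b' * ?t b' (d b))"
        using tsuml[of ?r "\<lambda>b. b" E "d b"] u by simp
      also have "\<dots> = (\<Sum>b'\<in>E. if b' = b then ?r b' else 0)"
        using d(2)[OF that] by (intro sum.cong) auto
      finally show ?thesis using that E(1) by simp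
    qed
    then show ?thesis using u by simp
  qed
  have exp2: "u = (\<Sum>b\<in>E. ?t b u *\<^sub>C d b)" if u: "u \<in> P" for u
  proof -
    let ?w = "\<Sum>b\<in>E. ?t b u *\<^sub>C d b"
    have wP: "?w \<in> P" using d(1) by (intro subspace_lincomb sP)
    have "u + (-1) *\<^sub>C ?w = 0"
    proof (rule ndr)
      show "u + (-1) *\<^sub>C ?w \<in> P"
        using u wP sP complex_vector.subspace_add complex_vector.subspace_scale by blast
      fix b assume b: "b \<in> E"
      have "?t b ?w = (\<Sum>b'\<in>E. if b' = b then ?t b' u else 0)"
        unfolding tsumr using d(2)[OF _ b] by (intro sum.cong) auto
      then have "?t b ?w = ?t b u" using b E(1) by simp
      then show "?t b (u + (-1) *\<^sub>C ?w) = 0" by (simp only: tl) simp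
    qed
    then show ?thesis by simp
  qed
  have commute: "\<rho> z (\<Sum>b\<in>E. \<rho> b (\<rho> (d b) v)) = (\<Sum>b\<in>E. \<rho> b (\<rho> (d b) (\<rho> z v)))"
    if V: "lie_module V \<rho>" and v: "v \<in> V" for V z v
  proof -
    note mV = lie_module_mem[OF V] and lV = lie_module_lin[OF V] and sV = lie_module_subspace[OF V]
    have 1: "\<rho> (bracket z b) (\<rho> (d b) v) = (\<Sum>b'\<in>E. ?t (bracket z b) (d b') *\<^sub>C \<rho> b' (\<rho> (d b) v))" if "b \<in> E" for b
    proof -
      have eq: "bracket z b = (\<Sum>b'\<in>E. ?t (bracket z b) (d b') *\<^sub>C b')"
        by (rule exp1) (intro lie_ideal_bracket[OF P(1)] EP that)
      show ?thesis
        by (subst eq) (rule lie_module_lincomb[OF V mV[OF v]])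
    qed
    have 2: "\<rho> b (\<rho> (bracket z (d b)) v) = (\<Sum>b'\<in>E. ?t b' (bracket z (d b)) *\<^sub>C \<rho> b (\<rho> (d b') v))" if "b \<in> E" for b
    proof -
      have eq: "bracket z (d b) = (\<Sum>b'\<in>E. ?t b' (bracket z (d b)) *\<^sub>C d b')"
        by (rule exp2) (intro lie_ideal_bracket[OF P(1)] d that)
      have "\<rho> (bracket z (d b)) v = (\<Sum>b'\<in>E. ?t b' (bracket z (d b)) *\<^sub>C \<rho> (d b') v)"
        by (subst eq) (rule lie_module_lincomb[OF V v])
      then show ?thesis
        using lin_on_sum_scale[OF lV sV, of E "\<lambda>b'. \<rho> (d b') v"] mV[OF v] by simp
    qed
    have step: "\<rho> z (\<rho> b (\<rho> (d b) v))
        = \<rho> (bracket z b) (\<rho> (d b) v) + \<rho> b (\<rho> (bracket z (d b)) v) + \<rho> b (\<rho> (d b) (\<rho> z v))" for b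
    proof -
      have "\<rho> b (\<rho> (bracket z (d b)) v) = \<rho> b (\<rho> z (\<rho> (d b) v)) - \<rho> b (\<rho> (d b) (\<rho> z v))"
        using v mV by (simp add: lie_module_bracket[OF V] lin_on_diff[OF lV sV])
      moreover have "\<rho> (bracket z b) (\<rho> (d b) v) = \<rho> z (\<rho> b (\<rho> (d b) v)) - \<rho> b (\<rho> z (\<rho> (d b) v))"
        using v mV by (simp add: lie_module_bracket[OF V])
      ultimately show ?thesis by simp
    qed
    \<comment> \<open>Invariance of the form makes the matrices of \<open>ad z\<close> on
      \<open>E\<close> and on its dual basis negative transposes of each other, so the two sums
      cancel.\<close>
    have "(\<Sum>b\<in>E. \<rho> (bracket z b) (\<rho> (d b) v)) + (\<Sum>b\<in>E. \<rho> b (\<rho> (bracket z (d b)) v))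
        = (\<Sum>b\<in>E. \<Sum>b'\<in>E. ?t (bracket z b) (d b') *\<^sub>C \<rho> b' (\<rho> (d b) v))
          + (\<Sum>b'\<in>E. \<Sum>b\<in>E. ?t b (bracket z (d b')) *\<^sub>C \<rho> b' (\<rho> (d b) v))"
      by (simp add: 1 2)
    also have "(\<Sum>b'\<in>E. \<Sum>b\<in>E. ?t b (bracket z (d b')) *\<^sub>C \<rho> b' (\<rho> (d b) v))
        = (\<Sum>b\<in>E. \<Sum>b'\<in>E. ?t b (bracket z (d b')) *\<^sub>C \<rho> b' (\<rho> (d b) v))"
      by (rule sum.swap)
    also have "(\<Sum>b\<in>E. \<Sum>b'\<in>E. ?t (bracket z b) (d b') *\<^sub>C \<rho> b' (\<rho> (d b) v)) + \<dots>
        = (\<Sum>b\<in>E. \<Sum>b'\<in>E. (?t (bracket z b) (d b') + ?t b (bracket z (d b'))) *\<^sub>C \<rho> b' (\<rho> (d b) v))"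
      by (simp add: scaleC_add_left sum.distrib)
    also have "\<dots> = 0" by (simp add: trace_form_bracket[OF C W])
    finally have z: "(\<Sum>b\<in>E. \<rho> (bracket z b) (\<rho> (d b) v)) + (\<Sum>b\<in>E. \<rho> b (\<rho> (bracket z (d b)) v)) = 0" .
    have "\<rho> z (\<Sum>b\<in>E. \<rho> b (\<rho> (d b) v)) = (\<Sum>b\<in>E. \<rho> z (\<rho> b (\<rho> (d b) v)))"
      using v mV by (intro lin_on_sum[OF lV sV]) auto
    also have "\<dots> = (\<Sum>b\<in>E. \<rho> b (\<rho> (d b) (\<rho> z v)))"
      by (simp only: step sum.distrib z add_0)
    finally show ?thesis .
  qed
  have "E \<noteq> {}" using P(2) E(3) by auto
  then show ?thesis using that[of E d] E(1) d(2) commute by auto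
qed

section \<open>Weyl's theorem\<close>

text \<open>Makes linear maps vectors, so that \<open>weyl_complement\<close> can treat a space of
  them as the carrier of a module.\<close>

instantiation "fun" :: (type, complex_vector) complex_vector
begin
definition scaleC_fun :: "complex \<Rightarrow> ('a \<Rightarrow> 'b) \<Rightarrow> 'a \<Rightarrow> 'b"
  where "scaleC_fun c f = (\<lambda>x. c *\<^sub>C f x)"
instance
  by standard (simp_all add: scaleC_fun_def fun_eq_iff scaleC_add_right scaleC_add_left scaleC_scaleC scaleC_one)
end

lemma scaleC_fun_apply [simp]: "(c *\<^sub>C f) x = c *\<^sub>C f x"
  by (simp add: scaleC_fun_def)

lemma sum_fun_apply: "(\<Sum>i\<in>A. g i) x = (\<Sum>i\<in>A. g i x)"
  for g :: "'i \<Rightarrow> 'a \<Rightarrow> 'b::complex_vector"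
  by (induction A rule: infinite_finite_induct) simp_all

section \<open>Submodules and quotient modules\<close>

lemma lie_submoduleI:
  assumes "lie_module V \<rho>" "csubspace W" "W \<subseteq> V" "\<And>x w. w \<in> W \<Longrightarrow> \<rho> x w \<in> W"
  shows "lie_submodule W V \<rho>"
  using assms unfolding lie_submodule_def lie_module_def by (auto simp: subset_iff)

lemma lie_submoduleD:
  assumes "lie_submodule W V \<rho>"
  shows "W \<subseteq> V" "lie_module W \<rho>" "csubspace W" "w \<in> W \<Longrightarrow> \<rho> x w \<in> W"
  using assms by (auto simp: lie_submodule_def lie_module_subspace lie_module_mem)

lemma lie_submodule_trans: "lie_submodule U W \<rho> \<Longrightarrow> lie_submodule W V \<rho> \<Longrightarrow> lie_submodule U V \<rho>"
  by (auto simp: lie_submodule_def)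

lemma lie_submodule_span_Un:
  assumes V: "lie_module V \<rho>" and U: "lie_submodule U V \<rho>" "lie_submodule W V \<rho>"
  shows "lie_submodule (cspan (U \<union> W)) V \<rho>"
proof (rule lie_submoduleI[OF V])
  show "cspan (U \<union> W) \<subseteq> V"
    using U lie_module_subspace[OF V] by (intro complex_vector.span_minimal) (auto simp: lie_submodule_def)
  fix x w assume "w \<in> cspan (U \<union> W)"
  then obtain a b where ab: "w = a + b" "a \<in> cspan U" "b \<in> cspan W"
    unfolding complex_vector.span_Un by blast
  have sp: "cspan U = U" "cspan W = W"
    using complex_vector.span_eq_iff[THEN iffD2] lie_submoduleD(3)[OF U(1)] lie_submoduleD(3)[OF U(2)] by blast+
  have abm: "a \<in> U" "b \<in> W" using ab sp by auto
  then have "\<rho> x w = \<rho> x a + \<rho> x b"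
    using ab lin_on_add[OF lie_module_lin[OF V]] lie_submoduleD(1)[OF U(1)] lie_submoduleD(1)[OF U(2)] by blast
  also have "\<dots> \<in> cspan (U \<union> W)"
    using abm lie_submoduleD(4)[OF U(1)] lie_submoduleD(4)[OF U(2)]
    by (intro complex_vector.span_add complex_vector.span_base) auto
  finally show "\<rho> x w \<in> cspan (U \<union> W)" .
qed simp

lemma finite_dim_span_Un:
  assumes "finite_dim U" "finite_dim W"
  shows "finite_dim (cspan (U \<union> W))"
proof -
  obtain A where A: "finite A" "cspan A = U" using assms(1) by (auto simp: finite_dim_def)
  obtain B where B: "finite B" "cspan B = W" using assms(2) by (auto simp: finite_dim_def)
  have "cspan (U \<union> W) = cspan (A \<union> B)"
    unfolding complex_vector.span_Un A(2)[symmetric] B(2)[symmetric] complex_vector.span_span ..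
  then show ?thesis using finite_dim_span[of "A \<union> B"] A(1) B(1) by simp
qed

text \<open>The quotient \<open>V/U\<close> lives on a complement of \<open>U\<close>, with
  \<open>\<rho>\<close> followed by \<open>\<pi>\<close> as its action. The last conclusion says
  that this action may be computed on any representative, which is the homomorphism property of
  \<open>\<pi>\<close>.\<close>

lemma quotient_module:
  assumes V: "lie_module V \<rho>" and U: "lie_submodule U V \<rho>"
  obtains C \<pi> where "C \<subseteq> V" "Vector_Spaces.linear scaleC scaleC \<pi>"
    "\<And>v. v \<in> V \<Longrightarrow> \<pi> v \<in> C" "\<And>v. v \<in> C \<Longrightarrow> \<pi> v = v" "\<And>v. v \<in> V \<Longrightarrow> v - \<pi> v \<in> U"
    "\<And>v. v \<in> V \<Longrightarrow> \<pi> v = 0 \<longleftrightarrow> v \<in> U" "lie_module C (\<lambda>x v. \<pi> (\<rho> x v))"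
    "\<And>x v. v \<in> V \<Longrightarrow> \<pi> (\<rho> x (\<pi> v)) = \<pi> (\<rho> x v)"
proof -
  note sV = lie_module_subspace[OF V] and lV = lie_module_lin[OF V] and mV = lie_module_mem[OF V]
  obtain C \<pi> where C: "csubspace C" "C \<subseteq> V" and \<pi>: "Vector_Spaces.linear scaleC scaleC \<pi>"
    "\<And>v. v \<in> V \<Longrightarrow> \<pi> v \<in> C" "\<And>v. v \<in> C \<Longrightarrow> \<pi> v = v" "\<And>v. v \<in> V \<Longrightarrow> v - \<pi> v \<in> U"
    "\<And>v. v \<in> V \<Longrightarrow> \<pi> v = 0 \<longleftrightarrow> v \<in> U"
    by (rule complement_projection[OF lie_submoduleD(3)[OF U] sV lie_submoduleD(1)[OF U]]) (rule that)
  have CV: "v \<in> C \<Longrightarrow> v \<in> V" for v using C by blast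
  have lin: "\<pi> (a + b) = \<pi> a + \<pi> b" "\<pi> (a - b) = \<pi> a - \<pi> b" "\<pi> (c *\<^sub>C a) = c *\<^sub>C \<pi> a" for a b c
    by (simp_all add: cv_pair.linear_add[OF \<pi>(1)] cv_pair.linear_diff[OF \<pi>(1)] cv_pair.linear_scale[OF \<pi>(1)])
  have idem: "\<pi> (\<rho> x (\<pi> v)) = \<pi> (\<rho> x v)" if v: "v \<in> V" for x v
  proof -
    have "\<rho> x (v - \<pi> v) \<in> U" using \<pi>(4)[OF v] lie_submoduleD(4)[OF U] by blast
    moreover have "\<pi> v \<in> V" using \<pi>(2)[OF v] CV by blast
    moreover have "\<rho> x (v - \<pi> v) = \<rho> x v - \<rho> x (\<pi> v)"
      by (rule lin_on_diff[OF lV sV v \<open>\<pi> v \<in> V\<close>])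
    ultimately have "\<pi> (\<rho> x v - \<rho> x (\<pi> v)) = 0"
      using \<pi>(5) mV v complex_vector.subspace_diff[OF sV] by metis
    then show ?thesis by (simp add: lin)
  qed
  have "lie_module C (\<lambda>x v. \<pi> (\<rho> x v))"
    unfolding lie_module_def
    using C(1) \<pi>(2) mV CV
    by (auto simp: lin idem lin_on_add[OF lV] lin_on_scale[OF lV] lie_module_add[OF V] lie_module_scale[OF V]
        lie_module_bracket[OF V])
  then show ?thesis using that[of C \<pi>] C(2) \<pi> idem by blast
qed

section \<open>Submodules of codimension one\<close>

lemma trace_on_sum:
  assumes "cindependent B" "\<And>i b. i \<in> A \<Longrightarrow> b \<in> B \<Longrightarrow> f i b \<in> cspan B"
  shows "trace_on B (\<lambda>v. \<Sum>i\<in>A. f i v) = (\<Sum>i\<in>A. trace_on B (f i))"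
proof -
  have "trace_on B (\<lambda>v. \<Sum>i\<in>A. f i v) = (\<Sum>b\<in>B. \<Sum>i\<in>A. complex_vector.representation B (f i b) b)"
    unfolding trace_on_def
    by (rule sum.cong[OF refl]) (simp add: complex_vector.representation_sum[OF assms(1)] assms(2))
  then show ?thesis unfolding trace_on_def by (simp add: sum.swap[of _ B])
qed

text \<open>A bracket \<open>[a, b]\<close> acts on \<open>v\<close> by
  \<open>a (b v) - b (a v)\<close>, which vanishes because \<open>a v\<close> and \<open>b v\<close>
  lie in \<open>W\<close>; a semisimple algebra is spanned by brackets.\<close>

lemma acts_trivially_on_extension:
  fixes \<rho> :: "'g::complex_lie_algebra \<Rightarrow> 'v::complex_vector \<Rightarrow> 'v"
  assumes fd: "finite_dim (UNIV :: 'g set)" and ss: "semisimple TYPE('g)"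
    and V: "lie_module V \<rho>" and v: "v \<in> V" "\<And>x. \<rho> x v \<in> W"
    and W: "\<And>x w. w \<in> W \<Longrightarrow> \<rho> x w = 0"
  shows "\<rho> x v = 0"
proof -
  obtain B :: "'g set" where B: "finite B" "cindependent B" "cspan B = UNIV" using finite_dim_basis[OF fd] by metis
  have "x \<in> cspan {bracket x y | x y. x \<in> UNIV \<and> y \<in> (UNIV :: 'g set)}"
    using perfect[OF fd ss B] unfolding derived_def by auto
  then show ?thesis
  proof (induction rule: complex_vector.span_induct_alt)
    case base
    show ?case by (rule lie_module_zero[OF V v(1)])
  next
    case (step c y z)
    then obtain a b where "y = bracket a b" by blast
    then have "\<rho> y v = 0" using v W by (simp add: lie_module_bracket[OF V])
    then show ?case using step v(1) by (simp add: lie_module_add[OF V] lie_module_scale[OF V])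
  qed
qed

text \<open>The hypotheses make \<open>V/W\<close> the trivial module. A proper nonzero submodule
  \<open>U\<close> of \<open>W\<close> reduces the dimension twice, in \<open>V/U\<close> and in the
  preimage of the invariant line found there. For simple \<open>W\<close> with nontrivial action the
  Casimir operator is invertible on \<open>W\<close> and maps \<open>V\<close> into
  \<open>W\<close>, so its kernel is the complement.\<close>

lemma weyl_codimension_one:
  fixes \<rho> :: "'g::complex_lie_algebra \<Rightarrow> 'v::complex_vector \<Rightarrow> 'v"
  assumes fd: "finite_dim (UNIV :: 'g set)" and ss: "semisimple TYPE('g)"
    and "lie_module V \<rho>" "finite_dim V" "lie_submodule W V \<rho>"
    and "v0 \<in> V - W" "V = cspan (insert v0 W)" "\<And>x v. v \<in> V \<Longrightarrow> \<rho> x v \<in> W"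
  shows "\<exists>v\<in>V - W. \<forall>x. \<rho> x v = 0"
  using assms(3-)
proof (induction "cdim W" arbitrary: V W \<rho> v0 rule: less_induct)
  case less
  note V = less.prems(1) and W = less.prems(3)
  note sV = lie_module_subspace[OF V] and lV = lie_module_lin[OF V] and mV = lie_module_mem[OF V]
  note WV = lie_submoduleD(1)[OF W] and mW = lie_submoduleD(2)[OF W] and sW = lie_submoduleD(3)[OF W]
  have fW: "finite_dim W" using finite_dim_subset[OF less.prems(2) sW WV] .
  show ?case
  proof (cases "\<exists>U. lie_submodule U W \<rho> \<and> U \<noteq> {0} \<and> U \<noteq> W")
    case True
    then obtain U where U: "lie_submodule U W \<rho>" "U \<noteq> {0}" "U \<noteq> W" by blast
    note UW = lie_submoduleD(1)[OF U(1)] and sU = lie_submoduleD(3)[OF U(1)]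
    have UV: "lie_submodule U V \<rho>" by (rule lie_submodule_trans[OF U(1) W])
    obtain C \<pi> where C: "C \<subseteq> V" and \<pi>: "Vector_Spaces.linear scaleC scaleC \<pi>"
      "\<And>v. v \<in> V \<Longrightarrow> \<pi> v \<in> C" "\<And>v. v \<in> C \<Longrightarrow> \<pi> v = v" "\<And>v. v \<in> V \<Longrightarrow> v - \<pi> v \<in> U"
      "\<And>v. v \<in> V \<Longrightarrow> \<pi> v = 0 \<longleftrightarrow> v \<in> U" and modC: "lie_module C (\<lambda>x v. \<pi> (\<rho> x v))"
      and idem: "\<And>x v. v \<in> V \<Longrightarrow> \<pi> (\<rho> x (\<pi> v)) = \<pi> (\<rho> x v)"
      by (rule quotient_module[OF V UV]) (rule that)
    have \<pi>W: "\<pi> v \<in> W" if "v \<in> W" for v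
    proof -
      have "v - \<pi> v \<in> W" using that WV \<pi>(4) UW by blast
      then have "v - (v - \<pi> v) \<in> W" using that sW complex_vector.subspace_diff by blast
      then show ?thesis by simp
    qed
    define D where "D = \<pi> ` W"
    have DW: "D \<subseteq> W" using \<pi>W by (auto simp: D_def)
    have DC: "D \<subseteq> C" using \<pi>(2) WV by (auto simp: D_def)
    have sD: "csubspace D" unfolding D_def
      by (rule lin_on_image_subspace[OF linear_lin_on[OF \<pi>(1)] sW])
    have D: "lie_submodule D C (\<lambda>x v. \<pi> (\<rho> x v))"
    proof (rule lie_submoduleI[OF modC sD DC])
      fix x w assume "w \<in> D"
      then have "\<rho> x w \<in> W" using DW lie_submoduleD(4)[OF W] by blast
      then show "\<pi> (\<rho> x w) \<in> D" by (simp add: D_def)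
    qed
    have "D \<noteq> W"
    proof
      assume "D = W"
      obtain u where u: "u \<in> U" "u \<noteq> 0" using U(2) complex_vector.subspace_0[OF sU] by blast
      have "u \<in> V" "u \<in> C" using u UW WV DC \<open>D = W\<close> by auto
      then show False using \<pi>(3,5) u by metis
    qed
    then have dimD: "cdim D < cdim W" using dim_strict_mono[OF fW sD] DW by blast
    have fC: "finite_dim C" using finite_dim_subset[OF less.prems(2) lie_module_subspace[OF modC] C] .
    have v0: "v0 \<in> V" "v0 \<notin> W" using less.prems(4) by auto
    have "\<exists>v\<in>C - D. \<forall>x. \<pi> (\<rho> x v) = 0"
    proof (rule less.hyps[OF dimD modC fC D, of "\<pi> v0"])
      have "\<pi> v0 \<notin> D"
      proof
        assume "\<pi> v0 \<in> D"
        then have "(v0 - \<pi> v0) + \<pi> v0 \<in> W"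
          using \<pi>(4)[OF v0(1)] UW DW complex_vector.subspace_add[OF sW] by blast
        then show False using v0 by simp
      qed
      then show "\<pi> v0 \<in> C - D" using \<pi>(2) v0 by blast
      have "C = \<pi> ` V"
      proof
        show "C \<subseteq> \<pi> ` V" using \<pi>(3) C by (metis image_eqI subsetD subsetI)
      qed (use \<pi>(2) in auto)
      also have "\<dots> = cspan (\<pi> ` insert v0 W)"
        using cv_pair.linear_span_image[OF \<pi>(1), of "insert v0 W"] less.prems(5) by simp
      finally show "C = cspan (insert (\<pi> v0) D)" by (simp add: D_def)
      show "\<pi> (\<rho> x v) \<in> D" if "v \<in> C" for x v
        using that C less.prems(6) by (auto simp: D_def)
    qed
    then obtain v where v: "v \<in> C" "v \<notin> D" "\<And>x. \<pi> (\<rho> x v) = 0" by blast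
    have vV: "v \<in> V" using v C by blast
    have vW: "v \<notin> W" using v \<pi>(3)[OF v(1)] by (metis D_def image_eqI)
    have vU: "\<rho> x v \<in> U" for x using v(3) \<pi>(5) mV[OF vV] by blast
    \<comment> \<open>The preimage of the invariant line of \<open>V/U\<close>; \<open>U\<close> has
      codimension one in it, and the action maps it into \<open>U\<close>.\<close>
    define V' where "V' = cspan (insert v U)"
    have memV': "z \<in> V' \<longleftrightarrow> (\<exists>k. z - k *\<^sub>C v \<in> U)" for z
      unfolding V'_def complex_vector.span_insert complex_vector.span_eq_iff[THEN iffD2, OF sU] by simp
    have V'V: "V' \<subseteq> V" unfolding V'_def
      by (rule complex_vector.span_minimal[OF _ sV]) (use vV UW WV in auto)
    have UV': "U \<subseteq> V'" using complex_vector.span_superset[of "insert v U"] by (auto simp: V'_def)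
    have actV': "\<rho> x z \<in> U" if z: "z \<in> V'" for x z
    proof -
      obtain k where k: "z - k *\<^sub>C v \<in> U" using z memV' by blast
      have "z - k *\<^sub>C v \<in> V" "k *\<^sub>C v \<in> V" using k UW WV vV sV complex_vector.subspace_scale by auto
      then have "\<rho> x ((z - k *\<^sub>C v) + k *\<^sub>C v) = \<rho> x (z - k *\<^sub>C v) + k *\<^sub>C \<rho> x v"
        using vV by (simp only: lin_on_add[OF lV] lin_on_scale[OF lV])
      also have "\<dots> \<in> U"
        using k vU lie_submoduleD(4)[OF U(1)] by (intro complex_vector.subspace_add complex_vector.subspace_scale sU)
      finally show ?thesis by simp
    qed
    have subV': "lie_submodule V' V \<rho>"
      by (rule lie_submoduleI[OF V _ V'V]) (use actV' UV' in \<open>auto simp: V'_def\<close>)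
    have "\<exists>z\<in>V' - U. \<forall>x. \<rho> x z = 0"
    proof (rule less.hyps)
      show "cdim U < cdim W" using dim_strict_mono[OF fW sU] UW U(3) by blast
      show mV': "lie_module V' \<rho>" using lie_submoduleD(2)[OF subV'] .
      show "finite_dim V'" using finite_dim_subset[OF less.prems(2) lie_submoduleD(3)[OF subV'] V'V] .
      show "lie_submodule U V' \<rho>" using UV' lie_submoduleD(2)[OF U(1)] by (simp add: lie_submodule_def)
      show "v \<in> V' - U" using vW UW complex_vector.span_base[of v "insert v U"] by (auto simp: V'_def)
    qed (use actV' in \<open>auto simp: V'_def\<close>)
    then obtain z where z: "z \<in> V'" "z \<notin> U" "\<forall>x. \<rho> x z = 0" by blast
    obtain k where k: "z - k *\<^sub>C v \<in> U" using z memV' by blast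
    have "k \<noteq> 0" using k z(2) by auto
    have "z \<notin> W"
    proof
      assume "z \<in> W"
      then have "(1 / k) *\<^sub>C (z - (z - k *\<^sub>C v)) \<in> W"
        using k UW sW complex_vector.subspace_diff complex_vector.subspace_scale by blast
      then show False using vW \<open>k \<noteq> 0\<close> by simp
    qed
    then show ?thesis using z V'V by blast
  next
    case False
    then have simple: "U = {0} \<or> U = W" if "lie_submodule U W \<rho>" for U using that by blast
    have v0: "v0 \<in> V" "v0 \<notin> W" using less.prems(4) by auto
    show ?thesis
    proof (cases "\<forall>x. \<forall>w\<in>W. \<rho> x w = 0")
      case True
      then have "\<rho> x v0 = 0" for x
        using acts_trivially_on_extension[OF fd ss V v0(1), of W] less.prems(6)[OF v0(1)] by blast
      then show ?thesis using v0 by blast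
    next
      case False
      obtain B :: "'g set" where B: "finite B" "cindependent B" "cspan B = UNIV" using finite_dim_basis[OF fd] by metis
      obtain C where C: "finite C" "cindependent C" "cspan C = W" using finite_dim_basis[OF fW] by metis
      have mC: "lie_module (cspan C) \<rho>" using mW C by simp
      obtain P where P: "lie_ideal P" "P \<noteq> {0}"
        "\<And>x. x \<in> P \<Longrightarrow> (\<And>y. y \<in> P \<Longrightarrow> trace_form C \<rho> x y = 0) \<Longrightarrow> x = 0"
        by (rule nondegenerate_ideal[OF fd ss B C(1,2) mC]) (use False C in auto)
      have fP: "finite_dim P" using finite_dim_subset[OF fd lie_ideal_subspace[OF P(1)]] by simp
      obtain E d where E: "finite E" "E \<noteq> {}" "\<And>b. b \<in> E \<Longrightarrow> trace_form C \<rho> b (d b) = 1"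
        and comm: "\<And>V z v. lie_module V \<rho> \<Longrightarrow> v \<in> V \<Longrightarrow>
          \<rho> z (\<Sum>b\<in>E. \<rho> b (\<rho> (d b) v)) = (\<Sum>b\<in>E. \<rho> b (\<rho> (d b) (\<rho> z v)))"
        by (rule casimir[OF C(1,2) mC P(1,2) fP]) (rule P(3), simp, simp, rule that)
      define c where "c v = (\<Sum>b\<in>E. \<rho> b (\<rho> (d b) v))" for v
      have lc: "lin_on V c"
        unfolding lin_on_def c_def
        by (simp add: lin_on_add[OF lV] lin_on_scale[OF lV] mV sum.distrib complex_vector.scale_sum_right)
      have cW: "c v \<in> W" if "v \<in> V" for v
        unfolding c_def using that mV less.prems(6) by (intro complex_vector.subspace_sum[OF sW]) auto
      have cz: "\<rho> z (c v) = c (\<rho> z v)" if "v \<in> V" for z v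
        unfolding c_def by (rule comm[OF V that])
      \<comment> \<open>Schur's argument: the kernel of the Casimir operator on the simple module
        \<open>W\<close> is a submodule, and it is not \<open>W\<close> because the trace of
        \<open>c\<close> on \<open>W\<close> is \<open>card E\<close>.\<close>
      define N where "N = {w \<in> W. c w = 0}"
      have "lie_submodule N W \<rho>"
      proof (rule lie_submoduleI[OF mW])
        show "csubspace N"
          unfolding N_def using sW WV lin_on_zero[OF lc sV]
          by (intro complex_vector.subspaceI)
            (auto simp: complex_vector.subspace_0 complex_vector.subspace_add complex_vector.subspace_scale
              lin_on_add[OF lc] lin_on_scale[OF lc] subset_iff)
        show "\<rho> x w \<in> N" if "w \<in> N" for x w
          using that lie_submoduleD(4)[OF W] cz[of w x] WV lie_module_zero_arg[OF V] by (auto simp: N_def)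
      qed (auto simp: N_def)
      moreover have "N \<noteq> W"
      proof
        assume "N = W"
        then have c0: "c w = 0" if "w \<in> W" for w using that by (auto simp: N_def)
        have CW: "w \<in> C \<Longrightarrow> w \<in> W" for w using C(3) complex_vector.span_base by blast
        have "of_nat (card E) = (\<Sum>b\<in>E. trace_form C \<rho> b (d b))" using E(3) by simp
        also have "\<dots> = trace_on C c"
          unfolding trace_form_def c_def
          by (rule trace_on_sum[symmetric, OF C(2)]) (simp only: C(3) lie_submoduleD(4)[OF W] CW)
        also have "\<dots> = 0" unfolding trace_on_def using c0 CW
          by (simp add: complex_vector.representation_zero)
        finally show False using E(1,2) by simp
      qed
      ultimately have N0: "N = {0}" using simple by blast
      have "c ` W = W"
      proof (rule injective_endo_surj[OF fW lin_on_subset[OF lc WV]])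
        show "c ` W \<subseteq> W" using cW WV by auto
        show "v = 0" if "v \<in> W" "c v = 0" for v using that N0 by (auto simp: N_def)
      qed
      \<comment> \<open>\<open>c\<close> maps \<open>W\<close> onto itself, so \<open>v0\<close> can
        be corrected by an element of \<open>W\<close> to lie in the kernel of
        \<open>c\<close>.\<close>
      then obtain w where w: "w \<in> W" "c w = c v0" using cW[OF v0(1)] by (metis image_iff)
      have wV: "w \<in> V" using w WV by blast
      let ?v = "v0 - w"
      have vV: "?v \<in> V" using complex_vector.subspace_diff[OF sV v0(1) wV] .
      have "c ?v = 0" using w lin_on_diff[OF lc sV v0(1) wV] by simp
      then have "c (\<rho> x ?v) = 0" for x using cz[OF vV, of x] lie_module_zero_arg[OF V] by simp
      then have "\<rho> x ?v \<in> N" for x using less.prems(6)[OF vV] by (simp add: N_def)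
      then have "\<rho> x ?v = 0" for x using N0 by blast
      moreover have "?v \<notin> W"
      proof
        assume "?v \<in> W"
        then have "?v + w \<in> W" using w complex_vector.subspace_add[OF sW] by blast
        then show False using v0 by simp
      qed
      ultimately show ?thesis using vV by blast
    qed
  qed
qed

text \<open>The submodule case is the codimension one case inside the module of those linear maps
  \<open>V \<rightarrow> W\<close> that restrict to a scalar on \<open>W\<close>.\<close>

theorem weyl_complement:
  fixes \<rho> :: "'g::complex_lie_algebra \<Rightarrow> 'v::complex_vector \<Rightarrow> 'v"
  assumes fd: "finite_dim (UNIV :: 'g set)" and ss: "semisimple TYPE('g)"
    and V: "lie_module V \<rho>" "finite_dim V" and W: "lie_submodule W V \<rho>"
  obtains U where "lie_submodule U V \<rho>" "U \<inter> W = {0}" "\<And>v. v \<in> V \<Longrightarrow> \<exists>u\<in>U. \<exists>w\<in>W. v = u + w"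
proof -
  note sV = lie_module_subspace[OF V(1)] and lV = lie_module_lin[OF V(1)] and mV = lie_module_mem[OF V(1)]
  note WV = lie_submoduleD(1)[OF W] and sW = lie_submoduleD(3)[OF W] and mW = lie_submoduleD(4)[OF W]
  have WVm: "w \<in> W \<Longrightarrow> w \<in> V" for w using WV by blast
  have "\<exists>U. lie_submodule U V \<rho> \<and> U \<inter> W = {0} \<and> (\<forall>v\<in>V. \<exists>u\<in>U. \<exists>w\<in>W. v = u + w)"
  proof (cases "W = {0}")
    case True
    then show ?thesis using V complex_vector.subspace_0[OF sV] by (intro exI[of _ V]) (auto simp: lie_submodule_def)
  next
    case False
    \<comment> \<open>Maps are set to zero off \<open>V\<close>: equality of functions then means
      equality on \<open>V\<close>, and \<open>E1\<close> has finite dimension.\<close>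
    define E1 where "E1 = {f :: 'v \<Rightarrow> 'v. lin_on V f \<and> (\<forall>v\<in>V. f v \<in> W) \<and> (\<forall>v. v \<notin> V \<longrightarrow> f v = 0) \<and> (\<exists>c. \<forall>w\<in>W. f w = c *\<^sub>C w)}"
    define E0 where "E0 = {f \<in> E1. \<forall>w\<in>W. f w = 0}"
    define \<sigma> where "\<sigma> x f = (\<lambda>v. if v \<in> V then \<rho> x (f v) - f (\<rho> x v) else 0)" for x and f :: "'v \<Rightarrow> 'v"
    have E1D: "lin_on V f" "v \<in> V \<Longrightarrow> f v \<in> W" "v \<in> V \<Longrightarrow> f v \<in> V" "v \<notin> V \<Longrightarrow> f v = 0" if "f \<in> E1" for f v
      using that WVm by (auto simp: E1_def)
    have sE1: "csubspace E1"
    proof (rule complex_vector.subspaceI)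
      show "0 \<in> E1"
        using complex_vector.subspace_0[OF sW] by (auto simp: E1_def lin_on_def intro!: exI[of _ 0])
    next
      fix f g assume fg: "f \<in> E1" "g \<in> E1"
      obtain a b where "\<forall>w\<in>W. f w = a *\<^sub>C w" "\<forall>w\<in>W. g w = b *\<^sub>C w" using fg by (auto simp: E1_def)
      then have "\<exists>c. \<forall>w\<in>W. (f + g) w = c *\<^sub>C w" by (intro exI[of _ "a + b"]) (simp add: scaleC_add_left)
      moreover have "lin_on V (\<lambda>v. f v + g v)" by (rule lin_on_plus[OF E1D(1)[OF fg(1)] E1D(1)[OF fg(2)]])
      ultimately show "f + g \<in> E1"
        using fg complex_vector.subspace_add[OF sW] by (auto simp: E1_def plus_fun_def)
    next
      fix k f assume f: "f \<in> E1"
      obtain a where "\<forall>w\<in>W. f w = a *\<^sub>C w" using f by (auto simp: E1_def)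
      then have "\<exists>c. \<forall>w\<in>W. (k *\<^sub>C f) w = c *\<^sub>C w" by (intro exI[of _ "k * a"]) (simp add: scaleC_scaleC)
      moreover have "lin_on V (\<lambda>v. k *\<^sub>C f v)" by (rule lin_on_scale_fun[OF E1D(1)[OF f]])
      ultimately show "k *\<^sub>C f \<in> E1"
        using f complex_vector.subspace_scale[OF sW] by (auto simp: E1_def scaleC_fun_def)
    qed
    \<comment> \<open>The scalar on \<open>W\<close> commutes with \<open>\<rho> x\<close>, so the
      commutator vanishes on \<open>W\<close>: the quotient of \<open>E1\<close> by
      \<open>E0\<close> is a trivial module.\<close>
    have \<sigma>E0: "\<sigma> x f \<in> E0" if f: "f \<in> E1" for x f
    proof -
      have l: "lin_on V (\<lambda>v. \<rho> x (f v) - f (\<rho> x v))"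
        by (intro lin_on_minus_fun lin_on_comp[OF E1D(1)[OF f] _ lV]
            lin_on_comp[OF lV lie_module_image[OF V(1)] E1D(1)[OF f]]) (use E1D[OF f] in auto)
      obtain a where a: "\<forall>w\<in>W. f w = a *\<^sub>C w" using f by (auto simp: E1_def)
      have z: "\<sigma> x f w = 0" if "w \<in> W" for w
        using that a mW[OF that] WVm by (simp add: \<sigma>_def lin_on_scale[OF lV])
      have "lin_on V (\<sigma> x f)"
        using l complex_vector.subspace_add[OF sV] complex_vector.subspace_scale[OF sV]
        unfolding lin_on_def \<sigma>_def by simp
      moreover have "\<sigma> x f v \<in> W" if "v \<in> V" for v
        using that E1D[OF f] mV mW complex_vector.subspace_diff[OF sW] by (simp add: \<sigma>_def)
      moreover have "\<exists>c. \<forall>w\<in>W. \<sigma> x f w = c *\<^sub>C w" using z by (intro exI[of _ 0]) simp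
      ultimately show ?thesis using z by (simp add: E0_def E1_def \<sigma>_def)
    qed
    have modE1: "lie_module E1 \<sigma>"
      unfolding lie_module_def
    proof (intro conjI allI ballI)
      fix x y :: 'g and f g :: "'v \<Rightarrow> 'v" and c :: complex
      show "csubspace E1" by (rule sE1)
      show "f \<in> E1 \<Longrightarrow> \<sigma> x f \<in> E1" using \<sigma>E0 by (auto simp: E0_def)
      show "f \<in> E1 \<Longrightarrow> g \<in> E1 \<Longrightarrow> \<sigma> x (f + g) = \<sigma> x f + \<sigma> x g"
        using E1D by (auto simp: \<sigma>_def fun_eq_iff lin_on_add[OF lV])
      show "f \<in> E1 \<Longrightarrow> \<sigma> x (c *\<^sub>C f) = c *\<^sub>C \<sigma> x f"
        using E1D by (auto simp: \<sigma>_def fun_eq_iff lin_on_scale[OF lV] complex_vector.scale_right_diff_distrib)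
      show "f \<in> E1 \<Longrightarrow> \<sigma> (x + y) f = \<sigma> x f + \<sigma> y f"
        using E1D mV by (auto simp: \<sigma>_def fun_eq_iff lie_module_add[OF V(1)] lin_on_add[OF E1D(1)])
      show "f \<in> E1 \<Longrightarrow> \<sigma> (c *\<^sub>C x) f = c *\<^sub>C \<sigma> x f"
        using E1D mV by (auto simp: \<sigma>_def fun_eq_iff lie_module_scale[OF V(1)] lin_on_scale[OF E1D(1)]
            complex_vector.scale_right_diff_distrib)
      show "f \<in> E1 \<Longrightarrow> \<sigma> (bracket x y) f = \<sigma> x (\<sigma> y f) - \<sigma> y (\<sigma> x f)"
        using E1D mV by (auto simp: \<sigma>_def fun_eq_iff lie_module_bracket[OF V(1)] lin_on_diff[OF E1D(1) sV]
            lin_on_diff[OF lV sV])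
    qed
    have subE0: "lie_submodule E0 E1 \<sigma>"
    proof (rule lie_submoduleI[OF modE1])
      show "csubspace E0"
        unfolding E0_def using sE1
        by (intro complex_vector.subspaceI)
          (auto simp: complex_vector.subspace_0 complex_vector.subspace_add complex_vector.subspace_scale)
      show "\<sigma> x f \<in> E0" if "f \<in> E0" for x f using that \<sigma>E0 by (auto simp: E0_def)
    qed (auto simp: E0_def)
    obtain B where B: "finite B" "cindependent B" "cspan B = V" using finite_dim_basis[OF V(2)] by metis
    obtain C where C: "finite C" "cindependent C" "cspan C = W"
      using finite_dim_basis[OF finite_dim_subset[OF V(2) sW WV]] by metis
    \<comment> \<open>Matrix units: the \<open>b\<close>-coordinate of \<open>v\<close> times the
      basis vector \<open>c\<close>.\<close>
    define e where "e b c = (\<lambda>v. if v \<in> V then complex_vector.representation B v b *\<^sub>C c else 0)" for b and c :: 'v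
    let ?G = "(\<lambda>(b, c). e b c) ` (B \<times> C)"
    have "E1 \<subseteq> cspan ?G"
    proof
      fix f assume f: "f \<in> E1"
      have BV: "b \<in> B \<Longrightarrow> b \<in> V" for b using B(3) complex_vector.span_base by blast
      let ?c = "\<lambda>b c. complex_vector.representation C (f b) c"
      have eq: "f v = (\<Sum>b\<in>B. \<Sum>c\<in>C. ?c b c *\<^sub>C e b c v)" for v
      proof (cases "v \<in> V")
        case True
        have "f v = f (\<Sum>b\<in>B. complex_vector.representation B v b *\<^sub>C b)"
          using complex_vector.sum_representation_eq[OF B(2) _ B(1)] B(3) True by simp
        also have "\<dots> = (\<Sum>b\<in>B. complex_vector.representation B v b *\<^sub>C f b)"
          by (rule lin_on_sum_scale[OF E1D(1)[OF f] sV BV])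
        also have "\<dots> = (\<Sum>b\<in>B. \<Sum>c\<in>C. ?c b c *\<^sub>C e b c v)"
        proof (rule sum.cong[OF refl])
          fix b assume "b \<in> B"
          then have "f b \<in> cspan C" using E1D(2)[OF f BV] by (simp add: C(3))
          then have "f b = (\<Sum>c\<in>C. ?c b c *\<^sub>C c)"
            using complex_vector.sum_representation_eq[OF C(2) _ C(1)] by simp
          then have "complex_vector.representation B v b *\<^sub>C f b
              = complex_vector.representation B v b *\<^sub>C (\<Sum>c\<in>C. ?c b c *\<^sub>C c)" by simp
          then show "complex_vector.representation B v b *\<^sub>C f b = (\<Sum>c\<in>C. ?c b c *\<^sub>C e b c v)"
            using True by (simp add: e_def complex_vector.scale_sum_right scaleC_scaleC mult.commute)
        qed
        finally show ?thesis .
      next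
        case False
        then show ?thesis using E1D(4)[OF f] by (simp add: e_def)
      qed
      have "f = (\<Sum>b\<in>B. \<Sum>c\<in>C. ?c b c *\<^sub>C e b c)"
        by (rule ext, unfold sum_fun_apply scaleC_fun_apply) (rule eq)
      also have "\<dots> \<in> cspan ?G"
        by (intro complex_vector.span_sum subspace_lincomb) (auto intro!: complex_vector.span_base)
      finally show "f \<in> cspan ?G" .
    qed
    then have fE1: "finite_dim E1"
      using finite_dim_subset[OF finite_dim_span[of ?G] sE1] B(1) C(1) by blast
    obtain D \<pi> where \<pi>: "Vector_Spaces.linear scaleC scaleC \<pi>" "\<And>v. v \<in> V \<Longrightarrow> v - \<pi> v \<in> W"
      "\<And>v. v \<in> V \<Longrightarrow> \<pi> v = 0 \<longleftrightarrow> v \<in> W"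
      by (rule complement_projection[OF sW sV WV]) blast
    \<comment> \<open>A linear projection of \<open>V\<close> onto \<open>W\<close>. It is the
      scalar \<open>1\<close> on \<open>W\<close>, so it spans \<open>E1\<close> modulo
      \<open>E0\<close>.\<close>
    define p where "p v = (if v \<in> V then v - \<pi> v else 0)" for v
    have pW: "p w = w" if "w \<in> W" for w using that WVm \<pi>(3)[of w] by (simp add: p_def)
    have "lin_on V p"
      using lin_on_minus_fun[OF lin_on_ident linear_lin_on[OF \<pi>(1)], of V]
        complex_vector.subspace_add[OF sV] complex_vector.subspace_scale[OF sV]
      unfolding lin_on_def p_def by simp
    then have pE1: "p \<in> E1"
      using \<pi>(2) pW by (auto simp: E1_def p_def[abs_def] intro!: exI[of _ 1] simp: scaleC_one)
    have "p \<notin> E0"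
    proof
      assume "p \<in> E0"
      then have "w = 0" if "w \<in> W" for w using pW[OF that] that by (simp add: E0_def)
      then show False using False complex_vector.subspace_0[OF sW] by blast
    qed
    have spanE1: "E1 = cspan (insert p E0)"
    proof
      show "cspan (insert p E0) \<subseteq> E1"
        by (rule complex_vector.span_minimal[OF _ sE1]) (use pE1 in \<open>auto simp: E0_def\<close>)
      show "E1 \<subseteq> cspan (insert p E0)"
      proof
        fix f assume f: "f \<in> E1"
        then obtain c where c: "\<forall>w\<in>W. f w = c *\<^sub>C w" by (auto simp: E1_def)
        have "f - c *\<^sub>C p \<in> E1"
          by (intro complex_vector.subspace_diff[OF sE1] complex_vector.subspace_scale[OF sE1] f pE1)
        then have "f - c *\<^sub>C p \<in> E0" using c pW by (simp add: E0_def)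
        then have "f - c *\<^sub>C p \<in> cspan E0" by (rule complex_vector.span_base)
        then show "f \<in> cspan (insert p E0)" unfolding complex_vector.span_insert by blast
      qed
    qed
    have "\<exists>f\<in>E1 - E0. \<forall>x. \<sigma> x f = 0"
      by (rule weyl_codimension_one[OF fd ss modE1 fE1 subE0 _ spanE1]) (use pE1 \<open>p \<notin> E0\<close> \<sigma>E0 in auto)
    \<comment> \<open>An invariant \<open>f\<close> commutes with the action, maps \<open>V\<close>
      into \<open>W\<close> and is a nonzero scalar on \<open>W\<close>; its kernel is therefore a
      complementary submodule.\<close>
    then obtain f where f: "f \<in> E1" "f \<notin> E0" "\<And>x. \<sigma> x f = 0" by blast
    then obtain c where c: "\<forall>w\<in>W. f w = c *\<^sub>C w" by (auto simp: E1_def)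
    have "c \<noteq> 0" using f c by (auto simp: E0_def)
    have comm: "f (\<rho> x v) = \<rho> x (f v)" if "v \<in> V" for x v
      using fun_cong[OF f(3)[of x], of v] that by (simp add: \<sigma>_def)
    define U where "U = {v \<in> V. f v = 0}"
    have lf: "lin_on V f" using E1D(1)[OF f(1)] .
    have "lie_submodule U V \<rho>"
    proof (rule lie_submoduleI[OF V(1)])
      show "csubspace U" unfolding U_def using sV lin_on_zero[OF lf sV]
        by (intro complex_vector.subspaceI)
          (auto simp: complex_vector.subspace_0 complex_vector.subspace_add complex_vector.subspace_scale
            lin_on_add[OF lf] lin_on_scale[OF lf])
      show "\<rho> x w \<in> U" if "w \<in> U" for x w
        using that mV comm lie_module_zero_arg[OF V(1)] by (simp add: U_def)
    qed (auto simp: U_def)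
    moreover have "U \<inter> W = {0}"
      using c \<open>c \<noteq> 0\<close> complex_vector.subspace_0[OF sV] complex_vector.subspace_0[OF sW] lin_on_zero[OF lf sV]
      by (auto simp: U_def)
    moreover have "\<exists>u\<in>U. \<exists>w\<in>W. v = u + w" if v: "v \<in> V" for v
    proof -
      let ?w = "(1 / c) *\<^sub>C f v"
      have w: "?w \<in> W" by (intro complex_vector.subspace_scale[OF sW] E1D(2)[OF f(1) v])
      have "f (v - ?w) = 0"
        using lin_on_diff[OF lf sV v WVm[OF w]] c w \<open>c \<noteq> 0\<close> by (simp add: scaleC_scaleC scaleC_one)
      then have "v - ?w \<in> U" using complex_vector.subspace_diff[OF sV v WVm[OF w]] by (simp add: U_def)
      then show ?thesis using w by (intro bexI[of _ "v - ?w"] bexI[of _ ?w]) simp_all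
    qed
    ultimately show ?thesis by blast
  qed
  then show ?thesis using that by blast
qed

section \<open>Locally finite modules\<close>

definition locally_finite :: "'v::complex_vector set \<Rightarrow> ('g::complex_lie_algebra \<Rightarrow> 'v \<Rightarrow> 'v) \<Rightarrow> bool"
  where "locally_finite V \<rho> \<longleftrightarrow> lie_module V \<rho> \<and>
    (\<forall>v\<in>V. \<exists>F. finite_dim F \<and> lie_submodule F V \<rho> \<and> v \<in> F)"

lemma locally_finite_obtain:
  assumes "locally_finite V \<rho>" "v \<in> V"
  obtains F where "finite_dim F" "lie_submodule F V \<rho>" "v \<in> F"
  using assms unfolding locally_finite_def by blast

definition invariants :: "'v::complex_vector set \<Rightarrow> ('g::complex_lie_algebra \<Rightarrow> 'v \<Rightarrow> 'v) \<Rightarrow> 'v set"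
  where "invariants V \<rho> = {v \<in> V. \<forall>x. \<rho> x v = 0}"

definition action_span :: "'v::complex_vector set \<Rightarrow> ('g::complex_lie_algebra \<Rightarrow> 'v \<Rightarrow> 'v) \<Rightarrow> 'v set"
  where "action_span V \<rho> = cspan {\<rho> x v | x v. v \<in> V}"

lemma action_span_subset:
  assumes "lie_module V \<rho>"
  shows "action_span V \<rho> \<subseteq> V"
  unfolding action_span_def
  by (rule complex_vector.span_minimal[OF _ lie_module_subspace[OF assms]]) (auto intro: lie_module_mem[OF assms])

lemma action_span_mono: "U \<subseteq> V \<Longrightarrow> action_span U \<rho> \<subseteq> action_span V \<rho>"
  unfolding action_span_def by (rule complex_vector.span_mono) auto

lemma invariants_subspace:
  assumes V: "lie_module V \<rho>"
  shows "csubspace (invariants V \<rho>)"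
  unfolding invariants_def using lie_module_subspace[OF V] lie_module_zero_arg[OF V]
  by (intro complex_vector.subspaceI)
    (auto simp: complex_vector.subspace_0 complex_vector.subspace_add complex_vector.subspace_scale
      lin_on_add[OF lie_module_lin[OF V]] lin_on_scale[OF lie_module_lin[OF V]])

lemma action_span_submodule:
  assumes V: "lie_module V \<rho>"
  shows "lie_submodule (action_span V \<rho>) V \<rho>"
proof (rule lie_submoduleI[OF V])
  show "\<rho> x w \<in> action_span V \<rho>" if "w \<in> action_span V \<rho>" for x w
  proof -
    have "w \<in> V" using that action_span_subset[OF V] by blast
    then show ?thesis unfolding action_span_def by (intro complex_vector.span_base) blast
  qed
qed (use action_span_subset[OF V] in \<open>auto simp: action_span_def\<close>)

lemma invariants_submodule:
  assumes V: "lie_module V \<rho>"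
  shows "lie_submodule (invariants V \<rho>) V \<rho>"
proof (rule lie_submoduleI[OF V invariants_subspace[OF V]])
  show "\<rho> x w \<in> invariants V \<rho>" if "w \<in> invariants V \<rho>" for x w
    using that lie_module_zero_arg[OF V] complex_vector.subspace_0[OF lie_module_subspace[OF V]]
    by (simp add: invariants_def)
qed (auto simp: invariants_def)

context
  fixes dummy :: "'g::complex_lie_algebra itself"
  assumes fd: "finite_dim (UNIV :: 'g set)" and ss: "semisimple TYPE('g)"
begin

text \<open>In a decomposition of \<open>V\<close> into the invariants and a complement
  \<open>U\<close>, the action sees only the \<open>U\<close>-component, so all of
  \<open>action_span\<close> lies in \<open>U\<close>.\<close>

lemma invariants_Int_action_span_fd:
  fixes \<rho> :: "'g \<Rightarrow> 'v::complex_vector \<Rightarrow> 'v"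
  assumes V: "lie_module V \<rho>" "finite_dim V" and v: "v \<in> invariants V \<rho>" "v \<in> action_span V \<rho>"
  shows "v = 0"
proof -
  note I = invariants_submodule[OF V(1)]
  obtain U where U: "lie_submodule U V \<rho>" "U \<inter> invariants V \<rho> = {0}"
    "\<And>v. v \<in> V \<Longrightarrow> \<exists>u\<in>U. \<exists>w\<in>invariants V \<rho>. v = u + w"
    by (rule weyl_complement[OF fd ss V I]) (rule that)
  have "\<rho> x v \<in> U" if vV: "v \<in> V" for x v
  proof -
    obtain u w where uw: "u \<in> U" "w \<in> invariants V \<rho>" "v = u + w" using U(3)[OF vV] by blast
    have "\<rho> x v = \<rho> x u + \<rho> x w"
      using uw lie_submoduleD(1)[OF U(1)] unfolding uw(3)
      by (intro lin_on_add[OF lie_module_lin[OF V(1)]]) (auto simp: invariants_def)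
    then show ?thesis using uw lie_submoduleD(4)[OF U(1)] by (simp add: invariants_def)
  qed
  then have "action_span V \<rho> \<subseteq> U"
    unfolding action_span_def by (intro complex_vector.span_minimal lie_submoduleD(3)[OF U(1)]) auto
  then show ?thesis using v U(2) by blast
qed

text \<open>On a complement of \<open>action_span\<close> the action is zero, since its values lie
  in both summands; the complement thus consists of invariants.\<close>

lemma invariants_plus_action_span_fd:
  fixes \<rho> :: "'g \<Rightarrow> 'v::complex_vector \<Rightarrow> 'v"
  assumes V: "lie_module V \<rho>" "finite_dim V" and v: "v \<in> V"
  shows "\<exists>z\<in>invariants V \<rho>. v - z \<in> action_span V \<rho>"
proof -
  note K = action_span_submodule[OF V(1)]
  obtain U where U: "lie_submodule U V \<rho>" "U \<inter> action_span V \<rho> = {0}"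
    "\<And>v. v \<in> V \<Longrightarrow> \<exists>u\<in>U. \<exists>w\<in>action_span V \<rho>. v = u + w"
    by (rule weyl_complement[OF fd ss V K]) (rule that)
  obtain u w where uw: "u \<in> U" "w \<in> action_span V \<rho>" "v = u + w" using U(3)[OF v] by blast
  have "\<rho> x u = 0" for x
  proof -
    have "\<rho> x u \<in> U" using uw lie_submoduleD(4)[OF U(1)] by blast
    moreover have "\<rho> x u \<in> action_span V \<rho>"
      using uw(1) lie_submoduleD(1)[OF U(1)] unfolding action_span_def by (intro complex_vector.span_base) blast
    ultimately show ?thesis using U(2) by blast
  qed
  then have "u \<in> invariants V \<rho>" using uw lie_submoduleD(1)[OF U(1)] by (auto simp: invariants_def)
  then show ?thesis using uw by (intro bexI[of _ u]) simp_all
qed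

text \<open>Membership in \<open>action_span\<close> involves finitely many vectors, so it already
  holds in a finite-dimensional submodule.\<close>

lemma invariants_Int_action_span:
  fixes \<rho> :: "'g \<Rightarrow> 'v::complex_vector \<Rightarrow> 'v"
  assumes V: "locally_finite V \<rho>" and v: "v \<in> invariants V \<rho>" "v \<in> action_span V \<rho>"
  shows "v = 0"
proof -
  have mV: "lie_module V \<rho>" using V by (simp add: locally_finite_def)
  have "\<exists>F. finite_dim F \<and> lie_submodule F V \<rho> \<and> v \<in> action_span F \<rho>"
    using v(2) unfolding action_span_def[of V]
  proof (induction rule: complex_vector.span_induct_alt)
    case base
    obtain F where "finite_dim F" "lie_submodule F V \<rho>"
      using locally_finite_obtain[OF V, of 0] complex_vector.subspace_0[OF lie_module_subspace[OF mV]] by blast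
    then show ?case by (intro exI[of _ F]) (simp add: action_span_def complex_vector.span_zero)
  next
    case (step c y z)
    then obtain x u where xu: "y = \<rho> x u" "u \<in> V" by blast
    obtain F where F: "finite_dim F" "lie_submodule F V \<rho>" "u \<in> F" by (rule locally_finite_obtain[OF V xu(2)])
    obtain G where G: "finite_dim G" "lie_submodule G V \<rho>" "z \<in> action_span G \<rho>" using step by blast
    let ?H = "cspan (F \<union> G)"
    have "u \<in> ?H" using F(3) by (intro complex_vector.span_base) simp
    then have "y \<in> action_span ?H \<rho>" unfolding action_span_def xu(1) by (intro complex_vector.span_base) blast
    moreover have "G \<subseteq> ?H" using complex_vector.span_superset[of "F \<union> G"] by blast
    then have "z \<in> action_span ?H \<rho>" using action_span_mono[of G ?H \<rho>] G(3) by blast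
    ultimately have "c *\<^sub>C y + z \<in> action_span ?H \<rho>"
      unfolding action_span_def by (intro complex_vector.span_add complex_vector.span_scale)
    then show ?case using finite_dim_span_Un[OF F(1) G(1)] lie_submodule_span_Un[OF mV F(2) G(2)] by blast
  qed
  then obtain F where F: "finite_dim F" "lie_submodule F V \<rho>" "v \<in> action_span F \<rho>" by blast
  have mF: "lie_module F \<rho>" using lie_submoduleD(2)[OF F(2)] .
  have "v \<in> invariants F \<rho>" using v(1) F(3) action_span_subset[OF mF] by (auto simp: invariants_def)
  then show ?thesis using invariants_Int_action_span_fd[OF mF F(1) _ F(3)] by blast
qed

lemma invariants_plus_action_span:
  fixes \<rho> :: "'g \<Rightarrow> 'v::complex_vector \<Rightarrow> 'v"
  assumes V: "locally_finite V \<rho>" and v: "v \<in> V"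
  shows "\<exists>z\<in>invariants V \<rho>. v - z \<in> action_span V \<rho>"
proof -
  obtain F where F: "finite_dim F" "lie_submodule F V \<rho>" "v \<in> F" by (rule locally_finite_obtain[OF V v])
  obtain z where "z \<in> invariants F \<rho>" "v - z \<in> action_span F \<rho>"
    using invariants_plus_action_span_fd[OF lie_submoduleD(2)[OF F(2)] F(1,3)] by blast
  moreover have "F \<subseteq> V" using lie_submoduleD(1)[OF F(2)] .
  ultimately show ?thesis using action_span_mono[of F V \<rho>] by (auto simp: invariants_def)
qed

lemma locally_finite_submodule:
  fixes \<rho> :: "'g \<Rightarrow> 'v::complex_vector \<Rightarrow> 'v"
  assumes V: "locally_finite V \<rho>" and U: "lie_submodule U V \<rho>"
  shows "locally_finite U \<rho>"
  unfolding locally_finite_def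
proof (intro conjI ballI)
  show mU: "lie_module U \<rho>" using lie_submoduleD(2)[OF U] .
  fix u assume "u \<in> U"
  then have "u \<in> V" using lie_submoduleD(1)[OF U] by blast
  then obtain F where F: "finite_dim F" "lie_submodule F V \<rho>" "u \<in> F" by (rule locally_finite_obtain[OF V])
  have s: "csubspace (F \<inter> U)"
    by (rule complex_vector.subspace_inter[OF lie_submoduleD(3)[OF F(2)] lie_submoduleD(3)[OF U]])
  have "lie_submodule (F \<inter> U) U \<rho>"
    by (rule lie_submoduleI[OF mU s]) (use lie_submoduleD(4)[OF F(2)] lie_submoduleD(4)[OF U] in auto)
  moreover have "finite_dim (F \<inter> U)" by (rule finite_dim_subset[OF F(1) s]) simp
  ultimately show "\<exists>F. finite_dim F \<and> lie_submodule F U \<rho> \<and> u \<in> F" using F \<open>u \<in> U\<close> by blast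
qed

end

section \<open>Complete reducibility\<close>

lemma simple_submodule_exists:
  assumes V: "lie_module V \<rho>" "finite_dim V" "V \<noteq> {0}"
  obtains U where "lie_submodule U V \<rho>" "simple_module U \<rho>" "finite_dim U"
proof -
  define P where "P U \<longleftrightarrow> lie_submodule U V \<rho> \<and> U \<noteq> {0}" for U
  have "P V" using V by (simp add: P_def lie_submodule_def)
  then obtain U where U: "P U" and min: "\<And>U'. P U' \<Longrightarrow> cdim U \<le> cdim U'"
    using ex_has_least_nat[of P V cdim] by blast
  have sub: "lie_submodule U V \<rho>" using U by (simp add: P_def)
  have fU: "finite_dim U" using finite_dim_subset[OF V(2) lie_submoduleD(3)[OF sub] lie_submoduleD(1)[OF sub]] .
  have "W = {0} \<or> W = U" if W: "lie_submodule W U \<rho>" for W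
  proof (rule ccontr)
    assume "\<not> (W = {0} \<or> W = U)"
    then have "P W" "W \<subset> U" using lie_submodule_trans[OF W sub] lie_submoduleD(1)[OF W] by (auto simp: P_def)
    then show False using min[of W] dim_strict_mono[OF fU lie_submoduleD(3)[OF W]] by simp
  qed
  then have "simple_module U \<rho>" using U lie_submoduleD(2)[OF sub] by (simp add: simple_module_def P_def)
  then show ?thesis using that sub fU by blast
qed

lemma span_Union_submodules:
  assumes V: "lie_module V \<rho>" and W: "\<And>W. W \<in> \<W> \<Longrightarrow> lie_submodule W V \<rho>"
  shows "lie_submodule (cspan (\<Union>\<W>)) V \<rho>"
proof (rule lie_submoduleI[OF V])
  note sV = lie_module_subspace[OF V]
  show sub: "cspan (\<Union>\<W>) \<subseteq> V"
    by (rule complex_vector.span_minimal[OF _ sV]) (use W lie_submoduleD(1) in blast)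
  fix x w assume "w \<in> cspan (\<Union>\<W>)"
  then have "w \<in> V \<and> \<rho> x w \<in> cspan (\<Union>\<W>)"
  proof (induction rule: complex_vector.span_induct_alt)
    case base
    show ?case using lie_module_zero_arg[OF V] complex_vector.subspace_0[OF sV] by (simp add: complex_vector.span_zero)
  next
    case (step c y z)
    then obtain W0 where W0: "W0 \<in> \<W>" "y \<in> W0" by blast
    have y: "y \<in> V" using lie_submoduleD(1)[OF W[OF W0(1)]] W0(2) by blast
    have "\<rho> x y \<in> W0" using lie_submoduleD(4)[OF W[OF W0(1)] W0(2)] .
    then have xy: "\<rho> x y \<in> cspan (\<Union>\<W>)" using W0(1) by (intro complex_vector.span_base) blast
    have cy: "c *\<^sub>C y \<in> V" using y complex_vector.subspace_scale[OF sV] by blast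
    have "\<rho> x (c *\<^sub>C y + z) = c *\<^sub>C \<rho> x y + \<rho> x z"
      using step.IH cy y by (simp add: lin_on_add[OF lie_module_lin[OF V]] lin_on_scale[OF lie_module_lin[OF V]])
    also have "\<dots> \<in> cspan (\<Union>\<W>)"
      using xy step.IH by (intro complex_vector.span_add complex_vector.span_scale) auto
    finally show ?case using step.IH cy complex_vector.subspace_add[OF sV] by blast
  qed
  then show "\<rho> x w \<in> cspan (\<Union>\<W>)" ..
qed simp

text \<open>Zorn's lemma for independent families of finite-dimensional simple submodules. If the
  span \<open>S\<close> of a maximal family missed \<open>v\<close>, a complement of
  \<open>F \<inter> S\<close> in a finite-dimensional submodule \<open>F\<close> containing
  \<open>v\<close> would hold a further simple submodule.\<close>

theorem locally_finite_semisimple: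
  fixes \<rho> :: "'g::complex_lie_algebra \<Rightarrow> 'v::complex_vector \<Rightarrow> 'v"
  assumes fd: "finite_dim (UNIV :: 'g set)" and ss: "semisimple TYPE('g)"
    and V: "locally_finite V \<rho>"
  obtains \<W> where "internal_direct_sum \<W> V"
    "\<And>W. W \<in> \<W> \<Longrightarrow> simple_module W \<rho> \<and> finite_dim W \<and> lie_submodule W V \<rho>"
proof -
  have mV: "lie_module V \<rho>" using V by (simp add: locally_finite_def)
  note sV = lie_module_subspace[OF mV]
  define good where "good \<W> \<longleftrightarrow>
    (\<forall>W\<in>\<W>. simple_module W \<rho> \<and> finite_dim W \<and> lie_submodule W V \<rho>) \<and>
    (\<forall>W\<in>\<W>. W \<inter> cspan (\<Union>(\<W> - {W})) = {0})" for \<W>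
  have "\<exists>M\<in>Collect good. \<forall>X\<in>Collect good. M \<subseteq> X \<longrightarrow> X = M"
  proof (rule subset_Zorn)
    fix C assume chain: "subset.chain (Collect good) C"
    have C: "X \<in> C \<Longrightarrow> good X" for X using chain by (auto simp: subset.chain_def)
    have tot: "X \<in> C \<Longrightarrow> Y \<in> C \<Longrightarrow> X \<subseteq> Y \<or> Y \<subseteq> X" for X Y using chain unfolding subset.chain_def by blast
    have "good (\<Union>C)"
      unfolding good_def
    proof (intro conjI ballI)
      show "simple_module W \<rho>" "finite_dim W" "lie_submodule W V \<rho>" if "W \<in> \<Union>C" for W
        using that C by (auto simp: good_def)
      fix W assume "W \<in> \<Union>C"
      then obtain X0 where X0: "X0 \<in> C" "W \<in> X0" by blast
      \<comment> \<open>A vector of the span involves finitely many submodules, and a single family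
        of the chain contains them all.\<close>
      have "\<exists>X\<in>C. W \<in> X \<and> v \<in> cspan (\<Union>(X - {W}))" if "v \<in> cspan (\<Union>(\<Union>C - {W}))" for v
        using that
      proof (induction rule: complex_vector.span_induct_alt)
        case base
        then show ?case using X0 complex_vector.span_zero by blast
      next
        case (step c x y)
        then obtain X1 W1 where X1: "X1 \<in> C" "W1 \<in> X1" "W1 \<noteq> W" "x \<in> W1" by blast
        obtain X2 where X2: "X2 \<in> C" "W \<in> X2" "y \<in> cspan (\<Union>(X2 - {W}))" using step by blast
        define X where "X = X1 \<union> X2"
        have X: "X \<in> C" using tot[OF X1(1) X2(1)] X1(1) X2(1) by (auto simp: X_def sup.absorb1 sup.absorb2)
        have "x \<in> cspan (\<Union>(X - {W}))" using X1 by (intro complex_vector.span_base) (auto simp: X_def)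
        moreover have "y \<in> cspan (\<Union>(X - {W}))"
          using X2(3) complex_vector.span_mono[of "\<Union>(X2 - {W})" "\<Union>(X - {W})"] by (auto simp: X_def)
        ultimately have "c *\<^sub>C x + y \<in> cspan (\<Union>(X - {W}))"
          by (intro complex_vector.span_add complex_vector.span_scale)
        then show ?case using X X2(2) by (auto simp: X_def)
      qed
      moreover have "W \<inter> cspan (\<Union>(X - {W})) = {0}" if "X \<in> C" "W \<in> X" for X
        using C[OF that(1)] that(2) by (simp add: good_def)
      ultimately have "W \<inter> cspan (\<Union>(\<Union>C - {W})) \<subseteq> {0}" by blast
      moreover have "lie_submodule W V \<rho>" using X0(2) C[OF X0(1)] by (simp add: good_def)
      then have "0 \<in> W" using lie_submoduleD(3) complex_vector.subspace_0 by blast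
      ultimately show "W \<inter> cspan (\<Union>(\<Union>C - {W})) = {0}" using complex_vector.span_zero by blast
    qed
    then show "\<exists>U\<in>Collect good. \<forall>X\<in>C. X \<subseteq> U" by blast
  qed
  then obtain \<W> where good: "good \<W>" and max: "\<And>X. good X \<Longrightarrow> \<W> \<subseteq> X \<Longrightarrow> X = \<W>" by blast
  have sub: "\<And>W. W \<in> \<W> \<Longrightarrow> lie_submodule W V \<rho>" using good by (simp add: good_def)
  define S where "S = cspan (\<Union>\<W>)"
  have S: "lie_submodule S V \<rho>" unfolding S_def by (rule span_Union_submodules[OF mV sub])
  have "S = V"
  proof (rule ccontr)
    assume "S \<noteq> V"
    then obtain v where v: "v \<in> V" "v \<notin> S" using lie_submoduleD(1)[OF S] by blast
    obtain F where F: "finite_dim F" "lie_submodule F V \<rho>" "v \<in> F" by (rule locally_finite_obtain[OF V v(1)])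
    note mF = lie_submoduleD(2)[OF F(2)]
    have FS: "lie_submodule (F \<inter> S) F \<rho>"
      by (rule lie_submoduleI[OF mF])
        (use lie_submoduleD(4)[OF F(2)] lie_submoduleD(4)[OF S] lie_submoduleD(3)[OF F(2)] lie_submoduleD(3)[OF S]
          in \<open>auto intro: complex_vector.subspace_inter\<close>)
    obtain U where U: "lie_submodule U F \<rho>" "U \<inter> (F \<inter> S) = {0}"
      "\<And>v. v \<in> F \<Longrightarrow> \<exists>u\<in>U. \<exists>w\<in>F \<inter> S. v = u + w"
      by (rule weyl_complement[OF fd ss mF F(1) FS]) (rule that)
    have "U \<noteq> {0}" using U(3)[OF F(3)] v(2) by auto
    obtain N where N: "lie_submodule N U \<rho>" "simple_module N \<rho>" "finite_dim N"
      by (rule simple_submodule_exists[OF lie_submoduleD(2)[OF U(1)]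
            finite_dim_subset[OF F(1) lie_submoduleD(3)[OF U(1)] lie_submoduleD(1)[OF U(1)]] \<open>U \<noteq> {0}\<close>])
    have NV: "lie_submodule N V \<rho>" by (rule lie_submodule_trans[OF N(1) lie_submodule_trans[OF U(1) F(2)]])
    have N0: "0 \<in> N" using complex_vector.subspace_0[OF lie_submoduleD(3)[OF NV]] .
    have NS: "w = 0" if "w \<in> N" "w \<in> S" for w
      using that U(2) lie_submoduleD(1)[OF N(1)] lie_submoduleD(1)[OF U(1)] by blast
    have "good (insert N \<W>)"
      unfolding good_def
    proof (intro conjI ballI)
      show "simple_module W \<rho>" "finite_dim W" "lie_submodule W V \<rho>" if "W \<in> insert N \<W>" for W
        using that good N NV by (auto simp: good_def)
      fix W assume W: "W \<in> insert N \<W>"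
      have W0: "0 \<in> W"
        using W N0 complex_vector.subspace_0[OF lie_submoduleD(3)[OF sub]] by blast
      have "w = 0" if w: "w \<in> W" "w \<in> cspan (\<Union>(insert N \<W> - {W}))" for w
      proof (cases "W = N")
        case True
        have "\<Union>(insert N \<W> - {W}) \<subseteq> \<Union>\<W>" using True by blast
        then have "w \<in> S" using w(2) complex_vector.span_mono[of "\<Union>(insert N \<W> - {W})" "\<Union>\<W>"] unfolding S_def by blast
        then show ?thesis using NS w(1) True by blast
      next
        case False
        then have WW: "W \<in> \<W>" using W by blast
        have "\<Union>(insert N \<W> - {W}) = N \<union> \<Union>(\<W> - {W})" using False by blast
        then have "w \<in> cspan (N \<union> \<Union>(\<W> - {W}))" using w(2) by simp
        then obtain n t where nt: "w = n + t" "n \<in> cspan N" "t \<in> cspan (\<Union>(\<W> - {W}))"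
          unfolding complex_vector.span_Un by blast
        have n: "n \<in> N" using nt(2) complex_vector.span_eq_iff[THEN iffD2, OF lie_submoduleD(3)[OF NV]] by simp
        have "w \<in> S" unfolding S_def using w(1) WW by (intro complex_vector.span_base) blast
        moreover have "t \<in> S" using nt(3) complex_vector.span_mono[of "\<Union>(\<W> - {W})" "\<Union>\<W>"] unfolding S_def by blast
        ultimately have "w - t \<in> S" using complex_vector.subspace_diff[OF lie_submoduleD(3)[OF S]] by blast
        then have "n = 0" using NS[OF n] nt(1) by simp
        then have "w \<in> W \<inter> cspan (\<Union>(\<W> - {W}))" using nt w(1) by simp
        then show ?thesis using good WW by (auto simp: good_def)
      qed
      then show "W \<inter> cspan (\<Union>(insert N \<W> - {W})) = {0}" using W0 complex_vector.span_zero by blast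
    qed
    then have "insert N \<W> = \<W>" by (rule max) blast
    then have "N \<subseteq> S" unfolding S_def using complex_vector.span_superset[of "\<Union>\<W>"] by blast
    then have "N = {0}" using NS N0 by blast
    then show False using N(2) by (simp add: simple_module_def)
  qed
  then have "internal_direct_sum \<W> V"
    using good by (simp add: internal_direct_sum_def good_def S_def)
  then show ?thesis
    by (rule that) (use good in \<open>simp add: good_def\<close>)
qed

section \<open>The enveloping algebra of the Takiff algebra\<close>

text \<open>The comparison module of the final statement. It also instantiates the module context in
  which \<open>free_algebra_induct\<close> was proved.\<close>

lemma trivial_module: "lie_module UNIV (trivial_action :: 'l::complex_lie_algebra \<Rightarrow> complex \<Rightarrow> complex)"
  by (simp add: lie_module_def trivial_action_def)

lemma free_const_commute: "free_const c * f = f * free_const c"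
  for f :: "'a::complex_lie_algebra free_algebra"
proof (induction f rule: free_algebra_induct[OF trivial_module, case_names single add])
  case (single w a)
  show ?case by (simp add: free_const_def mult_single mult.commute)
next
  case (add f g)
  then show ?case by (simp add: distrib_left distrib_right)
qed

lemma uea_gen_add: "uea_gen (x + y) = uea_gen x + uea_gen y"
  by transfer (metis uea_ideal.gen_add diff_diff_eq)

lemma uea_gen_scaleC: "uea_gen (c *\<^sub>C x) = c *\<^sub>C uea_gen x"
  by transfer (rule uea_ideal.gen_scaleC)

lemma uea_gen_commutator: "uea_gen x * uea_gen y - uea_gen y * uea_gen x = uea_gen (bracket x y)"
  by transfer (rule uea_ideal.gen_bracket)

lemma uea_scaleC_mult_left: "(c *\<^sub>C u) * v = c *\<^sub>C (u * (v :: 'a::complex_lie_algebra uea))"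
  by transfer (simp add: mult.assoc uea_ideal_zero)

lemma uea_scaleC_mult_right: "u * (c *\<^sub>C v) = c *\<^sub>C (u * (v :: 'a::complex_lie_algebra uea))"
proof (transfer, goal_cases)
  case (1 u c v)
  have "u * (free_const c * v) = free_const c * (u * v)"
    by (metis free_const_commute mult.assoc)
  then show ?case by (simp add: uea_ideal_zero)
qed

lemma uea_abs_cases: obtains f where "u = abs_uea f"
  by (metis Quotient3_abs_rep[OF Quotient3_uea])

text \<open>Words are extended on the left, in accordance with \<open>uea_act\<close>, which lets
  the leftmost letter act last.\<close>

lemma uea_induct [case_names one add scaleC gen_mult]:
  assumes "P 1" "\<And>u v. P u \<Longrightarrow> P v \<Longrightarrow> P (u + v)" "\<And>c u. P u \<Longrightarrow> P (c *\<^sub>C u)"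
    "\<And>x u. P u \<Longrightarrow> P (uea_gen x * u)"
  shows "P (u :: 'a::complex_lie_algebra uea)"
proof -
  obtain f where f: "u = abs_uea f" by (rule uea_abs_cases)
  have "P (abs_uea f)"
  proof (induction f rule: free_algebra_induct[OF trivial_module, case_names single add])
    case (single w c)
    have P1: "P (abs_uea (Poly_Mapping.single (Word xs) 1))" for xs :: "'a list"
    proof (induction xs)
      case Nil
      then show ?case using assms(1) by (simp add: one_uea.abs_eq zero_free_monoid_def flip: single_one)
    next
      case (Cons x xs)
      have "Poly_Mapping.single (Word (x # xs)) 1 = free_gen x * (Poly_Mapping.single (Word xs) 1 :: 'a free_algebra)"
        by (simp add: free_gen_def mult_single plus_free_monoid_def)
      then have "abs_uea (Poly_Mapping.single (Word (x # xs)) 1) = uea_gen x * abs_uea (Poly_Mapping.single (Word xs) 1)"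
        by (simp add: uea_gen.abs_eq times_uea.abs_eq)
      then show ?case using assms(4)[OF Cons] by simp
    qed
    have eq: "abs_uea (Poly_Mapping.single w c) = c *\<^sub>C abs_uea (Poly_Mapping.single (Word (letters w)) 1)"
      by (simp add: scaleC_uea.abs_eq free_const_def mult_single)
    show ?case unfolding eq by (rule assms(3)[OF P1])
  next
    case (add f g)
    then show ?case using assms(2) by (metis plus_uea.abs_eq)
  qed
  then show ?thesis using f by simp
qed

context
  fixes V :: "'v::complex_vector set" and \<rho> :: "'l::complex_lie_algebra \<Rightarrow> 'v \<Rightarrow> 'v"
  assumes V: "lie_module V \<rho>"
begin

lemma uea_act_mem: "v \<in> V \<Longrightarrow> uea_act \<rho> u v \<in> V"
  unfolding uea_act_def by (rule free_act_mem[OF V])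

lemma uea_act_add: "v \<in> V \<Longrightarrow> uea_act \<rho> (u + w) v = uea_act \<rho> u v + uea_act \<rho> w v"
proof -
  assume "v \<in> V"
  obtain f g where "u = abs_uea f" "w = abs_uea g" by (metis uea_abs_cases)
  then show ?thesis using \<open>v \<in> V\<close> by (simp add: plus_uea.abs_eq uea_act_abs[OF V] free_act_add[OF V])
qed

lemma uea_act_mult: "v \<in> V \<Longrightarrow> uea_act \<rho> (u * w) v = uea_act \<rho> u (uea_act \<rho> w v)"
proof -
  assume "v \<in> V"
  obtain f g where "u = abs_uea f" "w = abs_uea g" by (metis uea_abs_cases)
  then show ?thesis using \<open>v \<in> V\<close>
    by (simp add: times_uea.abs_eq uea_act_abs[OF V] free_act_mult[OF V] free_act_mem[OF V])
qed

lemma uea_act_scaleC: "v \<in> V \<Longrightarrow> uea_act \<rho> (c *\<^sub>C u) v = c *\<^sub>C uea_act \<rho> u v"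
proof -
  assume "v \<in> V"
  obtain f where "u = abs_uea f" by (rule uea_abs_cases)
  then show ?thesis using \<open>v \<in> V\<close>
    by (simp add: scaleC_uea.abs_eq uea_act_abs[OF V] free_act_mult[OF V] free_const_def free_act_single[OF V]
        zero_free_monoid_def)
qed

lemma uea_act_one: "v \<in> V \<Longrightarrow> uea_act \<rho> 1 v = v"
proof -
  assume "v \<in> V"
  then show ?thesis
    by (simp add: one_uea.abs_eq uea_act_abs[OF V] free_act_single[OF V] zero_free_monoid_def scaleC_one flip: single_one)
qed

lemma uea_act_diff: "v \<in> V \<Longrightarrow> uea_act \<rho> (u - w) v = uea_act \<rho> u v - uea_act \<rho> w v"
  using uea_act_add[of v "u - w" w] by simp

lemma uea_act_zero: "v \<in> V \<Longrightarrow> uea_act \<rho> 0 v = 0"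
  using uea_act_diff[of v 0 0] by simp

lemma uea_act_lin: "lin_on V (uea_act \<rho> u)"
  unfolding lin_on_def uea_act_def
proof (intro conjI ballI allI)
  show "free_act \<rho> (rep_uea u) (v + w) = free_act \<rho> (rep_uea u) v + free_act \<rho> (rep_uea u) w"
    if "v \<in> V" "w \<in> V" for v w using that by (rule free_act_add_arg[OF V])
  show "free_act \<rho> (rep_uea u) (c *\<^sub>C v) = c *\<^sub>C free_act \<rho> (rep_uea u) v" if "v \<in> V" for c v
    unfolding free_act_def using that
    by (simp add: foldr_scaleC[OF V] complex_vector.scale_sum_right scaleC_scaleC mult.commute)
qed

end

section \<open>The subalgebra generated by \<open>gbar\<close>\<close>

definition body_gen :: "'g::complex_lie_algebra \<Rightarrow> 'g takiff uea"
  where "body_gen v = uea_gen (Takiff v 0)"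

definition nil_gen :: "'g::complex_lie_algebra \<Rightarrow> 'g takiff uea"
  where "nil_gen v = uea_gen (Takiff 0 v)"

definition gbar_algebra :: "'g::complex_lie_algebra takiff uea set"
  where "gbar_algebra = subalgebra_generated (uea_gen ` gbar)"

definition ad :: "'g::complex_lie_algebra \<Rightarrow> 'g takiff uea \<Rightarrow> 'g takiff uea"
  where "ad x f = body_gen x * f - f * body_gen x"

lemma uea_gen_takiff: "uea_gen t = body_gen (body t) + nil_gen (nil_part t)"
  unfolding body_gen_def nil_gen_def by (simp add: plus_takiff_def flip: uea_gen_add)

lemma nil_gen_add: "nil_gen (v + w) = nil_gen v + nil_gen w"
  and nil_gen_scaleC: "nil_gen (c *\<^sub>C v) = c *\<^sub>C nil_gen v"
  and body_gen_add: "body_gen (v + w) = body_gen v + body_gen w"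
  and body_gen_scaleC: "body_gen (c *\<^sub>C v) = c *\<^sub>C body_gen v"
  unfolding body_gen_def nil_gen_def
  by (simp_all add: plus_takiff_def scaleC_takiff_def flip: uea_gen_add uea_gen_scaleC)

lemma nil_gen_zero: "nil_gen 0 = 0"
  using nil_gen_scaleC[of 0 0] by simp

lemma gbar_generators: "uea_gen ` gbar = range nil_gen"
  by (auto simp: gbar_def nil_gen_def takiff_tensor_def)

lemma nil_gen_commute: "nil_gen v * nil_gen w = nil_gen w * nil_gen v"
proof -
  have "uea_gen (0 :: 'a takiff) = 0" using uea_gen_scaleC[of 0 "0 :: 'a takiff"] by simp
  moreover have "bracket (Takiff 0 v) (Takiff 0 w) = 0" by (simp add: bracket_takiff_def zero_takiff_def)
  ultimately have "nil_gen v * nil_gen w - nil_gen w * nil_gen v = 0"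
    unfolding nil_gen_def by (simp add: uea_gen_commutator)
  then show ?thesis by simp
qed

lemma ad_nil_gen: "ad x (nil_gen v) = nil_gen (bracket x v)"
  unfolding ad_def nil_gen_def body_gen_def uea_gen_commutator by (simp add: bracket_takiff_def)

lemma body_gen_bracket: "body_gen (bracket x y) = body_gen x * body_gen y - body_gen y * body_gen x"
  unfolding body_gen_def uea_gen_commutator by (simp add: bracket_takiff_def)

lemma ad_one [simp]: "ad x 1 = 0"
  by (simp add: ad_def)

lemma ad_add: "ad x (f + g) = ad x f + ad x g"
  and ad_scaleC: "ad x (c *\<^sub>C f) = c *\<^sub>C ad x f"
  and ad_mult: "ad x (f * g) = ad x f * g + f * ad x g"
  and ad_add_left: "ad (x + y) f = ad x f + ad y f"
  and ad_scaleC_left: "ad (c *\<^sub>C x) f = c *\<^sub>C ad x f"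
  and ad_bracket: "ad (bracket x y) f = ad x (ad y f) - ad y (ad x f)"
  by (simp_all add: ad_def algebra_simps uea_scaleC_mult_left uea_scaleC_mult_right body_gen_add
      body_gen_scaleC body_gen_bracket complex_vector.scale_right_diff_distrib)

lemma gbar_algebra_one: "1 \<in> gbar_algebra"
  and gbar_algebra_add: "f \<in> gbar_algebra \<Longrightarrow> g \<in> gbar_algebra \<Longrightarrow> f + g \<in> gbar_algebra"
  and gbar_algebra_scaleC: "f \<in> gbar_algebra \<Longrightarrow> c *\<^sub>C f \<in> gbar_algebra"
  and gbar_algebra_mult: "f \<in> gbar_algebra \<Longrightarrow> g \<in> gbar_algebra \<Longrightarrow> f * g \<in> gbar_algebra"
  and gbar_algebra_nil_gen: "nil_gen v \<in> gbar_algebra"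
  unfolding gbar_algebra_def gbar_generators
  by (auto intro: subalgebra_generated.intros)

lemma gbar_algebra_induct [consumes 1, case_names gen one add scaleC mult]:
  assumes "f \<in> gbar_algebra" "\<And>v. P (nil_gen v)" "P 1"
    "\<And>u v. u \<in> gbar_algebra \<Longrightarrow> P u \<Longrightarrow> v \<in> gbar_algebra \<Longrightarrow> P v \<Longrightarrow> P (u + v)"
    "\<And>u c. u \<in> gbar_algebra \<Longrightarrow> P u \<Longrightarrow> P (c *\<^sub>C u)"
    "\<And>u v. u \<in> gbar_algebra \<Longrightarrow> P u \<Longrightarrow> v \<in> gbar_algebra \<Longrightarrow> P v \<Longrightarrow> P (u * v)"
  shows "P f"
  using assms(1) unfolding gbar_algebra_def gbar_generators
proof (induction rule: subalgebra_generated.induct)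
  case (base u)
  then show ?case using assms(2) by blast
qed (use assms(3-) in \<open>auto simp: gbar_algebra_def gbar_generators\<close>)

lemma gbar_algebra_subspace: "csubspace gbar_algebra"
proof (rule complex_vector.subspaceI)
  show "0 \<in> gbar_algebra" using gbar_algebra_scaleC[OF gbar_algebra_one, of 0] by simp
qed (auto intro: gbar_algebra_add gbar_algebra_scaleC)

lemma gbar_algebra_commute:
  assumes "f \<in> gbar_algebra" "g \<in> gbar_algebra"
  shows "f * g = g * f"
proof -
  have nil: "nil_gen v * g = g * nil_gen v" if "g \<in> gbar_algebra" for v g
    using that
  proof (induction rule: gbar_algebra_induct)
    case (mult u w)
    then show ?case by (metis mult.assoc)
  qed (auto simp: nil_gen_commute distrib_left distrib_right uea_scaleC_mult_left uea_scaleC_mult_right)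
  show ?thesis using assms(1)
  proof (induction rule: gbar_algebra_induct)
    case (mult u w)
    then show ?case by (metis mult.assoc)
  qed (auto simp: nil assms(2) distrib_left distrib_right uea_scaleC_mult_left uea_scaleC_mult_right)
qed

lemma ad_gbar_algebra: "f \<in> gbar_algebra \<Longrightarrow> ad x f \<in> gbar_algebra"
proof (induction rule: gbar_algebra_induct)
  case one
  then show ?case using complex_vector.subspace_0[OF gbar_algebra_subspace] by simp
qed (simp_all add: ad_nil_gen ad_add ad_scaleC ad_mult gbar_algebra_nil_gen gbar_algebra_add gbar_algebra_scaleC
    gbar_algebra_mult)

lemma gbar_algebra_ad_module: "lie_module gbar_algebra ad"
  unfolding lie_module_def
  using gbar_algebra_subspace
  by (simp add: ad_gbar_algebra ad_add ad_scaleC ad_add_left ad_scaleC_left ad_bracket)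

text \<open>An element of the commutative algebra commutes with every \<open>nil_gen\<close>, and
  invariance under \<open>ad\<close> covers the remaining generators of the enveloping
  algebra.\<close>

lemma takiff_center_iff: "z \<in> takiff_center \<longleftrightarrow> z \<in> gbar_algebra \<and> (\<forall>x. ad x z = 0)"
proof
  assume "z \<in> takiff_center"
  then show "z \<in> gbar_algebra \<and> (\<forall>x. ad x z = 0)"
    by (simp add: takiff_center_def uea_center_def gbar_algebra_def ad_def)
next
  assume z: "z \<in> gbar_algebra \<and> (\<forall>x. ad x z = 0)"
  have gen: "z * uea_gen t = uea_gen t * z" for t
  proof -
    have "body_gen (body t) * z = z * body_gen (body t)" using z by (simp add: ad_def)
    moreover have "nil_gen (nil_part t) * z = z * nil_gen (nil_part t)"
      using gbar_algebra_commute[OF gbar_algebra_nil_gen] z by blast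
    ultimately show ?thesis by (simp add: uea_gen_takiff distrib_left distrib_right)
  qed
  have "z * u = u * z" for u
  proof (induction u rule: uea_induct)
    case (gen_mult x u)
    have "z * (uea_gen x * u) = uea_gen x * (z * u)" by (simp add: gen mult.assoc[symmetric])
    then show ?case by (simp add: gen_mult.IH mult.assoc)
  qed (simp_all add: distrib_left distrib_right uea_scaleC_mult_left uea_scaleC_mult_right)
  then show "z \<in> takiff_center" using z by (simp add: takiff_center_def uea_center_def gbar_algebra_def)
qed

lemma takiff_center_invariants: "takiff_center = invariants gbar_algebra ad"
  by (auto simp: takiff_center_iff invariants_def)

text \<open>The span of products of at most \<open>n\<close> elements of \<open>gbar\<close>. Each
  step has finite dimension and is stable under \<open>ad\<close>, whence local finiteness; that
  there are countably many steps is played off against the uncountable field in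
  \<open>gbar_ideal_extend\<close>.\<close>

primrec gbar_filtration :: "nat \<Rightarrow> 'g::complex_lie_algebra takiff uea set"
  where "gbar_filtration 0 = cspan {1}"
  | "gbar_filtration (Suc n) = cspan (gbar_filtration n \<union> {nil_gen v * f | v f. f \<in> gbar_filtration n})"

lemma gbar_filtration_subspace: "csubspace (gbar_filtration n)"
  by (cases n) simp_all

lemma gbar_filtration_mono: "m \<le> n \<Longrightarrow> gbar_filtration m \<subseteq> gbar_filtration n"
proof (induction rule: dec_induct)
  case (step k)
  then show ?case using complex_vector.span_superset[of "gbar_filtration k \<union> {nil_gen v * f | v f. f \<in> gbar_filtration k}"]
    by (simp del: Un_subset_iff) blast
qed simp

lemma gbar_filtration_nil_gen: "f \<in> gbar_filtration n \<Longrightarrow> nil_gen v * f \<in> gbar_filtration (Suc n)"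
  by (auto intro: complex_vector.span_base)

lemma gbar_filtration_mult:
  "f \<in> gbar_filtration m \<Longrightarrow> g \<in> gbar_filtration n \<Longrightarrow> f * g \<in> gbar_filtration (m + n)"
proof (induction m arbitrary: f)
  case 0
  then obtain c where "f = c *\<^sub>C 1" by (auto simp: complex_vector.span_singleton)
  then show ?case using 0 complex_vector.subspace_scale[OF gbar_filtration_subspace]
    by (simp add: uea_scaleC_mult_left)
next
  case (Suc m)
  from Suc.prems(1) show ?case
    unfolding gbar_filtration.simps
  proof (induction rule: complex_vector.span_induct_alt)
    case base
    show ?case using complex_vector.subspace_0[OF gbar_filtration_subspace, of "Suc m + n"] by simp
  next
    case (step c x y)
    have "x * g \<in> gbar_filtration (Suc m + n)"
      using step(1)
    proof
      assume "x \<in> gbar_filtration m"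
      then have "x * g \<in> gbar_filtration (m + n)" using Suc by blast
      then show ?thesis using gbar_filtration_mono[of "m + n" "Suc m + n"] by auto
    next
      assume "x \<in> {nil_gen v * f | v f. f \<in> gbar_filtration m}"
      then obtain v f where "x = nil_gen v * f" "f \<in> gbar_filtration m" by blast
      then show ?thesis using Suc.IH[OF _ Suc.prems(2), of f] gbar_filtration_nil_gen[of "f * g" "m + n" v]
        by (simp add: mult.assoc)
    qed
    then show ?case
      using step.IH unfolding distrib_right uea_scaleC_mult_left
      by (intro complex_vector.subspace_add[OF gbar_filtration_subspace]
        complex_vector.subspace_scale[OF gbar_filtration_subspace])
  qed
qed

lemma gbar_filtration_subset: "gbar_filtration n \<subseteq> gbar_algebra"
proof (induction n)
  case 0
  then show ?case
    using complex_vector.span_minimal[OF _ gbar_algebra_subspace, of "{1}"] gbar_algebra_one by simp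
next
  case (Suc n)
  then show ?case unfolding gbar_filtration.simps
    by (intro complex_vector.span_minimal gbar_algebra_subspace) (auto intro!: gbar_algebra_mult gbar_algebra_nil_gen)
qed

lemma gbar_algebra_filtration:
  assumes "f \<in> gbar_algebra"
  obtains n where "f \<in> gbar_filtration n"
proof -
  have "\<exists>n. f \<in> gbar_filtration n"
    using assms
  proof (induction rule: gbar_algebra_induct)
    case (gen v)
    have "nil_gen v * 1 \<in> gbar_filtration (Suc 0)"
      by (rule gbar_filtration_nil_gen) (simp add: complex_vector.span_base)
    then have "nil_gen v \<in> gbar_filtration (Suc 0)" by (simp only: mult_1_right)
    then show ?case by blast
  next
    case one
    show ?case by (intro exI[of _ 0]) (simp add: complex_vector.span_base)
  next
    case (add u v)
    then obtain m n where "u \<in> gbar_filtration m" "v \<in> gbar_filtration n" by blast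
    then have "u \<in> gbar_filtration (max m n)" "v \<in> gbar_filtration (max m n)"
      using gbar_filtration_mono[of m "max m n"] gbar_filtration_mono[of n "max m n"] by auto
    then show ?case using complex_vector.subspace_add[OF gbar_filtration_subspace] by blast
  next
    case (scaleC u c)
    then show ?case using complex_vector.subspace_scale[OF gbar_filtration_subspace] by blast
  next
    case (mult u v)
    then show ?case using gbar_filtration_mult by blast
  qed
  then show ?thesis using that by blast
qed

lemma gbar_filtration_ad: "f \<in> gbar_filtration n \<Longrightarrow> ad x f \<in> gbar_filtration n"
proof (induction n arbitrary: f)
  case 0
  then obtain c where "f = c *\<^sub>C 1" by (auto simp: complex_vector.span_singleton)
  then show ?case using complex_vector.span_zero by (simp add: ad_scaleC)
next
  case (Suc n)
  from Suc.prems show ?case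
    unfolding gbar_filtration.simps
  proof (induction rule: complex_vector.span_induct_alt)
    case base
    have "ad x 0 = 0" by (simp add: ad_def)
    then show ?case using complex_vector.span_zero by simp
  next
    case (step c y z)
    have "ad x y \<in> gbar_filtration (Suc n)"
      using step(1)
    proof
      assume "y \<in> gbar_filtration n"
      then show ?thesis using Suc.IH gbar_filtration_mono[of n "Suc n"] by auto
    next
      assume "y \<in> {nil_gen v * f | v f. f \<in> gbar_filtration n}"
      then obtain v f where y: "y = nil_gen v * f" "f \<in> gbar_filtration n" by blast
      then have "ad x y = nil_gen (bracket x v) * f + nil_gen v * ad x f" by (simp add: ad_mult ad_nil_gen)
      then show ?thesis
        using complex_vector.subspace_add[OF gbar_filtration_subspace gbar_filtration_nil_gen gbar_filtration_nil_gen]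
          y Suc.IH by metis
    qed
    then show ?case
      using step.IH complex_vector.subspace_add[OF gbar_filtration_subspace, of _ "Suc n"]
        complex_vector.subspace_scale[OF gbar_filtration_subspace, of _ "Suc n"]
      unfolding gbar_filtration.simps(2)[symmetric] ad_add ad_scaleC by blast
  qed
qed

lemma gbar_filtration_finite_dim:
  assumes "finite_dim (UNIV :: 'g::complex_lie_algebra set)"
  shows "finite_dim (gbar_filtration n :: 'g takiff uea set)"
proof (induction n)
  case 0
  show ?case by (simp add: finite_dim_span)
next
  case (Suc n)
  obtain B :: "'g set" where B: "finite B" "cspan B = UNIV" using assms by (auto simp: finite_dim_def)
  obtain F :: "'g takiff uea set" where F: "finite F" "cspan F = gbar_filtration n"
    using Suc by (auto simp: finite_dim_def)
  let ?G = "F \<union> (\<lambda>(b, f). nil_gen b * f) ` (B \<times> F)"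
  have "nil_gen v * f \<in> cspan ?G" if f: "f \<in> gbar_filtration n" for v f
  proof -
    have 1: "nil_gen b * f \<in> cspan ?G" if b: "b \<in> B" for b
      using f unfolding F(2)[symmetric]
    proof (induction rule: complex_vector.span_induct_alt)
      case (step c x y)
      have "nil_gen b * x \<in> cspan ?G" using b step(1) by (intro complex_vector.span_base) auto
      then show ?case using step.IH
        by (simp only: distrib_left uea_scaleC_mult_right complex_vector.span_add complex_vector.span_scale)
    qed (simp add: complex_vector.span_zero)
    have "v \<in> cspan B" using B by simp
    then show ?thesis
    proof (induction rule: complex_vector.span_induct_alt)
      case (step c x y)
      then show ?case using 1[OF step(1)]
        by (simp only: distrib_right uea_scaleC_mult_left nil_gen_add nil_gen_scaleC complex_vector.span_add
            complex_vector.span_scale)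
    qed (simp add: nil_gen_zero complex_vector.span_zero)
  qed
  moreover have "gbar_filtration n \<subseteq> cspan ?G" unfolding F(2)[symmetric] by (rule complex_vector.span_mono) simp
  ultimately have "gbar_filtration (Suc n) \<subseteq> cspan ?G"
    unfolding gbar_filtration.simps by (intro complex_vector.span_minimal) auto
  moreover have "finite ?G" using B F by simp
  ultimately show ?case
    using finite_dim_subset[OF finite_dim_span[of ?G] gbar_filtration_subspace] by blast
qed

lemma gbar_algebra_locally_finite:
  assumes "finite_dim (UNIV :: 'g::complex_lie_algebra set)"
  shows "locally_finite (gbar_algebra :: 'g takiff uea set) ad"
  unfolding locally_finite_def
proof (intro conjI ballI)
  show "lie_module gbar_algebra (ad :: 'g \<Rightarrow> _)" by (rule gbar_algebra_ad_module)
  fix f :: "'g takiff uea" assume "f \<in> gbar_algebra"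
  then obtain n where n: "f \<in> gbar_filtration n" by (rule gbar_algebra_filtration)
  have "lie_submodule (gbar_filtration n) gbar_algebra (ad :: 'g \<Rightarrow> _)"
    by (rule lie_submoduleI[OF gbar_algebra_ad_module gbar_filtration_subspace gbar_filtration_subset
          gbar_filtration_ad])
  then show "\<exists>F. finite_dim F \<and> lie_submodule F gbar_algebra ad \<and> f \<in> F"
    using gbar_filtration_finite_dim[OF assms] n by blast
qed

subsection \<open>The Takiff module structure on the nilpotent part\<close>

text \<open>A model of the module induced from the trivial \<open>g\<close>-module: \<open>1\<close>
  is the invariant generator, \<open>g\<close> acts by commutators because it kills
  \<open>1\<close>, and \<open>gbar\<close> acts by multiplication.\<close>

definition takiff_act :: "'g::complex_lie_algebra takiff \<Rightarrow> 'g takiff uea \<Rightarrow> 'g takiff uea"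
  where "takiff_act t f = ad (body t) f + nil_gen (nil_part t) * f"

lemma takiff_act_module: "lie_module gbar_algebra takiff_act"
proof -
  have br: "takiff_act (bracket s t) f = takiff_act s (takiff_act t f) - takiff_act t (takiff_act s f)" for s t :: "'a takiff" and f
  proof -
    have 1: "nil_gen (bracket (nil_part s) (body t)) = - nil_gen (bracket (body t) (nil_part s))"
      unfolding bracket_anticommute[of "nil_part s" "body t"]
      using nil_gen_scaleC[of "-1" "bracket (body t) (nil_part s)"] by simp
    have 2: "nil_gen (nil_part s) * (nil_gen (nil_part t) * f) = nil_gen (nil_part t) * (nil_gen (nil_part s) * f)"
      by (simp add: nil_gen_commute[of "nil_part s"] flip: mult.assoc)
    show ?thesis
      by (simp add: takiff_act_def bracket_takiff_def ad_bracket nil_gen_add ad_add ad_mult ad_nil_gen distrib_left distrib_right left_diff_distrib 1 2)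
  qed
  show ?thesis
    unfolding lie_module_def
    by (simp add: br gbar_algebra_subspace)
      (simp add: takiff_act_def ad_gbar_algebra gbar_algebra_add gbar_algebra_mult gbar_algebra_nil_gen ad_add ad_scaleC
        ad_add_left ad_scaleC_left plus_takiff_def scaleC_takiff_def nil_gen_add nil_gen_scaleC distrib_left distrib_right
        uea_scaleC_mult_left uea_scaleC_mult_right scaleC_add_right algebra_simps)
qed

lemma takiff_act_body: "takiff_act (Takiff x 0) f = ad x f"
  and takiff_act_nil: "takiff_act (Takiff 0 x) f = nil_gen x * f"
  by (simp_all add: takiff_act_def nil_gen_zero ad_def body_gen_def flip: zero_takiff_def)
    (use uea_gen_scaleC[of 0 "0 :: 'a takiff"] in simp)

lemma restrict_takiff: "restrict_to_g \<rho> x = \<rho> (Takiff x 0)"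
  by (simp add: restrict_to_g_def takiff_tensor_def)

lemma uea_act_nil_gen:
  "lie_module V \<rho> \<Longrightarrow> v \<in> V \<Longrightarrow> uea_act \<rho> (nil_gen x) v = \<rho> (Takiff 0 x) v"
  unfolding nil_gen_def by (rule uea_act_gen)

text \<open>\<open>gbar\<close> acts by multiplication and generates the algebra. Takiff submodules
  are therefore the same as \<open>ad\<close>-stable ideals; \<open>takiff_submodule_ad\<close> and
  \<open>takiff_submoduleI\<close> complete this dictionary.\<close>

lemma takiff_submodule_ideal:
  assumes "lie_submodule N gbar_algebra takiff_act" "f \<in> N" "h \<in> gbar_algebra"
  shows "f * h \<in> N"
proof -
  note N = lie_submoduleD(1)[OF assms(1)] lie_submoduleD(3)[OF assms(1)]
  have "\<forall>f\<in>N. h * f \<in> N"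
    using assms(3)
  proof (induction rule: gbar_algebra_induct)
    case (gen v)
    show ?case using lie_submoduleD(4)[OF assms(1), of _ "Takiff 0 v"] by (simp add: takiff_act_nil)
  next
    case (mult u v)
    then show ?case by (simp add: mult.assoc)
  qed (use N in \<open>auto simp: distrib_right uea_scaleC_mult_left complex_vector.subspace_add complex_vector.subspace_scale\<close>)
  moreover have "f * h = h * f" using gbar_algebra_commute assms N(1) by blast
  ultimately show ?thesis using assms(2) by simp
qed

lemma takiff_submodule_ad:
  assumes "lie_submodule N gbar_algebra takiff_act"
  shows "lie_submodule N gbar_algebra ad"
  by (rule lie_submoduleI[OF gbar_algebra_ad_module lie_submoduleD(3,1)[OF assms]])
    (use lie_submoduleD(4)[OF assms, of _ "Takiff _ 0"] in \<open>simp add: takiff_act_body\<close>)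

lemma takiff_submoduleI:
  assumes "csubspace N" "N \<subseteq> gbar_algebra" "\<And>x f. f \<in> N \<Longrightarrow> ad x f \<in> N"
    "\<And>f h. f \<in> N \<Longrightarrow> h \<in> gbar_algebra \<Longrightarrow> h * f \<in> N"
  shows "lie_submodule N gbar_algebra takiff_act"
  by (rule lie_submoduleI[OF takiff_act_module assms(1,2)])
    (unfold takiff_act_def, intro complex_vector.subspace_add assms gbar_algebra_nil_gen)

section \<open>Characters of the nilpotent part\<close>

text \<open>Plain ideals, without stability under \<open>ad\<close>: adjoining an element
  \<open>x - c\<close> may destroy it, and the kernel of a character need not have it.\<close>

definition gbar_ideal :: "'g::complex_lie_algebra takiff uea set \<Rightarrow> bool"
  where "gbar_ideal I \<longleftrightarrow> csubspace I \<and> I \<subseteq> gbar_algebra \<and> (\<forall>f\<in>I. \<forall>h\<in>gbar_algebra. h * f \<in> I)"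

text \<open>Otherwise all \<open>x - c\<close> would be invertible modulo \<open>I\<close>, and uncountably many of the inverses
  would lie in one finite-dimensional step of the filtration.\<close>

lemma gbar_ideal_extend:
  fixes I :: "'g::complex_lie_algebra takiff uea set"
  assumes fd: "finite_dim (UNIV :: 'g set)" and I: "gbar_ideal I" "1 \<notin> I" and x: "x \<in> gbar_algebra"
  obtains c I' where "gbar_ideal I'" "1 \<notin> I'" "I \<subseteq> I'" "x - c *\<^sub>C 1 \<in> I'"
proof -
  note sS = gbar_algebra_subspace
  have sI: "csubspace I" and IS: "\<And>f. f \<in> I \<Longrightarrow> f \<in> gbar_algebra"
    and Im: "\<And>f h. f \<in> I \<Longrightarrow> h \<in> gbar_algebra \<Longrightarrow> h * f \<in> I"
    using I(1) by (auto simp: gbar_ideal_def)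
  have xc: "x - c *\<^sub>C 1 \<in> gbar_algebra" for c
    by (intro complex_vector.subspace_diff[OF sS] x gbar_algebra_scaleC gbar_algebra_one)
  have xcm: "(x - c *\<^sub>C 1) * u = x * u - c *\<^sub>C u" for c u
    by (simp add: left_diff_distrib uea_scaleC_mult_left)
  \<comment> \<open>The ideal generated by \<open>I\<close> and \<open>x - c\<close>.\<close>
  define J where "J c = {f + (x - c *\<^sub>C 1) * h | f h. f \<in> I \<and> h \<in> gbar_algebra}" for c
  have JI: "gbar_ideal (J c)" for c
    unfolding gbar_ideal_def
  proof (intro conjI ballI)
    show "csubspace (J c)"
    proof (rule complex_vector.subspaceI)
      show "0 \<in> J c" unfolding J_def
        using complex_vector.subspace_0[OF sI] complex_vector.subspace_0[OF sS]
        by (intro CollectI exI[of _ 0]) simp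
      fix a b assume "a \<in> J c" "b \<in> J c"
      then obtain f h f' h' where ab: "a = f + (x - c *\<^sub>C 1) * h" "b = f' + (x - c *\<^sub>C 1) * h'"
        "f \<in> I" "f' \<in> I" "h \<in> gbar_algebra" "h' \<in> gbar_algebra" unfolding J_def by blast
      then have "a + b = (f + f') + (x - c *\<^sub>C 1) * (h + h')" by (simp add: distrib_left)
      then show "a + b \<in> J c" unfolding J_def
        using ab complex_vector.subspace_add[OF sI] gbar_algebra_add by blast
      fix k
      have "k *\<^sub>C a = k *\<^sub>C f + (x - c *\<^sub>C 1) * (k *\<^sub>C h)"
        using ab by (simp add: scaleC_add_right uea_scaleC_mult_right)
      then show "k *\<^sub>C a \<in> J c" unfolding J_def
        using ab complex_vector.subspace_scale[OF sI] gbar_algebra_scaleC by blast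
    qed
    show "J c \<subseteq> gbar_algebra"
      unfolding J_def using IS xc by (auto intro!: gbar_algebra_add gbar_algebra_mult)
    fix a k :: "'g takiff uea" assume "a \<in> J c" "k \<in> gbar_algebra"
    then obtain f h where ab: "a = f + (x - c *\<^sub>C 1) * h" "f \<in> I" "h \<in> gbar_algebra" unfolding J_def by blast
    have "k * a = k * f + (x - c *\<^sub>C 1) * (k * h)"
      using gbar_algebra_commute[OF \<open>k \<in> gbar_algebra\<close> xc[of c]] ab(1)
      by (simp add: distrib_left flip: mult.assoc)
    then show "k * a \<in> J c" unfolding J_def using ab Im gbar_algebra_mult \<open>k \<in> gbar_algebra\<close> by blast
  qed
  have "\<exists>c. 1 \<notin> J c"
  proof (rule ccontr)
    assume "\<nexists>c. 1 \<notin> J c"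
    then have "\<exists>u. u \<in> gbar_algebra \<and> (x * u - c *\<^sub>C u) - 1 \<in> I" for c
    proof -
      have "1 \<in> J c" using \<open>\<nexists>c. 1 \<notin> J c\<close> by blast
      then obtain f h where fh: "1 = f + (x - c *\<^sub>C 1) * h" "f \<in> I" "h \<in> gbar_algebra" unfolding J_def by blast
      have "(x * h - c *\<^sub>C h) - 1 = - f" using fh(1) unfolding xcm by (simp add: algebra_simps)
      then show ?thesis using fh complex_vector.subspace_neg[OF sI] by metis
    qed
    \<comment> \<open>\<open>u c\<close> is an inverse of \<open>x - c\<close> modulo
      \<open>I\<close>.\<close>
    then obtain u where u: "\<And>c. u c \<in> gbar_algebra" "\<And>c. (x * u c - c *\<^sub>C u c) - 1 \<in> I" by metis
    define m where "m f = x * f" for f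
    have lm: "lin_on W m" for W
      unfolding lin_on_def m_def by (simp add: distrib_left uea_scaleC_mult_right)
    have mS: "m ` gbar_algebra \<subseteq> gbar_algebra" and mI: "m ` I \<subseteq> I"
      using x Im by (auto simp: m_def gbar_algebra_mult)
    \<comment> \<open>Uncountably many \<open>c\<close> are distributed over countably many steps of
      the filtration, so one step contains \<open>u c\<close> for infinitely many \<open>c\<close>,
      and any \<open>card E + 1\<close> of these satisfy a nontrivial relation.\<close>
    have "UNIV = (\<Union>n. {c. u c \<in> gbar_filtration n})"
      using u(1) gbar_algebra_filtration by blast
    then obtain n where "infinite {c. u c \<in> gbar_filtration n}"
      using uncountable_UNIV_complex countable_UN[of UNIV "\<lambda>n. {c. u c \<in> gbar_filtration n}"]
        countable_finite by (metis countableI_type)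
    note inf = this
    obtain E :: "'g takiff uea set" where E: "finite E" "cindependent E" "cspan E = gbar_filtration n"
      using finite_dim_basis[OF gbar_filtration_finite_dim[OF fd]] by metis
    obtain A where A: "finite A" "card A = Suc (card E)" "A \<subseteq> {c. u c \<in> gbar_filtration n}"
      using infinite_arbitrarily_large[OF inf] by metis
    let ?r = "complex_vector.representation E"
    obtain a where a: "\<exists>i\<in>A. a i \<noteq> 0" "\<forall>e\<in>E. (\<Sum>i\<in>A. a i * ?r (u i) e) = 0"
      using homogeneous_system[OF E(1) A(1), of "\<lambda>i e. ?r (u i) e"] A(2) by auto
    have "(\<Sum>i\<in>A. a i *\<^sub>C u i) = (\<Sum>i\<in>A. \<Sum>e\<in>E. (a i * ?r (u i) e) *\<^sub>C e)"
    proof (rule sum.cong[OF refl])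
      fix i assume "i \<in> A"
      then have "u i \<in> cspan E" using A(3) E(3) by blast
      then have "a i *\<^sub>C u i = a i *\<^sub>C (\<Sum>e\<in>E. ?r (u i) e *\<^sub>C e)"
        using complex_vector.sum_representation_eq[OF E(2) _ E(1)] by simp
      then show "a i *\<^sub>C u i = (\<Sum>e\<in>E. (a i * ?r (u i) e) *\<^sub>C e)"
        by (simp add: complex_vector.scale_sum_right scaleC_scaleC)
    qed
    also have "\<dots> = (\<Sum>e\<in>E. (\<Sum>i\<in>A. a i * ?r (u i) e) *\<^sub>C e)"
      by (subst sum.swap) (simp add: complex_vector.scale_sum_left)
    also have "\<dots> = 0" using a(2) by simp
    finally have u0: "(\<Sum>i\<in>A. a i *\<^sub>C u i) = 0" .
    \<comment> \<open>The relation reads, modulo \<open>I\<close>, that the sum of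
      \<open>a i / (x - i)\<close> vanishes. Clearing denominators with \<open>P\<close> gives the
      polynomial \<open>p\<close>, whose value at \<open>x\<close> lies in \<open>I\<close>.\<close>
    define Q where "Q i = (\<Prod>j\<in>A - {i}. [:- j, 1:])" for i
    define P where "P = (\<Prod>j\<in>A. [:- j, 1:])"
    define p where "p = (\<Sum>i\<in>A. smult (a i) (Q i))"
    have QP: "[:- i, 1:] * Q i = P" if "i \<in> A" for i
      unfolding P_def Q_def using prod.remove[OF A(1) that, of "\<lambda>j. [:- j, 1:]"] by simp
    \<comment> \<open>At a root \<open>k\<close> of \<open>P\<close> with \<open>a k\<close> nonzero
      only the summand of \<open>k\<close> survives, as in Lagrange interpolation.\<close>
    have "p \<noteq> 0"
    proof
      assume "p = 0"
      obtain k where k: "k \<in> A" "a k \<noteq> 0" using a(1) by blast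
      have "poly (Q i) k = 0" if "i \<in> A" "i \<noteq> k" for i
        unfolding Q_def poly_prod using that k A(1) by (intro prod_zero) (auto intro!: bexI[of _ k])
      then have "poly p k = a k * poly (Q k) k"
        unfolding p_def poly_sum using k A(1) by (subst sum.remove[OF A(1) k(1)]) (simp add: sum.neutral)
      moreover have "poly (Q k) k \<noteq> 0"
        unfolding Q_def poly_prod using A(1) by (auto simp: prod_zero_iff)
      ultimately show False using k \<open>p = 0\<close> by simp
    qed
    moreover have "op_eval m p 1 \<in> I"
    proof -
      have diff: "op_eval m P (u i) - op_eval m (Q i) 1 \<in> I" if "i \<in> A" for i
      proof -
        let ?v = "m (u i) - i *\<^sub>C u i"
        have v: "?v \<in> gbar_algebra" "?v - 1 \<in> I"
          unfolding m_def
          by (intro complex_vector.subspace_diff[OF sS] gbar_algebra_scaleC gbar_algebra_mult x u)+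
        have "op_eval m P (u i) = op_eval m (Q i) ?v"
          using op_eval_linear_factor'[OF sS lm mS u(1), of i "Q i" i] QP[OF that] by simp
        then have "op_eval m P (u i) - op_eval m (Q i) 1 = op_eval m (Q i) (?v - 1)"
          using lin_on_diff[OF lin_on_op_eval[OF sS lm mS] sS v(1) gbar_algebra_one] by simp
        also have "\<dots> \<in> I" by (rule op_eval_mem[OF sI lm mI v(2)])
        finally show ?thesis .
      qed
      have "op_eval m p 1 = (\<Sum>i\<in>A. a i *\<^sub>C op_eval m (Q i) 1)"
        by (simp add: p_def op_eval_sum op_eval_smult)
      also have "\<dots> = (\<Sum>i\<in>A. a i *\<^sub>C op_eval m P (u i)) - (\<Sum>i\<in>A. a i *\<^sub>C (op_eval m P (u i) - op_eval m (Q i) 1))"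
        by (simp add: complex_vector.scale_right_diff_distrib sum_subtractf)
      also have "(\<Sum>i\<in>A. a i *\<^sub>C op_eval m P (u i)) = op_eval m P (\<Sum>i\<in>A. a i *\<^sub>C u i)"
        by (rule lin_on_sum_scale[OF lin_on_op_eval[OF sS lm mS] sS u(1), symmetric])
      also have "\<dots> = 0" unfolding u0 by (rule lin_on_zero[OF lin_on_op_eval[OF sS lm mS] sS])
      finally have "op_eval m p 1 = - (\<Sum>i\<in>A. a i *\<^sub>C (op_eval m P (u i) - op_eval m (Q i) 1))" by simp
      then show ?thesis using complex_vector.subspace_neg[OF sI subspace_lincomb[OF sI diff]] by simp
    qed
    \<comment> \<open>Each \<open>x - c\<close> is invertible modulo \<open>I\<close>, so the
      factors of \<open>p\<close> can be cancelled and \<open>1\<close> itself falls into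
      \<open>I\<close>.\<close>
    ultimately have "1 \<in> I"
    proof (rule op_eval_cancel[OF sS lm mS _ gbar_algebra_one _ sI])
      fix c v assume v: "v \<in> gbar_algebra" "m v - c *\<^sub>C v \<in> I"
      have "(x * u c - c *\<^sub>C u c) * v = u c * (m v - c *\<^sub>C v)"
        using gbar_algebra_commute[OF x u(1)[of c]]
        by (simp add: m_def algebra_simps uea_scaleC_mult_left uea_scaleC_mult_right flip: mult.assoc)
      then have "v = u c * (m v - c *\<^sub>C v) - v * ((x * u c - c *\<^sub>C u c) - 1)"
        using gbar_algebra_commute[OF v(1), of "(x * u c - c *\<^sub>C u c) - 1"] IS[OF u(2)[of c]]
        by (simp add: left_diff_distrib)
      moreover have "u c * (m v - c *\<^sub>C v) \<in> I" "v * ((x * u c - c *\<^sub>C u c) - 1) \<in> I"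
        using Im v u by auto
      ultimately show "v \<in> I" using complex_vector.subspace_diff[OF sI] by metis
    qed
    then show False using I(2) by blast
  qed
  then obtain c where "1 \<notin> J c" by blast
  moreover have "I \<subseteq> J c"
  proof
    fix f assume "f \<in> I"
    then show "f \<in> J c" unfolding J_def using complex_vector.subspace_0[OF sS] by (intro CollectI exI[of _ f] exI[of _ 0]) simp
  qed
  moreover have "x - c *\<^sub>C 1 \<in> J c"
    unfolding J_def using complex_vector.subspace_0[OF sI] gbar_algebra_one
    by (intro CollectI exI[of _ 0] exI[of _ 1]) simp
  ultimately show ?thesis using that JI by blast
qed

text \<open>Adjoining suitable \<open>nil_gen b - c\<close> for a finite spanning set of
  \<open>g\<close> makes every generator, hence every element, congruent to a scalar modulo the
  enlarged ideal \<open>I\<close>. The scalar is unique as \<open>1\<close> is not in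
  \<open>I\<close>, and it defines \<open>ev\<close>.\<close>

lemma gbar_character:
  fixes N :: "'g::complex_lie_algebra takiff uea set"
  assumes fd: "finite_dim (UNIV :: 'g set)" and N: "gbar_ideal N" "1 \<notin> N"
  obtains ev :: "'g takiff uea \<Rightarrow> complex" where "lin_on gbar_algebra ev" "ev 1 = 1" "\<And>f. f \<in> N \<Longrightarrow> ev f = 0"
    "\<And>f g. f \<in> gbar_algebra \<Longrightarrow> g \<in> gbar_algebra \<Longrightarrow> ev (f * g) = ev f * ev g"
proof -
  obtain B :: "'g set" where B: "finite B" "cspan B = UNIV" using fd by (auto simp: finite_dim_def)
  have "\<exists>I. gbar_ideal I \<and> 1 \<notin> I \<and> N \<subseteq> I \<and> (\<forall>b\<in>B. \<exists>c. nil_gen b - c *\<^sub>C 1 \<in> I)"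
    using B(1)
  proof (induction B rule: finite_induct)
    case empty
    then show ?case using N by blast
  next
    case (insert b B)
    then obtain I where I: "gbar_ideal I" "1 \<notin> I" "N \<subseteq> I" "\<forall>b\<in>B. \<exists>c. nil_gen b - c *\<^sub>C 1 \<in> I" by blast
    obtain c I' where "gbar_ideal I'" "1 \<notin> I'" "I \<subseteq> I'" "nil_gen b - c *\<^sub>C 1 \<in> I'"
      by (rule gbar_ideal_extend[OF fd I(1,2) gbar_algebra_nil_gen])
    then show ?case using I by (intro exI[of _ I']) blast
  qed
  then obtain I where I: "gbar_ideal I" "1 \<notin> I" "N \<subseteq> I" "\<forall>b\<in>B. \<exists>c. nil_gen b - c *\<^sub>C 1 \<in> I" by blast
  have sI: "csubspace I" and IS: "\<And>f. f \<in> I \<Longrightarrow> f \<in> gbar_algebra"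
    and Im: "\<And>f h. f \<in> I \<Longrightarrow> h \<in> gbar_algebra \<Longrightarrow> h * f \<in> I"
    using I(1) by (auto simp: gbar_ideal_def)
  note Iadd = complex_vector.subspace_add[OF sI] and Iscale = complex_vector.subspace_scale[OF sI]
    and Idiff = complex_vector.subspace_diff[OF sI]
  have gadd: "(f + g) - (c + d) *\<^sub>C 1 \<in> I" if "f - c *\<^sub>C 1 \<in> I" "g - d *\<^sub>C 1 \<in> I" for f g c d
    using Iadd[OF that] by (simp add: scaleC_add_left algebra_simps)
  have gscale: "k *\<^sub>C f - (k * c) *\<^sub>C 1 \<in> I" if "f - c *\<^sub>C 1 \<in> I" for f k c
    using Iscale[OF that, of k] by (simp add: complex_vector.scale_right_diff_distrib scaleC_scaleC)
  have gmult: "f * g - (c * d) *\<^sub>C 1 \<in> I"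
    if "f - c *\<^sub>C 1 \<in> I" "g - d *\<^sub>C 1 \<in> I" "f \<in> gbar_algebra" for f g c d
  proof -
    have "f * (g - d *\<^sub>C 1) + d *\<^sub>C (f - c *\<^sub>C 1) = f * g - (c * d) *\<^sub>C 1"
      by (simp add: right_diff_distrib uea_scaleC_mult_right complex_vector.scale_right_diff_distrib scaleC_scaleC mult.commute)
    then show ?thesis using Iadd[OF Im[OF that(2,3)] Iscale[OF that(1), of d]] by simp
  qed
  have gen: "\<exists>c. nil_gen v - c *\<^sub>C 1 \<in> I" for v
  proof -
    have "v \<in> cspan B" using B by simp
    then show ?thesis
    proof (induction rule: complex_vector.span_induct_alt)
      case base
      show ?case using complex_vector.subspace_0[OF sI] by (intro exI[of _ 0]) (simp add: nil_gen_zero)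
    next
      case (step k x y)
      then obtain c d where "nil_gen x - c *\<^sub>C 1 \<in> I" "nil_gen y - d *\<^sub>C 1 \<in> I" using I(4) by blast
      then show ?case using gadd[OF gscale[of "nil_gen x" c k], of "nil_gen y" d]
        by (auto simp: nil_gen_add nil_gen_scaleC)
    qed
  qed
  have ex: "\<exists>c. f - c *\<^sub>C 1 \<in> I" if "f \<in> gbar_algebra" for f
    using that
  proof (induction rule: gbar_algebra_induct)
    case one
    show ?case using complex_vector.subspace_0[OF sI] by (intro exI[of _ 1]) (simp add: scaleC_one)
  qed (use gen gadd gscale gmult in blast)+
  have unique: "c = d" if "f - c *\<^sub>C 1 \<in> I" "f - d *\<^sub>C 1 \<in> I" for f c d
  proof (rule ccontr)
    assume "c \<noteq> d"
    have "(1 / (d - c)) *\<^sub>C ((f - c *\<^sub>C 1) - (f - d *\<^sub>C 1)) \<in> I" by (intro Iscale Idiff that)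
    also have "(1 / (d - c)) *\<^sub>C ((f - c *\<^sub>C 1) - (f - d *\<^sub>C 1)) = (1 / (d - c)) *\<^sub>C (d - c) *\<^sub>C (1 :: 'g takiff uea)"
      by (simp add: complex_vector.scale_left_diff_distrib)
    finally show False using I(2) \<open>c \<noteq> d\<close> by (simp add: scaleC_scaleC scaleC_one)
  qed
  obtain ev where ev: "\<And>f. f \<in> gbar_algebra \<Longrightarrow> f - ev f *\<^sub>C 1 \<in> I" using ex by metis
  have evI: "ev f = c" if "f - c *\<^sub>C 1 \<in> I" "f \<in> gbar_algebra" for f c
    using unique ev that by blast
  show ?thesis
  proof (rule that)
    show "lin_on gbar_algebra ev"
      unfolding lin_on_def
      using gadd ev gscale gbar_algebra_add gbar_algebra_scaleC by (auto intro!: evI simp: scaleC_complex_def)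
    show "ev 1 = 1" using complex_vector.subspace_0[OF sI] gbar_algebra_one by (intro evI) (simp_all add: scaleC_one)
    show "ev f = 0" if "f \<in> N" for f using that I(3) IS by (intro evI) auto
    show "ev (f * g) = ev f * ev g" if "f \<in> gbar_algebra" "g \<in> gbar_algebra" for f g
      using that by (intro evI gmult ev gbar_algebra_mult)
  qed
qed

lemma takiff_submodule_gbar_ideal:
  assumes "lie_submodule N gbar_algebra takiff_act"
  shows "gbar_ideal (N :: 'a::complex_lie_algebra takiff uea set)"
  unfolding gbar_ideal_def
proof (intro conjI ballI)
  fix f h :: "'a takiff uea" assume fh: "f \<in> N" "h \<in> gbar_algebra"
  then have "h * f = f * h" using gbar_algebra_commute lie_submoduleD(1)[OF assms] by blast
  then show "h * f \<in> N" using takiff_submodule_ideal[OF assms fh] by simp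
qed (use lie_submoduleD[OF assms] in auto)

section \<open>The purely Takiff part of the center\<close>

lemma takiff_center_subspace: "csubspace (takiff_center :: 'g::complex_lie_algebra takiff uea set)"
  unfolding takiff_center_invariants by (rule invariants_subspace[OF gbar_algebra_ad_module])

lemma takiff_center_one: "(1 :: 'g::complex_lie_algebra takiff uea) \<in> takiff_center"
  by (simp add: takiff_center_iff gbar_algebra_one)

lemma takiff_center_gbar: "z \<in> takiff_center \<Longrightarrow> z \<in> gbar_algebra"
  by (simp add: takiff_center_iff)

lemma takiff_center_ad_mult: "z \<in> takiff_center \<Longrightarrow> ad x (z * f) = z * ad x f"
  by (simp add: takiff_center_iff ad_mult)

text \<open>A central factor can be moved inside \<open>ad\<close>. This makes the Reynolds operator
  linear over the center.\<close>

lemma takiff_center_action_span: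
  fixes z :: "'g::complex_lie_algebra takiff uea"
  assumes z: "z \<in> takiff_center" and f: "f \<in> action_span gbar_algebra ad"
  shows "z * f \<in> action_span gbar_algebra ad"
  using f unfolding action_span_def
proof (induction rule: complex_vector.span_induct_alt)
  case base
  then show ?case by (simp add: complex_vector.span_zero)
next
  case (step c x y)
  then obtain t h where th: "x = ad t h" "h \<in> gbar_algebra" by blast
  have "z * x = ad t (z * h)" using th takiff_center_ad_mult[OF z] by simp
  moreover have "z * h \<in> gbar_algebra" using gbar_algebra_mult[OF takiff_center_gbar[OF z] th(2)] .
  ultimately have "z * x \<in> cspan {ad x v |x v. v \<in> gbar_algebra}" by (intro complex_vector.span_base) blast
  then show ?case using step.IH
    by (simp only: distrib_left uea_scaleC_mult_right complex_vector.span_add complex_vector.span_scale)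
qed

section \<open>The Reynolds operator\<close>

definition reynolds :: "'g::complex_lie_algebra takiff uea \<Rightarrow> 'g takiff uea"
  where "reynolds f = (THE z. z \<in> takiff_center \<and> f - z \<in> action_span gbar_algebra ad)"

context
  fixes \<chi> :: "'g::complex_lie_algebra takiff uea \<Rightarrow> complex"
  assumes fd: "finite_dim (UNIV :: 'g set)" and ss: "semisimple TYPE('g)"
    and \<chi>: "takiff_character \<chi>"
begin

lemma reynolds_equation:
  fixes f :: "'g takiff uea"
  assumes "z \<in> takiff_center" "f - z \<in> action_span gbar_algebra ad"
  shows "reynolds f = z"
  unfolding reynolds_def
proof (rule the_equality)
  show "z \<in> takiff_center \<and> f - z \<in> action_span gbar_algebra ad" using assms by blast
  fix y assume y: "y \<in> takiff_center \<and> f - y \<in> action_span gbar_algebra ad"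
  have "y - z \<in> invariants gbar_algebra (ad :: 'g \<Rightarrow> _)"
    using assms(1) y complex_vector.subspace_diff[OF invariants_subspace[OF gbar_algebra_ad_module]]
    unfolding takiff_center_invariants by blast
  moreover have "(f - z) - (f - y) \<in> action_span gbar_algebra (ad :: 'g \<Rightarrow> _)"
    using complex_vector.span_diff[OF assms(2)[unfolded action_span_def] conjunct2[OF y, unfolded action_span_def]]
    by (simp add: action_span_def)
  ultimately have "y - z = 0"
    by (intro invariants_Int_action_span[OF fd ss gbar_algebra_locally_finite[OF fd]]) simp_all
  then show "y = z" by simp
qed

lemma reynolds:
  fixes f :: "'g takiff uea"
  assumes "f \<in> gbar_algebra"
  shows "reynolds f \<in> takiff_center" "f - reynolds f \<in> action_span gbar_algebra ad"
proof -
  obtain z where "z \<in> takiff_center" "f - z \<in> action_span gbar_algebra ad"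
    using invariants_plus_action_span[OF fd ss gbar_algebra_locally_finite[OF fd] assms]
    by (auto simp: takiff_center_invariants)
  then show "reynolds f \<in> takiff_center" "f - reynolds f \<in> action_span gbar_algebra ad"
    using reynolds_equation by auto
qed

text \<open>\<open>N\<close> is itself locally finite, so \<open>f\<close> splits inside
  \<open>N\<close>; by uniqueness this is the splitting in the whole algebra. An
  \<open>ad\<close>-stable ideal thus contains the projections of its elements.\<close>

lemma reynolds_submodule:
  fixes f :: "'g takiff uea"
  assumes N: "lie_submodule N gbar_algebra ad" and "f \<in> N"
  shows "reynolds f \<in> N"
proof -
  obtain z where z: "z \<in> invariants N ad" "f - z \<in> action_span N ad"
    using invariants_plus_action_span[OF fd ss
        locally_finite_submodule[OF fd ss gbar_algebra_locally_finite[OF fd] N] assms(2)] by blast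
  have NS: "N \<subseteq> gbar_algebra" using lie_submoduleD(1)[OF N] .
  then have "z \<in> takiff_center" using z(1) by (auto simp: takiff_center_iff invariants_def)
  moreover have "f - z \<in> action_span gbar_algebra ad" using z(2) action_span_mono[OF NS] by blast
  ultimately show ?thesis using reynolds_equation z(1) by (simp add: invariants_def)
qed

lemma reynolds_add:
  fixes f g :: "'g takiff uea"
  assumes "f \<in> gbar_algebra" "g \<in> gbar_algebra"
  shows "reynolds (f + g) = reynolds f + reynolds g"
proof (rule reynolds_equation)
  show "reynolds f + reynolds g \<in> takiff_center"
    using reynolds(1) assms complex_vector.subspace_add[OF takiff_center_subspace] by blast
  have "(f - reynolds f) + (g - reynolds g) \<in> action_span gbar_algebra (ad :: 'g \<Rightarrow> _)"
    using reynolds(2)[OF assms(1)] reynolds(2)[OF assms(2)] unfolding action_span_def by (rule complex_vector.span_add)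
  then show "f + g - (reynolds f + reynolds g) \<in> action_span gbar_algebra ad" by (simp add: algebra_simps)
qed

lemma reynolds_center_mult:
  fixes f z :: "'g takiff uea"
  assumes "z \<in> takiff_center" "f \<in> gbar_algebra"
  shows "reynolds (z * f) = z * reynolds f"
proof (rule reynolds_equation)
  show "z * reynolds f \<in> takiff_center"
    using reynolds(1)[OF assms(2)] assms(1)
    by (auto simp: takiff_center_iff gbar_algebra_mult ad_mult)
  have "z * (f - reynolds f) \<in> action_span gbar_algebra ad"
    by (rule takiff_center_action_span[OF assms(1) reynolds(2)[OF assms(2)]])
  then show "z * f - z * reynolds f \<in> action_span gbar_algebra ad" by (simp add: right_diff_distrib)
qed

lemma reynolds_ad:
  fixes f :: "'g takiff uea"
  assumes "f \<in> gbar_algebra"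
  shows "reynolds (ad x f) = 0"
proof (rule reynolds_equation)
  show "(0 :: 'g takiff uea) \<in> takiff_center" using complex_vector.subspace_0[OF takiff_center_subspace] .
  show "ad x f - 0 \<in> action_span gbar_algebra ad"
    unfolding action_span_def using assms by (intro complex_vector.span_base) auto
qed

lemma reynolds_center: "z \<in> takiff_center \<Longrightarrow> reynolds z = z" for z :: "'g takiff uea"
  by (rule reynolds_equation) (simp_all add: action_span_def complex_vector.span_zero)

lemma reynolds_scaleC:
  fixes f :: "'g takiff uea"
  assumes "f \<in> gbar_algebra"
  shows "reynolds (c *\<^sub>C f) = c *\<^sub>C reynolds f"
proof -
  have "c *\<^sub>C 1 \<in> (takiff_center :: 'g takiff uea set)"
    using takiff_center_one complex_vector.subspace_scale[OF takiff_center_subspace] by blast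
  then show ?thesis using reynolds_center_mult[of "c *\<^sub>C 1" f] assms by (simp add: uea_scaleC_mult_left)
qed

lemma character_rules:
  "\<chi> 1 = 1"
  "z \<in> takiff_center \<Longrightarrow> w \<in> takiff_center \<Longrightarrow> \<chi> (z + w) = \<chi> z + \<chi> w"
  "z \<in> takiff_center \<Longrightarrow> w \<in> takiff_center \<Longrightarrow> \<chi> (z * w) = \<chi> z * \<chi> w"
  "z \<in> takiff_center \<Longrightarrow> \<chi> (c *\<^sub>C z) = c * \<chi> z"
  using \<chi> by (auto simp: takiff_character_def)

lemma character_zero: "\<chi> 0 = 0"
  using character_rules(4)[OF takiff_center_one, of 0] by simp

text \<open>The annihilator of the \<open>g\<close>-invariant vector in the simple module to be constructed.\<close>

definition radical :: "'g takiff uea set"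
  where "radical = {f \<in> gbar_algebra. \<forall>h\<in>gbar_algebra. \<chi> (reynolds (f * h)) = 0}"

lemma radical_submodule: "lie_submodule radical gbar_algebra takiff_act"
proof (rule takiff_submoduleI)
  show "csubspace radical"
  proof (rule complex_vector.subspaceI)
    have "reynolds (0 :: 'g takiff uea) = 0"
      by (rule reynolds_center) (rule complex_vector.subspace_0[OF takiff_center_subspace])
    then show "0 \<in> radical"
      using complex_vector.subspace_0[OF gbar_algebra_subspace] by (simp add: radical_def character_zero)
  qed (auto simp: radical_def distrib_right uea_scaleC_mult_left gbar_algebra_add gbar_algebra_scaleC
      gbar_algebra_mult reynolds_add reynolds_scaleC character_rules reynolds(1))
  show "radical \<subseteq> gbar_algebra" by (auto simp: radical_def)
  show "ad x f \<in> radical" if f: "f \<in> radical" for x f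
    unfolding radical_def
  proof (intro CollectI conjI ballI)
    have fS: "f \<in> gbar_algebra" using f by (simp add: radical_def)
    then show "ad x f \<in> gbar_algebra" by (rule ad_gbar_algebra)
    fix h :: "'g takiff uea" assume h: "h \<in> gbar_algebra"
    \<comment> \<open>Integration by parts: the Reynolds operator kills \<open>ad x (f * h)\<close>,
      so \<open>ad x\<close> moves from \<open>f\<close> to \<open>h\<close> with a sign.\<close>
    have "ad x f * h = ad x (f * h) + (-1) *\<^sub>C (f * ad x h)" by (simp add: ad_mult)
    then have "reynolds (ad x f * h) = (-1) *\<^sub>C reynolds (f * ad x h)"
      using fS h by (simp only: reynolds_add reynolds_scaleC reynolds_ad gbar_algebra_mult ad_gbar_algebra
          gbar_algebra_scaleC add_0)
    also have "\<chi> \<dots> = (-1) * \<chi> (reynolds (f * ad x h))"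
      using fS h by (intro character_rules reynolds(1) gbar_algebra_mult ad_gbar_algebra)
    also have "\<dots> = 0" using f ad_gbar_algebra[OF h] by (simp add: radical_def)
    finally show "\<chi> (reynolds (ad x f * h)) = 0" .
  qed
  show "h * f \<in> radical" if f: "f \<in> radical" and h: "h \<in> gbar_algebra" for f h
    unfolding radical_def
  proof (intro CollectI conjI ballI)
    have fS: "f \<in> gbar_algebra" using f by (simp add: radical_def)
    then show "h * f \<in> gbar_algebra" using h by (rule_tac gbar_algebra_mult)
    fix k :: "'g takiff uea" assume k: "k \<in> gbar_algebra"
    have "h * f * k = f * (h * k)" using gbar_algebra_commute[OF h fS] by (simp add: mult.assoc)
    then show "\<chi> (reynolds (h * f * k)) = 0" using f gbar_algebra_mult[OF h k] by (simp add: radical_def)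
  qed
qed

lemma one_notin_radical: "1 \<notin> radical"
proof
  assume "1 \<in> radical"
  then have "\<chi> (reynolds 1) = 0" using gbar_algebra_one by (auto simp: radical_def)
  then show False using reynolds_center[OF takiff_center_one] character_rules(1) by simp
qed

text \<open>The element \<open>w = z - \<chi> z\<close> is central with \<open>\<chi> w = 0\<close>.
  Linearity of the Reynolds operator over the center gives \<open>\<chi> (reynolds (w * f * h)) =
  \<chi> w * \<chi> (reynolds (f * h))\<close>.\<close>

lemma center_radical:
  assumes z: "z \<in> takiff_center" and f: "f \<in> gbar_algebra"
  shows "z * f - \<chi> z *\<^sub>C f \<in> radical"
proof -
  define w where "w = z + (- \<chi> z) *\<^sub>C 1"
  have w: "w \<in> takiff_center"
    unfolding w_def using z takiff_center_one
    by (intro complex_vector.subspace_add complex_vector.subspace_scale takiff_center_subspace)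
  have c1: "(- \<chi> z) *\<^sub>C 1 \<in> (takiff_center :: 'g takiff uea set)"
    using takiff_center_one by (intro complex_vector.subspace_scale takiff_center_subspace)
  have "\<chi> w = \<chi> z + (- \<chi> z) * \<chi> 1"
    unfolding w_def character_rules(2)[OF z c1] character_rules(4)[OF takiff_center_one] ..
  then have \<chi>w: "\<chi> w = 0" using character_rules(1) by simp
  have "z * f - \<chi> z *\<^sub>C f = w * f" by (simp add: w_def left_diff_distrib uea_scaleC_mult_left)
  moreover have "w * f \<in> radical"
    unfolding radical_def
  proof (intro CollectI conjI ballI)
    show "w * f \<in> gbar_algebra" using takiff_center_gbar[OF w] f by (rule gbar_algebra_mult)
    fix h :: "'g takiff uea" assume h: "h \<in> gbar_algebra"
    then show "\<chi> (reynolds (w * f * h)) = 0"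
      using reynolds_center_mult[OF w, of "f * h"] f
      by (simp add: mult.assoc gbar_algebra_mult character_rules(3) w reynolds(1) \<chi>w)
  qed
  ultimately show ?thesis by simp
qed

text \<open>For \<open>f\<close> in \<open>N\<close> the projection \<open>z\<close> of
  \<open>f * h\<close> is a central element of \<open>N\<close>, and it is congruent to the scalar
  \<open>\<chi> z\<close> modulo the radical. Were the scalar nonzero, \<open>N\<close> would
  contain \<open>1\<close>.\<close>

lemma radical_maximal:
  assumes N: "lie_submodule N gbar_algebra takiff_act" and "radical \<subseteq> N" "1 \<notin> N"
  shows "N = radical"
proof
  show "N \<subseteq> radical"
  proof
    fix f assume f: "f \<in> N"
    show "f \<in> radical"
      unfolding radical_def
    proof (intro CollectI conjI ballI)
      show "f \<in> gbar_algebra" using f lie_submoduleD(1)[OF N] by blast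
      fix h :: "'g takiff uea" assume "h \<in> gbar_algebra"
      then have fh: "f * h \<in> N" by (rule takiff_submodule_ideal[OF N f])
      let ?z = "reynolds (f * h)"
      have zN: "?z \<in> N" by (rule reynolds_submodule[OF takiff_submodule_ad[OF N] fh])
      have z: "?z \<in> takiff_center" using fh lie_submoduleD(1)[OF N] by (intro reynolds(1)) blast
      have "?z * 1 - \<chi> ?z *\<^sub>C 1 \<in> N" using center_radical[OF z gbar_algebra_one] assms(2) by blast
      then have "?z - (?z * 1 - \<chi> ?z *\<^sub>C 1) \<in> N"
        by (rule complex_vector.subspace_diff[OF lie_submoduleD(3)[OF N] zN])
      then have "(1 / \<chi> ?z) *\<^sub>C (?z - (?z * 1 - \<chi> ?z *\<^sub>C 1)) \<in> N"
        by (rule complex_vector.subspace_scale[OF lie_submoduleD(3)[OF N]])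
      then show "\<chi> ?z = 0" using assms(3) by (cases "\<chi> ?z = 0") (simp_all add: scaleC_scaleC scaleC_one)
    qed
  qed
qed (use assms in blast)

end

section \<open>The simple module\<close>

lemma uea_act_hom:
  assumes V: "lie_module V \<rho>" and W: "lie_module W \<sigma>" and f: "lin_on V f" "f ` V \<subseteq> W"
    and hom: "\<And>x v. v \<in> V \<Longrightarrow> f (\<rho> x v) = \<sigma> x (f v)" and v: "v \<in> V"
  shows "f (uea_act \<rho> u v) = uea_act \<sigma> u (f v)"
proof -
  have mW: "f v \<in> W" if "v \<in> V" for v using f that by blast
  note mV = uea_act_mem[OF V]
  have "\<forall>v\<in>V. f (uea_act \<rho> u v) = uea_act \<sigma> u (f v)"
  proof (induction u rule: uea_induct)
    case one
    then show ?case by (simp add: uea_act_one[OF V] uea_act_one[OF W] mW)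
  next
    case (add u w)
    then show ?case by (simp add: uea_act_add[OF V] uea_act_add[OF W] mW mV lin_on_add[OF f(1)])
  next
    case (scaleC c u)
    then show ?case by (simp add: uea_act_scaleC[OF V] uea_act_scaleC[OF W] mW mV lin_on_scale[OF f(1)])
  next
    case (gen_mult x u)
    then show ?case
      by (simp add: uea_act_mult[OF V] uea_act_mult[OF W] uea_act_gen[OF V] uea_act_gen[OF W] mW mV hom
          uea_act_mem[OF W])
  qed
  then show ?thesis using v by blast
qed

lemma uea_act_takiff_act:
  assumes "z \<in> gbar_algebra" "f \<in> gbar_algebra"
  shows "uea_act takiff_act z f = z * f"
proof -
  note M = takiff_act_module
  have "\<forall>f\<in>gbar_algebra. uea_act takiff_act z f = z * f"
    using assms(1)
  proof (induction rule: gbar_algebra_induct)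
    case (mult u v)
    then show ?case by (simp add: uea_act_mult[OF M] gbar_algebra_mult mult.assoc)
  qed (simp_all add: uea_act_nil_gen[OF M] takiff_act_nil uea_act_one[OF M] uea_act_add[OF M] uea_act_scaleC[OF M]
      distrib_right uea_scaleC_mult_left)
  then show ?thesis using assms(2) by blast
qed

text \<open>A copy of the trivial module is a line of vectors killed by \<open>g\<close>; in the
  converse direction the coordinate along \<open>w\<close> is the isomorphism.\<close>

lemma contains_trivial_iff:
  fixes \<rho> :: "'g::complex_lie_algebra takiff \<Rightarrow> 'v::complex_vector \<Rightarrow> 'v"
  assumes V: "lie_module V \<rho>"
  shows "contains_trivial V \<rho> \<longleftrightarrow> (\<exists>w\<in>V. w \<noteq> 0 \<and> (\<forall>x. \<rho> (Takiff x 0) w = 0))"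
proof
  assume "contains_trivial V \<rho>"
  then obtain W f where W: "lie_submodule W V (restrict_to_g \<rho>)" and f: "bij_betw f W (UNIV :: complex set)"
    "\<And>c v. v \<in> W \<Longrightarrow> f (c *\<^sub>C v) = c *\<^sub>C f v" "\<And>x v. v \<in> W \<Longrightarrow> f (restrict_to_g \<rho> x v) = trivial_action x (f v)"
    unfolding contains_trivial_def module_iso_def by blast
  have W0: "0 \<in> W" using complex_vector.subspace_0[OF lie_submoduleD(3)[OF W]] .
  have f0: "f 0 = 0" using f(2)[OF W0, of 0] by simp
  have inj: "v = 0" if "v \<in> W" "f v = 0" for v
    using f(1) that W0 f0 unfolding bij_betw_def inj_on_def by metis
  obtain w where w: "w \<in> W" "f w = 1" using f(1) unfolding bij_betw_def by (metis UNIV_I image_iff)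
  have "w \<noteq> 0" using w f0 by auto
  moreover have "\<rho> (Takiff x 0) w = 0" for x
    using inj[OF lie_submoduleD(4)[OF W w(1), of x]] f(3)[OF w(1), of x]
    by (simp add: trivial_action_def restrict_takiff)
  moreover have "w \<in> V" using w lie_submoduleD(1)[OF W] by blast
  ultimately show "\<exists>w\<in>V. w \<noteq> 0 \<and> (\<forall>x. \<rho> (Takiff x 0) w = 0)" by blast
next
  assume "\<exists>w\<in>V. w \<noteq> 0 \<and> (\<forall>x. \<rho> (Takiff x 0) w = 0)"
  then obtain w where w: "w \<in> V" "w \<noteq> 0" "\<And>x. \<rho> (Takiff x 0) w = 0" by blast
  note sV = lie_module_subspace[OF V]
  define g where "g c = c *\<^sub>C w" for c
  define W where "W = range g"
  have gW: "g c \<in> W" for c by (simp add: W_def)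
  have g: "g (a + b) = g a + g b" "g (a * b) = a *\<^sub>C g b" for a b
    by (simp_all add: g_def scaleC_add_left scaleC_scaleC)
  have inj: "inj g" using w(2) by (auto simp: inj_def g_def)
  have zero: "restrict_to_g \<rho> x (g c) = 0" for x c
    using w by (simp add: restrict_takiff g_def lin_on_scale[OF lie_module_lin[OF V]])
  have g0: "g 0 = 0" by (simp add: g_def)
  have "csubspace W"
  proof (rule complex_vector.subspaceI)
    show "0 \<in> W" using gW[of 0] g0 by simp
    fix a b c assume "a \<in> W" "b \<in> W"
    then obtain i j where "a = g i" "b = g j" by (auto simp: W_def)
    then show "a + b \<in> W" "c *\<^sub>C a \<in> W" using gW g by metis+
  qed
  moreover have "restrict_to_g \<rho> x v = 0" if "v \<in> W" for x v using that zero by (auto simp: W_def)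
  ultimately have "lie_module W (restrict_to_g \<rho>)"
    unfolding lie_module_def
    by (simp add: complex_vector.subspace_0 complex_vector.subspace_add complex_vector.subspace_scale)
  moreover have "W \<subseteq> V" using w sV by (auto simp: W_def g_def complex_vector.subspace_scale)
  moreover have "module_iso W (restrict_to_g \<rho>) (UNIV :: complex set) trivial_action"
    unfolding module_iso_def
  proof (intro exI[of _ "inv g"] conjI ballI allI)
    show "bij_betw (inv g) W UNIV"
      using bij_betw_inv_into[of g UNIV W] inj by (simp add: bij_betw_def W_def)
    fix v assume "v \<in> W"
    then obtain i where i: "v = g i" by (auto simp: W_def)
    show "inv g (v + u) = inv g v + inv g u" if "u \<in> W" for u
    proof -
      obtain j where "u = g j" using \<open>u \<in> W\<close> by (auto simp: W_def)
      then show ?thesis using i by (simp add: inv_f_f[OF inj] flip: g)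
    qed
    show "inv g (c *\<^sub>C v) = c *\<^sub>C inv g v" for c
      using i by (simp add: inv_f_f[OF inj] scaleC_complex_def flip: g)
    show "inv g (restrict_to_g \<rho> x v) = trivial_action x (inv g v)" for x
      using i inv_f_f[OF inj, of 0] by (simp add: zero trivial_action_def g0)
  qed
  ultimately show "contains_trivial V \<rho>" unfolding contains_trivial_def lie_submodule_def by blast
qed

lemma restrict_module:
  fixes \<rho> :: "'g::complex_lie_algebra takiff \<Rightarrow> 'v::complex_vector \<Rightarrow> 'v"
  assumes V: "lie_module V \<rho>"
  shows "lie_module V (restrict_to_g \<rho>)"
proof -
  have t: "Takiff (x + y) 0 = Takiff x 0 + Takiff y 0" "Takiff (c *\<^sub>C x) 0 = c *\<^sub>C Takiff x 0"
    "Takiff (bracket x y) 0 = bracket (Takiff x 0) (Takiff y 0)" for x y :: 'g and c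
    by (simp_all add: plus_takiff_def scaleC_takiff_def bracket_takiff_def)
  show ?thesis
    using V unfolding lie_module_def restrict_takiff t by blast
qed

section \<open>The quotient by the radical\<close>

context
  fixes \<chi> :: "'g::complex_lie_algebra takiff uea \<Rightarrow> complex"
    and C :: "'g takiff uea set" and \<pi> and \<rho>
  assumes fd: "finite_dim (UNIV :: 'g set)" and ss: "semisimple TYPE('g)"
    and \<chi>: "takiff_character \<chi>"
    and C: "C \<subseteq> gbar_algebra" and lin: "Vector_Spaces.linear scaleC scaleC \<pi>"
    and \<pi>C: "\<And>v. v \<in> gbar_algebra \<Longrightarrow> \<pi> v \<in> C"
    and \<pi>id: "\<And>v. v \<in> C \<Longrightarrow> \<pi> v = v"
    and \<pi>diff: "\<And>v. v \<in> gbar_algebra \<Longrightarrow> v - \<pi> v \<in> radical \<chi>"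
    and \<pi>0: "\<And>v. v \<in> gbar_algebra \<Longrightarrow> \<pi> v = 0 \<longleftrightarrow> v \<in> radical \<chi>"
    and \<rho>: "\<rho> = (\<lambda>x v. \<pi> (takiff_act x v))" and modC: "lie_module C \<rho>"
    and idem: "\<And>x v. v \<in> gbar_algebra \<Longrightarrow> \<pi> (takiff_act x (\<pi> v)) = \<pi> (takiff_act x v)"
begin

lemmas rad = radical_submodule[OF fd ss \<chi>]

lemma \<pi>_lin: "\<pi> (a + b) = \<pi> a + \<pi> b" "\<pi> (a - b) = \<pi> a - \<pi> b" "\<pi> (c *\<^sub>C a) = c *\<^sub>C \<pi> a"
  by (simp_all add: cv_pair.linear_add[OF lin] cv_pair.linear_diff[OF lin] cv_pair.linear_scale[OF lin])

lemma C_gbar: "v \<in> C \<Longrightarrow> v \<in> gbar_algebra"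
  using C by blast

lemma \<pi>_hom: "f \<in> gbar_algebra \<Longrightarrow> \<pi> (uea_act takiff_act u f) = uea_act \<rho> u (\<pi> f)"
  by (rule uea_act_hom[OF takiff_act_module modC linear_lin_on[OF lin]]) (use \<pi>C idem in \<open>auto simp: \<rho>\<close>)

lemma \<pi>_act: "z \<in> gbar_algebra \<Longrightarrow> f \<in> gbar_algebra \<Longrightarrow> uea_act \<rho> z (\<pi> f) = \<pi> (z * f)"
  by (simp add: uea_act_takiff_act flip: \<pi>_hom)

lemma \<pi>_one: "\<pi> 1 \<noteq> 0" "\<pi> 1 \<in> C"
  using \<pi>0[OF gbar_algebra_one] one_notin_radical[OF fd ss \<chi>] \<pi>C[OF gbar_algebra_one] by auto

text \<open>The preimage \<open>N\<close> of a submodule contains the radical; by maximality it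
  either equals the radical or contains \<open>1\<close> and hence everything.\<close>

lemma quotient_simple: "simple_module C \<rho>"
  unfolding simple_module_def
proof (intro conjI allI impI)
  show "lie_module C \<rho>" by (rule modC)
  show "C \<noteq> {0}" using \<pi>_one by blast
  fix W assume W: "lie_submodule W C \<rho>"
  note sW = lie_submoduleD(3)[OF W]
  define N where "N = {f \<in> gbar_algebra. \<pi> f \<in> W}"
  have N: "lie_submodule N gbar_algebra takiff_act"
  proof (rule lie_submoduleI[OF takiff_act_module])
    show "csubspace N"
      using sW cv_pair.linear_0[OF lin]
      by (intro complex_vector.subspaceI)
        (auto simp: N_def complex_vector.subspace_0[OF gbar_algebra_subspace] gbar_algebra_add gbar_algebra_scaleC
          complex_vector.subspace_0 complex_vector.subspace_add complex_vector.subspace_scale \<pi>_lin)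
    show "takiff_act x f \<in> N" if "f \<in> N" for x f
      using that lie_submoduleD(4)[OF W, of "\<pi> f" x] idem[of f x] lie_module_mem[OF takiff_act_module, of f x]
      by (simp add: N_def \<rho>)
  qed (auto simp: N_def)
  have "radical \<chi> \<subseteq> N"
    using \<pi>0 complex_vector.subspace_0[OF sW] lie_submoduleD(1)[OF rad] by (force simp: N_def)
  show "W = {0} \<or> W = C"
  proof (cases "1 \<in> N")
    case True
    have "c \<in> W" if "c \<in> C" for c
      using takiff_submodule_ideal[OF N True, of c] that \<pi>id C_gbar by (simp add: N_def)
    then show ?thesis using lie_submoduleD(1)[OF W] by blast
  next
    case False
    then have "N = radical \<chi>" using radical_maximal[OF fd ss \<chi> N \<open>radical \<chi> \<subseteq> N\<close>] by blast
    then have "w = 0" if "w \<in> W" for w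
    proof -
      have w: "w \<in> C" using that lie_submoduleD(1)[OF W] by blast
      then have "w \<in> N" using that \<pi>id C_gbar by (simp add: N_def)
      then show ?thesis using \<pi>0[OF C_gbar[OF w]] \<pi>id[OF w] \<open>N = radical \<chi>\<close> by simp
    qed
    then show ?thesis using complex_vector.subspace_0[OF sW] by blast
  qed
qed

lemma quotient_contains_trivial: "contains_trivial C \<rho>"
proof -
  have "\<rho> (Takiff x 0) (\<pi> 1) = 0" for x
    using idem[OF gbar_algebra_one, of "Takiff x 0"] cv_pair.linear_0[OF lin] by (simp add: \<rho> takiff_act_body)
  then show ?thesis unfolding contains_trivial_iff[OF modC] using \<pi>_one by blast
qed

lemma quotient_acts_via: "acts_via \<chi> C \<rho>"
  unfolding acts_via_def
proof (intro ballI)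
  fix z v assume z: "z \<in> (takiff_center :: 'g takiff uea set)" and v: "v \<in> C"
  note vS = C_gbar[OF v] and zS = takiff_center_gbar[OF z]
  have "z * v - \<chi> z *\<^sub>C v \<in> radical \<chi>" by (rule center_radical[OF fd ss \<chi> z vS])
  moreover have "z * v - \<chi> z *\<^sub>C v \<in> gbar_algebra"
    by (intro complex_vector.subspace_diff[OF gbar_algebra_subspace] gbar_algebra_mult gbar_algebra_scaleC zS vS)
  ultimately have "\<pi> (z * v - \<chi> z *\<^sub>C v) = 0" using \<pi>0 by blast
  then have "\<pi> (z * v) = \<chi> z *\<^sub>C v" by (simp add: \<pi>_lin \<pi>id[OF v])
  then show "uea_act \<rho> z v = \<chi> z *\<^sub>C v" using \<pi>_act[OF zS vS] \<pi>id[OF v] by simp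
qed

text \<open>The kernel \<open>N\<close> of the orbit map \<open>\<psi>\<close> lies in the radical,
  because a central \<open>z\<close> in \<open>N\<close> satisfies
  \<open>\<chi> z *\<^sub>C w = \<psi> z = 0\<close>. Conversely, if \<open>\<psi>\<close> did not
  kill the radical, simplicity would give \<open>\<psi> k = w\<close> for some \<open>k\<close> in
  the radical; then \<open>k - 1\<close> lies in \<open>N\<close>, and \<open>1\<close> in the
  radical.\<close>

lemma quotient_unique:
  fixes \<sigma> :: "'g takiff \<Rightarrow> 'w::complex_vector \<Rightarrow> 'w"
  assumes W: "simple_module W \<sigma>" "contains_trivial W \<sigma>" "acts_via \<chi> W \<sigma>"
  shows "module_iso C \<rho> W \<sigma>"
proof -
  have mW: "lie_module W \<sigma>" using W(1) by (simp add: simple_module_def)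
  obtain w where w: "w \<in> W" "w \<noteq> 0" "\<And>x. \<sigma> (Takiff x 0) w = 0"
    using W(2) unfolding contains_trivial_iff[OF mW] by blast
  define \<psi> where "\<psi> f = uea_act \<sigma> f w" for f
  have \<psi>W: "\<psi> f \<in> W" for f unfolding \<psi>_def by (rule uea_act_mem[OF mW w(1)])
  have \<psi>lin: "\<psi> (f + g) = \<psi> f + \<psi> g" "\<psi> (f - g) = \<psi> f - \<psi> g" "\<psi> (c *\<^sub>C f) = c *\<^sub>C \<psi> f" "\<psi> 0 = 0" for f g c
    unfolding \<psi>_def
    by (simp_all add: uea_act_add[OF mW w(1)] uea_act_diff[OF mW w(1)] uea_act_scaleC[OF mW w(1)] uea_act_zero[OF mW w(1)])
  \<comment> \<open>\<open>takiff_act t f\<close> is \<open>t f - f y\<close> with \<open>y\<close>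
    the body of \<open>t\<close>, and the second term kills \<open>w\<close>.\<close>
  have \<psi>hom: "\<psi> (takiff_act t f) = \<sigma> t (\<psi> f)" for t f
  proof -
    have "takiff_act t f = uea_gen t * f - f * body_gen (body t)"
      by (simp add: takiff_act_def ad_def uea_gen_takiff distrib_right)
    moreover have "\<psi> (uea_gen t * f) = \<sigma> t (\<psi> f)"
      unfolding \<psi>_def uea_act_mult[OF mW w(1)] by (rule uea_act_gen[OF mW uea_act_mem[OF mW w(1)]])
    moreover have "\<psi> (f * body_gen (body t)) = 0"
      unfolding \<psi>_def uea_act_mult[OF mW w(1)] body_gen_def uea_act_gen[OF mW w(1)] w(3)
      using lin_on_zero[OF uea_act_lin[OF mW] lie_module_subspace[OF mW]] .
    ultimately show ?thesis by (simp add: \<psi>lin)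
  qed
  have \<psi>one: "\<psi> 1 = w" unfolding \<psi>_def by (rule uea_act_one[OF mW w(1)])
  have \<psi>on: "lin_on X \<psi>" for X by (simp add: lin_on_def \<psi>lin)
  have image: "lie_submodule (\<psi> ` X) W \<sigma>" if X: "lie_submodule X gbar_algebra takiff_act" for X
  proof (rule lie_submoduleI[OF mW])
    show "csubspace (\<psi> ` X)" by (rule lin_on_image_subspace[OF \<psi>on lie_submoduleD(3)[OF X]])
    show "\<sigma> x u \<in> \<psi> ` X" if "u \<in> \<psi> ` X" for x u
      using that lie_submoduleD(4)[OF X] by (auto simp flip: \<psi>hom)
  qed (use \<psi>W in auto)
  have simple: "X = {0} \<or> X = W" if "lie_submodule X W \<sigma>" for X
    using that W(1) by (simp add: simple_module_def)
  define N where "N = {f \<in> gbar_algebra. \<psi> f = 0}"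
  have N: "lie_submodule N gbar_algebra takiff_act"
  proof (rule lie_submoduleI[OF takiff_act_module])
    show "csubspace N"
      by (rule complex_vector.subspaceI)
        (auto simp: N_def complex_vector.subspace_0[OF gbar_algebra_subspace] gbar_algebra_add gbar_algebra_scaleC \<psi>lin)
    show "takiff_act x f \<in> N" if "f \<in> N" for x f
      using that lie_module_mem[OF takiff_act_module, of f x] lie_module_zero_arg[OF mW] by (simp add: N_def \<psi>hom)
  qed (auto simp: N_def)
  have NR: "N \<subseteq> radical \<chi>"
  proof
    fix f assume f: "f \<in> N"
    show "f \<in> radical \<chi>"
      unfolding radical_def[OF fd ss \<chi>]
    proof (intro CollectI conjI ballI)
      show "f \<in> gbar_algebra" using f by (simp add: N_def)
      fix h :: "'g takiff uea" assume "h \<in> gbar_algebra"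
      then have fh: "f * h \<in> N" by (rule takiff_submodule_ideal[OF N f])
      let ?z = "reynolds (f * h)"
      have "?z \<in> N" by (rule reynolds_submodule[OF fd ss \<chi> takiff_submodule_ad[OF N] fh])
      then have "\<psi> ?z = 0" by (simp add: N_def)
      moreover have "?z \<in> takiff_center" using fh by (intro reynolds(1)[OF fd ss \<chi>]) (simp add: N_def)
      then have "\<psi> ?z = \<chi> ?z *\<^sub>C w" using W(3) w(1) by (simp add: acts_via_def \<psi>_def)
      ultimately show "\<chi> ?z = 0" using w(2) by simp
    qed
  qed
  have RN: "\<psi> m = 0" if m: "m \<in> radical \<chi>" for m
  proof -
    have "\<psi> ` radical \<chi> \<noteq> W"
    proof
      assume "\<psi> ` radical \<chi> = W"
      then obtain k where k: "k \<in> radical \<chi>" "\<psi> k = w" using w(1) by (metis image_iff)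
      have kS: "k \<in> gbar_algebra" using k(1) lie_submoduleD(1)[OF rad] by blast
      have "k - 1 \<in> N"
        using k \<psi>one complex_vector.subspace_diff[OF gbar_algebra_subspace kS gbar_algebra_one]
        by (simp add: N_def \<psi>lin)
      then have "k - (k - 1) \<in> radical \<chi>"
        using NR k complex_vector.subspace_diff[OF lie_submoduleD(3)[OF rad]] by blast
      then show False using one_notin_radical[OF fd ss \<chi>] by simp
    qed
    then have "\<psi> ` radical \<chi> = {0}" using simple[OF image[OF rad]] by blast
    then show ?thesis using m by blast
  qed
  have onto: "\<psi> ` gbar_algebra = W"
  proof -
    have "lie_submodule gbar_algebra gbar_algebra (takiff_act :: 'g takiff \<Rightarrow> _)"
      using takiff_act_module by (simp add: lie_submodule_def)
    moreover have "w \<in> \<psi> ` gbar_algebra" using \<psi>one gbar_algebra_one by force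
    ultimately show ?thesis using simple[OF image] w(2) by blast
  qed
  have \<psi>\<pi>: "\<psi> (\<pi> f) = \<psi> f" if "f \<in> gbar_algebra" for f
    using RN[OF \<pi>diff[OF that]] by (simp add: \<psi>lin)
  show ?thesis
    unfolding module_iso_def
  proof (intro exI[of _ \<psi>] conjI ballI allI)
    have "inj_on \<psi> C"
    proof (rule inj_onI)
      fix a b assume ab: "a \<in> C" "b \<in> C" "\<psi> a = \<psi> b"
      have "a - b \<in> C" using ab complex_vector.subspace_diff[OF lie_module_subspace[OF modC]] by blast
      then have "a - b \<in> N" using ab C_gbar by (simp add: N_def \<psi>lin)
      then have "\<pi> (a - b) = 0" using NR \<pi>0 C_gbar \<open>a - b \<in> C\<close> by blast
      then show "a = b" using \<pi>id[OF \<open>a - b \<in> C\<close>] by simp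
    qed
    moreover have "\<psi> ` C = W"
    proof
      show "W \<subseteq> \<psi> ` C"
      proof
        fix u assume "u \<in> W"
        then obtain f where f: "f \<in> gbar_algebra" "u = \<psi> f" using onto by blast
        then have "u = \<psi> (\<pi> f)" using \<psi>\<pi> by simp
        then show "u \<in> \<psi> ` C" using \<pi>C[OF f(1)] by blast
      qed
    qed (use \<psi>W in auto)
    ultimately show "bij_betw \<psi> C W" by (simp add: bij_betw_def)
    show "\<psi> (\<rho> x v) = \<sigma> x (\<psi> v)" if "v \<in> C" for x v
      using \<psi>\<pi>[OF lie_module_mem[OF takiff_act_module C_gbar[OF that]], of x] by (simp add: \<rho> \<psi>hom)
  qed (simp_all add: \<psi>lin)
qed

lemma restrict_quotient: "restrict_to_g \<rho> x v = \<pi> (ad x v)"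
  by (simp add: restrict_takiff \<rho> takiff_act_body)

lemma quotient_locally_finite: "locally_finite C (restrict_to_g \<rho>)"
  unfolding locally_finite_def
proof (intro conjI ballI)
  show mod: "lie_module C (restrict_to_g \<rho>)" by (rule restrict_module[OF modC])
  fix f assume f: "f \<in> C"
  obtain n where n: "f \<in> gbar_filtration n" by (rule gbar_algebra_filtration[OF C_gbar[OF f]])
  let ?F = "\<pi> ` gbar_filtration n"
  have FS: "g \<in> gbar_filtration n \<Longrightarrow> g \<in> gbar_algebra" for g using gbar_filtration_subset by blast
  have sF: "csubspace ?F" by (rule lin_on_image_subspace[OF linear_lin_on[OF lin] gbar_filtration_subspace])
  have "lie_submodule ?F C (restrict_to_g \<rho>)"
  proof (rule lie_submoduleI[OF mod sF])
    show "?F \<subseteq> C" using FS \<pi>C by auto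
    show "restrict_to_g \<rho> x v \<in> ?F" if v: "v \<in> ?F" for x v
    proof -
      obtain g where g: "v = \<pi> g" "g \<in> gbar_filtration n" using v by blast
      have "restrict_to_g \<rho> x v = \<pi> (ad x g)"
        using idem[OF FS[OF g(2)], of "Takiff x 0"] g(1) by (simp add: restrict_quotient takiff_act_body)
      then show ?thesis using gbar_filtration_ad[OF g(2)] by blast
    qed
  qed
  moreover obtain E :: "'g takiff uea set" where E: "finite E" "cspan E = gbar_filtration n"
    using gbar_filtration_finite_dim[OF fd, of n] by (auto simp: finite_dim_def)
  have "?F = cspan (\<pi> ` E)" unfolding E(2)[symmetric] by (rule cv_pair.linear_span_image[OF lin, symmetric])
  then have "finite_dim ?F" using finite_dim_span[of "\<pi> ` E"] E(1) by simp
  moreover have "f \<in> ?F" using n \<pi>id[OF f] by force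
  ultimately show "\<exists>F. finite_dim F \<and> lie_submodule F C (restrict_to_g \<rho>) \<and> f \<in> F" by blast
qed

lemma radical_character:
  obtains ev where "lin_on gbar_algebra ev" "ev 1 = (1::complex)" "\<And>f. f \<in> radical \<chi> \<Longrightarrow> ev f = 0"
    "\<And>f g. f \<in> gbar_algebra \<Longrightarrow> g \<in> gbar_algebra \<Longrightarrow> ev (f * g) = ev f * ev g"
  by (rule gbar_character[OF fd takiff_submodule_gbar_ideal[OF rad] one_notin_radical[OF fd ss \<chi>]]) (rule that)

text \<open>Since the radical is a maximal \<open>g\<close>-stable ideal, no nonzero \<open>g\<close>-submodule of the quotient lies in
  the kernel of a character; so \<open>Hom\<^sub>g(W, V)\<close> embeds into the dual space of \<open>W\<close>.\<close>

lemma submodule_in_kernel: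
  assumes ev: "lin_on gbar_algebra ev" "ev 1 = (1::complex)" "\<And>f. f \<in> radical \<chi> \<Longrightarrow> ev f = 0"
    "\<And>f g. f \<in> gbar_algebra \<Longrightarrow> g \<in> gbar_algebra \<Longrightarrow> ev (f * g) = ev f * ev g"
    and N: "lie_submodule N C (restrict_to_g \<rho>)" "\<And>n. n \<in> N \<Longrightarrow> ev n = 0" and n: "n \<in> N"
  shows "n = 0"
proof -
  \<comment> \<open>\<open>N\<close> is \<open>ad\<close>-stable only up to the radical, since the
    action on \<open>C\<close> ends with \<open>\<pi>\<close>. Including the radical makes
    \<open>K\<close> a genuinely \<open>ad\<close>-stable ideal.\<close>
  let ?G = "{h * n | h n. h \<in> gbar_algebra \<and> n \<in> N} \<union> radical \<chi>"
  define K where "K = cspan ?G"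
  have NS: "n \<in> N \<Longrightarrow> n \<in> gbar_algebra" for n using lie_submoduleD(1)[OF N(1)] C_gbar by blast
  have RS: "m \<in> radical \<chi> \<Longrightarrow> m \<in> gbar_algebra" for m using lie_submoduleD(1)[OF rad] by blast
  have sK: "csubspace K" by (simp add: K_def)
  have GK: "g \<in> ?G \<Longrightarrow> g \<in> K" for g unfolding K_def by (rule complex_vector.span_base)
  have hn: "h * n \<in> K" if "h \<in> gbar_algebra" "n \<in> N" for h n using that by (intro GK) blast
  have mK: "m \<in> K" if "m \<in> radical \<chi>" for m using that by (intro GK) blast
  have KS: "K \<subseteq> gbar_algebra"
    unfolding K_def by (rule complex_vector.span_minimal[OF _ gbar_algebra_subspace])
      (use NS RS in \<open>auto intro: gbar_algebra_mult\<close>)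
  have indK: "P f" if "f \<in> K" "P 0" "\<And>h n. h \<in> gbar_algebra \<Longrightarrow> n \<in> N \<Longrightarrow> P (h * n)"
    "\<And>m. m \<in> radical \<chi> \<Longrightarrow> P m" "\<And>c x y. x \<in> K \<Longrightarrow> y \<in> K \<Longrightarrow> P x \<Longrightarrow> P y \<Longrightarrow> P (c *\<^sub>C x + y)" for P f
  proof -
    have "f \<in> K \<and> P f"
      using that(1) unfolding K_def
    proof (induction rule: complex_vector.span_induct_alt)
      case base
      show ?case using that(2) complex_vector.span_zero by blast
    next
      case (step c x y)
      have x: "x \<in> K" "P x" using step(1) that(3,4) GK by blast+
      have y: "y \<in> K" "P y" using step.IH by (simp_all add: K_def)
      have "c *\<^sub>C x + y \<in> K" using x y sK complex_vector.subspace_add complex_vector.subspace_scale by blast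
      then show ?case using that(5)[OF x(1) y(1) x(2) y(2)] by (simp add: K_def)
    qed
    then show ?thesis ..
  qed
  note Kadd = complex_vector.subspace_add[OF sK] and Kscale = complex_vector.subspace_scale[OF sK]
    and K0 = complex_vector.subspace_0[OF sK]
  have adK: "ad x f \<in> K" if "f \<in> K" for x f
    using that
  proof (rule indK)
    show "ad x 0 \<in> K" using K0 by (simp add: ad_def)
    fix h n :: "'g takiff uea" assume h: "h \<in> gbar_algebra" and n: "n \<in> N"
    have adn: "ad x n \<in> gbar_algebra" using ad_gbar_algebra NS n by blast
    have r: "\<pi> (ad x n) \<in> N" using lie_submoduleD(4)[OF N(1) n, of x] by (simp add: restrict_quotient)
    have d: "ad x n - \<pi> (ad x n) \<in> radical \<chi>" by (rule \<pi>diff[OF adn])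
    have hd: "h * (ad x n - \<pi> (ad x n)) \<in> radical \<chi>"
      using takiff_submodule_ideal[OF rad d h] gbar_algebra_commute[OF h RS[OF d]] by simp
    have "ad x (h * n) = ad x h * n + (h * \<pi> (ad x n) + h * (ad x n - \<pi> (ad x n)))"
      by (simp add: ad_mult right_diff_distrib)
    then show "ad x (h * n) \<in> K"
      using Kadd[OF hn[OF ad_gbar_algebra[OF h] n] Kadd[OF hn[OF h r] mK[OF hd]]] by simp
  next
    show "ad x m \<in> K" if "m \<in> radical \<chi>" for m
      using lie_submoduleD(4)[OF takiff_submodule_ad[OF rad] that] mK by blast
    show "ad x (c *\<^sub>C u + v) \<in> K" if "ad x u \<in> K" "ad x v \<in> K" for c u v
      using Kadd[OF Kscale[OF that(1)] that(2)] by (simp add: ad_add ad_scaleC)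
  qed
  have multK: "k * f \<in> K" if "f \<in> K" "k \<in> gbar_algebra" for k f
    using that(1)
  proof (rule indK)
    show "k * 0 \<in> K" using K0 by simp
    show "k * (h * n) \<in> K" if "h \<in> gbar_algebra" "n \<in> N" for h n
      using hn[OF gbar_algebra_mult[OF \<open>k \<in> gbar_algebra\<close> that(1)] that(2)] by (simp add: mult.assoc)
    show "k * m \<in> K" if "m \<in> radical \<chi>" for m
      using mK[OF takiff_submodule_ideal[OF rad that \<open>k \<in> gbar_algebra\<close>]]
        gbar_algebra_commute[OF \<open>k \<in> gbar_algebra\<close> RS[OF that]] by simp
    show "k * (c *\<^sub>C u + v) \<in> K" if "k * u \<in> K" "k * v \<in> K" for c u v
      using Kadd[OF Kscale[OF that(1)] that(2)] by (simp add: distrib_left uea_scaleC_mult_right)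
  qed
  have K: "lie_submodule K gbar_algebra takiff_act"
    by (rule takiff_submoduleI[OF sK KS adK multK])
  \<comment> \<open>\<open>ev\<close> is multiplicative and vanishes on \<open>N\<close> and on the
    radical, so \<open>K\<close> misses \<open>1\<close>; maximality then makes \<open>K\<close> the
    radical.\<close>
  have "ev f = 0" if "f \<in> K" for f
    using that
  proof (rule indK)
    show "ev 0 = 0" by (rule lin_on_zero[OF ev(1) gbar_algebra_subspace])
    show "ev (h * n) = 0" if "h \<in> gbar_algebra" "n \<in> N" for h n
      using ev(4)[OF that(1) NS[OF that(2)]] N(2)[OF that(2)] by simp
    show "ev (c *\<^sub>C u + v) = 0" if "u \<in> K" "v \<in> K" "ev u = 0" "ev v = 0" for c u v
    proof -
      have "u \<in> gbar_algebra" "v \<in> gbar_algebra" using that KS by auto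
      then show ?thesis
        using that lin_on_add[OF ev(1) gbar_algebra_scaleC] lin_on_scale[OF ev(1)] by (simp add: scaleC_complex_def)
    qed
  qed (rule ev(3))
  then have "1 \<notin> K" using ev(2) by auto
  then have "K = radical \<chi>" using radical_maximal[OF fd ss \<chi> K] mK by blast
  then have "n \<in> radical \<chi>" using hn[OF gbar_algebra_one n] by simp
  then have "\<pi> n = 0" using \<pi>0 NS[OF n] by blast
  moreover have "n \<in> C" using n lie_submoduleD(1)[OF N(1)] by blast
  ultimately show ?thesis using \<pi>id by simp
qed

text \<open>More than \<open>dim W\<close> summands isomorphic to \<open>W\<close> would give that
  many embeddings of \<open>W\<close>. Some nontrivial combination of them has its image in the
  kernel of \<open>ev\<close>, so it is zero by \<open>submodule_in_kernel\<close>, against the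
  directness of the sum.\<close>

lemma quotient_harish_chandra: "harish_chandra C \<rho>"
proof -
  obtain \<W> where ds: "internal_direct_sum \<W> C"
    and \<W>: "\<And>W. W \<in> \<W> \<Longrightarrow> simple_module W (restrict_to_g \<rho>) \<and> finite_dim W \<and> lie_submodule W C (restrict_to_g \<rho>)"
    by (rule locally_finite_semisimple[OF fd ss quotient_locally_finite]) (rule that)
  obtain ev where ev: "lin_on gbar_algebra ev" "ev 1 = (1::complex)" "\<And>f. f \<in> radical \<chi> \<Longrightarrow> ev f = 0"
    "\<And>f g. f \<in> gbar_algebra \<Longrightarrow> g \<in> gbar_algebra \<Longrightarrow> ev (f * g) = ev f * ev g"
    by (rule radical_character) (rule that)
  note modR = restrict_module[OF modC]
  note sC = lie_module_subspace[OF modC]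
  have "finite {W' \<in> \<W>. module_iso W' (restrict_to_g \<rho>) W (restrict_to_g \<rho>)}" (is "finite ?X") if W: "W \<in> \<W>" for W
  proof (rule ccontr)
    assume "infinite ?X"
    have simpleW: "simple_module W (restrict_to_g \<rho>)" and fW: "finite_dim W" and subW: "lie_submodule W C (restrict_to_g \<rho>)"
      using \<W>[OF W] by auto
    obtain B where B: "finite B" "cindependent B" "cspan B = W" using finite_dim_basis[OF fW] by metis
    have BW: "b \<in> B \<Longrightarrow> b \<in> W" for b using B(3) complex_vector.span_base by blast
    obtain A where A: "finite A" "card A = Suc (card B)" "A \<subseteq> ?X"
      using infinite_arbitrarily_large[OF \<open>infinite ?X\<close>, of "Suc (card B)"] by blast
    have AW: "X \<in> A \<Longrightarrow> X \<in> \<W>" for X using A(3) by blast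
    define emb where "emb X g \<longleftrightarrow> lin_on W g \<and> (\<forall>w\<in>W. g w \<in> X) \<and> (\<forall>w\<in>W. g w = 0 \<longrightarrow> w = 0) \<and>
      (\<forall>x. \<forall>w\<in>W. g (restrict_to_g \<rho> x w) = restrict_to_g \<rho> x (g w))" for X and g :: "'g takiff uea \<Rightarrow> 'g takiff uea"
    have "\<exists>g. emb X g" if XA: "X \<in> A" for X
    proof -
      have subX: "lie_submodule X C (restrict_to_g \<rho>)" using \<W>[OF AW[OF that]] by blast
      have isoX: "module_iso X (restrict_to_g \<rho>) W (restrict_to_g \<rho>)" using XA A(3) by blast
      obtain f where f: "bij_betw f X W" "\<And>v w. v \<in> X \<Longrightarrow> w \<in> X \<Longrightarrow> f (v + w) = f v + f w"
        "\<And>c v. v \<in> X \<Longrightarrow> f (c *\<^sub>C v) = c *\<^sub>C f v"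
        "\<And>x v. v \<in> X \<Longrightarrow> f (restrict_to_g \<rho> x v) = restrict_to_g \<rho> x (f v)"
        using isoX unfolding module_iso_def by blast
      define g where "g = inv_into X f"
      have inj: "inj_on f X" and img: "f ` X = W" using f(1) by (auto simp: bij_betw_def)
      have gX: "g w \<in> X" "f (g w) = w" if "w \<in> W" for w
        using that img by (auto simp: g_def inv_into_into f_inv_into_f)
      have gf: "g (f v) = v" if "v \<in> X" for v using that inj by (simp add: g_def)
      have sX: "csubspace X" using lie_submoduleD(3)[OF subX] .
      have "lin_on W g"
        unfolding lin_on_def
      proof (intro conjI ballI allI)
        show "g (v + w) = g v + g w" if "v \<in> W" "w \<in> W" for v w
          using gf[of "g v + g w"] f(2)[of "g v" "g w"] gX that complex_vector.subspace_add[OF sX] by simp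
        show "g (c *\<^sub>C v) = c *\<^sub>C g v" if "v \<in> W" for c v
          using gf[of "c *\<^sub>C g v"] f(3)[of "g v" c] gX that complex_vector.subspace_scale[OF sX] by simp
      qed
      moreover have "w = 0" if "w \<in> W" "g w = 0" for w
        using gX(2)[OF that(1)] that(2) f(3)[OF complex_vector.subspace_0[OF sX], of 0] by simp
      moreover have "g (restrict_to_g \<rho> x w) = restrict_to_g \<rho> x (g w)" if "w \<in> W" for x w
        using gf[of "restrict_to_g \<rho> x (g w)"] f(4)[of "g w" x] gX that lie_submoduleD(4)[OF subX] by simp
      ultimately have "emb X g" using gX(1) by (simp add: emb_def)
      then show ?thesis by blast
    qed
    then obtain g where "\<And>X. X \<in> A \<Longrightarrow> emb X (g X)" by metis
    then have g: "\<And>X. X \<in> A \<Longrightarrow> lin_on W (g X)" "\<And>X w. X \<in> A \<Longrightarrow> w \<in> W \<Longrightarrow> g X w \<in> X"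
      "\<And>X w. X \<in> A \<Longrightarrow> w \<in> W \<Longrightarrow> g X w = 0 \<Longrightarrow> w = 0"
      "\<And>X x w. X \<in> A \<Longrightarrow> w \<in> W \<Longrightarrow> g X (restrict_to_g \<rho> x w) = restrict_to_g \<rho> x (g X w)"
      unfolding emb_def by blast+
    have gC: "g X w \<in> C" if "X \<in> A" "w \<in> W" for X w
      using g(2)[OF that] lie_submoduleD(1)[of X C "restrict_to_g \<rho>"] \<W>[OF AW[OF that(1)]] by blast
    \<comment> \<open>There are \<open>card B + 1\<close> embeddings but only \<open>card B\<close>
      conditions, one for each basis vector of \<open>W\<close>.\<close>
    obtain c where c: "\<exists>X\<in>A. c X \<noteq> 0" "\<forall>b\<in>B. (\<Sum>X\<in>A. c X * ev (g X b)) = 0"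
      using homogeneous_system[OF B(1) A(1), of "\<lambda>X b. ev (g X b)"] A(2) by auto
    define \<phi> where "\<phi> w = (\<Sum>X\<in>A. c X *\<^sub>C g X w)" for w
    have \<phi>C: "\<phi> w \<in> C" if "w \<in> W" for w
      unfolding \<phi>_def using gC that by (intro subspace_lincomb[OF sC])
    have \<phi>lin: "lin_on W \<phi>"
      unfolding lin_on_def \<phi>_def
      by (simp add: lin_on_add[OF g(1)] lin_on_scale[OF g(1)] scaleC_add_right sum.distrib
          complex_vector.scale_sum_right scaleC_scaleC mult.commute)
    have \<phi>hom: "\<phi> (restrict_to_g \<rho> x w) = restrict_to_g \<rho> x (\<phi> w)" if "w \<in> W" for x w
    proof -
      have "restrict_to_g \<rho> x (\<phi> w) = (\<Sum>X\<in>A. c X *\<^sub>C restrict_to_g \<rho> x (g X w))"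
        unfolding \<phi>_def using gC that by (intro lin_on_sum_scale[OF lie_module_lin[OF modR] sC])
      then show ?thesis using g(4) that by (simp add: \<phi>_def)
    qed
    have "lie_submodule (\<phi> ` W) C (restrict_to_g \<rho>)"
    proof (rule lie_submoduleI[OF modR])
      show "csubspace (\<phi> ` W)" by (rule lin_on_image_subspace[OF \<phi>lin lie_submoduleD(3)[OF subW]])
      show "restrict_to_g \<rho> x u \<in> \<phi> ` W" if "u \<in> \<phi> ` W" for x u
        using that lie_submoduleD(4)[OF subW] by (auto simp flip: \<phi>hom)
    qed (use \<phi>C in auto)
    moreover have "ev u = 0" if u: "u \<in> \<phi> ` W" for u
    proof -
      obtain w where w: "w \<in> W" "u = \<phi> w" using u by blast
      have gS: "X \<in> A \<Longrightarrow> w \<in> W \<Longrightarrow> g X w \<in> gbar_algebra" for X w using gC C_gbar by blast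
      have "ev (\<phi> w) = 0"
      proof (rule lin_on_ext_span[where B = B and f = "\<lambda>w. ev (\<phi> w)" and g = "\<lambda>_. 0"])
        show "lin_on (cspan B) (\<lambda>w. ev (\<phi> w))"
          unfolding B(3) by (rule lin_on_comp[OF \<phi>lin _ ev(1)]) (use \<phi>C C_gbar in auto)
        show "lin_on (cspan B) (\<lambda>w. 0 :: complex)" by (simp add: lin_on_def)
        show "w \<in> cspan B" using w B by simp
        show "ev (\<phi> b) = 0" if "b \<in> B" for b
        proof -
          have "ev (\<phi> b) = (\<Sum>X\<in>A. c X *\<^sub>C ev (g X b))"
            unfolding \<phi>_def using gS BW[OF that] by (intro lin_on_sum_scale[OF ev(1) gbar_algebra_subspace])
          then show ?thesis using c(2) that by (simp add: scaleC_complex_def)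
        qed
      qed
      then show ?thesis using w by simp
    qed
    ultimately have \<phi>0: "\<phi> w = 0" if "w \<in> W" for w
      using submodule_in_kernel[OF ev, of "\<phi> ` W" "\<phi> w"] that by blast
    obtain X where X: "X \<in> A" "c X \<noteq> 0" using c(1) by blast
    have subX: "lie_submodule X C (restrict_to_g \<rho>)" using \<W>[OF AW[OF X(1)]] by blast
    have "W \<noteq> {0}" using simpleW by (simp add: simple_module_def)
    then obtain w where w: "w \<in> W" "w \<noteq> 0"
      using complex_vector.subspace_0[OF lie_submoduleD(3)[OF subW]] by blast
    have "c X *\<^sub>C g X w + (\<Sum>Y\<in>A - {X}. c Y *\<^sub>C g Y w) = 0"
      using \<phi>0[OF w(1)] A(1) X(1) by (simp add: \<phi>_def sum.remove[OF A(1) X(1)])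
    then have eq: "c X *\<^sub>C g X w = - (\<Sum>Y\<in>A - {X}. c Y *\<^sub>C g Y w)" by (simp add: eq_neg_iff_add_eq_0)
    have "g Y w \<in> cspan (\<Union>(\<W> - {X}))" if "Y \<in> A - {X}" for Y
      using g(2)[of Y w] that w(1) AW[of Y] by (intro complex_vector.span_base) auto
    then have "- (\<Sum>Y\<in>A - {X}. c Y *\<^sub>C g Y w) \<in> cspan (\<Union>(\<W> - {X}))"
      by (intro complex_vector.span_neg subspace_lincomb complex_vector.subspace_span)
    moreover have "c X *\<^sub>C g X w \<in> X"
      using g(2)[OF X(1) w(1)] complex_vector.subspace_scale[OF lie_submoduleD(3)[OF subX]] by blast
    moreover have "X \<inter> cspan (\<Union>(\<W> - {X})) = {0}" using ds AW[OF X(1)] by (simp add: internal_direct_sum_def)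
    ultimately have "c X *\<^sub>C g X w = 0" using eq by (metis IntI singletonD)
    then have "g X w = 0" using X(2) by simp
    then show False using g(3)[OF X(1) w(1)] w(2) by blast
  qed
  then show ?thesis unfolding harish_chandra_def using modC ds \<W> by blast
qed

text \<open>The action of \<open>[y, z] \<otimes> x\<close> is the commutator of the actions of \<open>y\<close> and \<open>z \<otimes> x\<close> and commutes with the
  latter, so on a finite-dimensional module it is nilpotent.\<close>

lemma quotient_infinite_dimensional:
  assumes fC: "finite_dim C"
  shows "acts_via \<chi> (UNIV :: complex set) trivial_action"
proof -
  obtain ev where ev: "lin_on gbar_algebra ev" "ev 1 = (1::complex)" "\<And>f. f \<in> radical \<chi> \<Longrightarrow> ev f = 0"
    "\<And>f g. f \<in> gbar_algebra \<Longrightarrow> g \<in> gbar_algebra \<Longrightarrow> ev (f * g) = ev f * ev g"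
    by (rule radical_character) (rule that)
  note lC = lie_module_lin[OF modC] and iC = lie_module_image[OF modC] and sC = lie_module_subspace[OF modC]
    and mC = lie_module_mem[OF modC]
  obtain B where B: "finite B" "cindependent B" "cspan B = C" using finite_dim_basis[OF fC] by metis
  have BC: "b \<in> B \<Longrightarrow> b \<in> C" for b using B(3) complex_vector.span_base by blast
  have nil: "ev (nil_gen (bracket y z)) = 0" for y z
  proof -
    define a where "a = Takiff 0 (bracket y z)"
    define Y where "Y = \<rho> (Takiff y 0)"
    define Z where "Z = \<rho> (Takiff 0 z)"
    have "bracket (Takiff y 0) (Takiff 0 z) = a" by (simp add: a_def bracket_takiff_def)
    then have aYZ: "\<rho> a v = Y (Z v) - Z (Y v)" if "v \<in> C" for v
      using lie_module_bracket[OF modC that, of "Takiff y 0" "Takiff 0 z"] by (simp add: Y_def Z_def)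
    \<comment> \<open>As in Cartan's criterion, nilpotency of \<open>\<rho> a\<close> is reduced to
      a single trace against the conjugate operator \<open>s\<close>.\<close>
    obtain s where s: "lin_on C s" "s ` C \<subseteq> C" "\<And>c v. v \<in> gen_eig C (\<rho> a) c \<Longrightarrow> s v = cnj c *\<^sub>C v"
      "trace_on B (\<lambda>v. \<rho> a (s v)) = 0 \<Longrightarrow> gen_eig C (\<rho> a) 0 = C"
      by (rule conjugate_operator[OF fC lC iC]) (use B in blast)
    have ms: "v \<in> C \<Longrightarrow> s v \<in> C" for v using s(2) by blast
    have lZ: "lin_on C Z" and mZ: "v \<in> C \<Longrightarrow> Z v \<in> C" and lY: "lin_on C Y" and mY: "v \<in> C \<Longrightarrow> Y v \<in> C" for v
      using lC mC by (simp_all add: Z_def Y_def)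
    have Zi: "Z ` C \<subseteq> C" using mZ by blast
    \<comment> \<open>As \<open>gbar\<close> is commutative, \<open>Takiff 0 z\<close> has weight
      zero under \<open>ad a\<close>, so \<open>Z\<close> preserves the generalized eigenspaces of
      \<open>\<rho> a\<close> and commutes with \<open>s\<close>. This makes the trace of
      \<open>[Y, Z] s\<close> vanish.\<close>
    have "bracket a (Takiff 0 z) = 0" by (simp add: a_def bracket_takiff_def zero_takiff_def)
    then have z0: "Takiff 0 z \<in> gen_eig UNIV (bracket a) 0"
      by (auto simp: gen_eig_def intro!: exI[of _ 1])
    have comm: "s (Z v) = Z (s v)" if "v \<in> C" for v
    proof (rule lin_on_ext_span[where B = "\<Union>c. gen_eig C (\<rho> a) c" and f = "\<lambda>v. s (Z v)" and g = "\<lambda>v. Z (s v)"])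
      note sp = gen_eig_span[OF sC lC iC fC]
      show "lin_on (cspan (\<Union>c. gen_eig C (\<rho> a) c)) (\<lambda>v. s (Z v))"
        unfolding sp by (rule lin_on_comp[OF lZ Zi s(1)])
      show "lin_on (cspan (\<Union>c. gen_eig C (\<rho> a) c)) (\<lambda>v. Z (s v))"
        unfolding sp by (rule lin_on_comp[OF s(1,2) lZ])
      show "v \<in> cspan (\<Union>c. gen_eig C (\<rho> a) c)" unfolding sp by (rule that)
      fix v assume "v \<in> (\<Union>c. gen_eig C (\<rho> a) c)"
      then obtain c where v: "v \<in> gen_eig C (\<rho> a) c" by blast
      then have "Z v \<in> gen_eig C (\<rho> a) c"
        using gen_eig_weight[OF modC lie_ideal_UNIV z0 v] by (simp add: Z_def)
      moreover have "v \<in> C" using v by (simp add: gen_eig_def)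
      ultimately show "s (Z v) = Z (s v)" using s(3) v by (simp add: lin_on_scale[OF lZ])
    qed
    have "trace_on B (\<lambda>v. Z (Y (s v))) = trace_on B (\<lambda>v. Y (s (Z v)))"
    proof (rule trace_on_comp_commute[OF B(1,2) B(1,2), of "\<lambda>v. Y (s v)" Z, unfolded B(3)])
      show "lin_on C (\<lambda>v. Y (s v))" by (rule lin_on_comp[OF s(1,2) lY])
    qed (use mY mZ ms lZ in auto)
    also have "\<dots> = trace_on B (\<lambda>v. Y (Z (s v)))"
      by (rule trace_on_cong) (simp add: comm BC)
    finally have tr: "trace_on B (\<lambda>v. Z (Y (s v))) = trace_on B (\<lambda>v. Y (Z (s v)))" .
    have "trace_on B (\<lambda>v. \<rho> a (s v)) = trace_on B (\<lambda>v. Y (Z (s v)) - Z (Y (s v)))"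
      by (rule trace_on_cong) (simp add: aYZ ms BC)
    also have "\<dots> = 0"
      by (subst trace_on_diff[OF B(2)]) (auto simp: tr B(3) mY mZ ms BC)
    finally have "gen_eig C (\<rho> a) 0 = C" by (rule s(4))
    \<comment> \<open>Nilpotency on the class of \<open>1\<close> puts a power of
      \<open>nil_gen (bracket y z)\<close> into the radical, and a multiplicative functional that
      kills a power kills the element.\<close>
    then obtain n where n: "(\<rho> a ^^ n) (\<pi> 1) = 0" using \<pi>_one(2) unfolding gen_eig_zero by blast
    let ?x = "nil_gen (bracket y z)"
    have xS: "?x ^ k \<in> gbar_algebra" for k
      by (induction k) (simp_all add: gbar_algebra_one gbar_algebra_mult gbar_algebra_nil_gen)
    have "(\<rho> a ^^ k) (\<pi> 1) = \<pi> (?x ^ k)" for k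
    proof (induction k)
      case (Suc k)
      then show ?case using idem[OF xS[of k], of a] by (simp add: \<rho> a_def takiff_act_nil)
    qed simp
    then have "?x ^ n \<in> radical \<chi>" using n \<pi>0[OF xS] by simp
    then have "ev (?x ^ n) = 0" by (rule ev(3))
    moreover have "ev (?x ^ k) = ev ?x ^ k" for k
      by (induction k) (simp_all add: ev xS gbar_algebra_nil_gen)
    ultimately show ?thesis by simp
  qed
  have ev_nil: "ev (nil_gen x) = 0" for x
  proof -
    obtain D :: "'g set" where D: "finite D" "cindependent D" "cspan D = UNIV" using finite_dim_basis[OF fd] by metis
    have "x \<in> cspan {bracket y z | y z. y \<in> UNIV \<and> z \<in> (UNIV :: 'g set)}"
      using perfect[OF fd ss D] unfolding derived_def by auto
    then show ?thesis
    proof (induction rule: complex_vector.span_induct_alt)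
      case base
      then show ?case using lin_on_zero[OF ev(1) gbar_algebra_subspace] by (simp add: nil_gen_zero)
    next
      case (step c u v)
      then obtain y z where "u = bracket y z" by blast
      then have "ev (nil_gen u) = 0" using nil by simp
      then show ?case
        using step.IH lin_on_add[OF ev(1) gbar_algebra_scaleC[OF gbar_algebra_nil_gen] gbar_algebra_nil_gen]
          lin_on_scale[OF ev(1) gbar_algebra_nil_gen]
        by (simp add: nil_gen_add nil_gen_scaleC scaleC_complex_def)
    qed
  qed
  note T = trivial_module
  \<comment> \<open>\<open>ev\<close> vanishes on the generators and is multiplicative, so it is the
    augmentation by which the algebra acts on the trivial module.\<close>
  have triv: "uea_act trivial_action f v = ev f * v" if "f \<in> gbar_algebra" for f and v :: complex
  proof -
    have "\<forall>v. uea_act trivial_action f v = ev f * v"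
      using that
    proof (induction rule: gbar_algebra_induct)
      case (gen w)
      show ?case by (simp only: uea_act_nil_gen[OF T UNIV_I] ev_nil) (simp add: trivial_action_def)
    qed (simp_all add: uea_act_one[OF T] uea_act_add[OF T] uea_act_scaleC[OF T] uea_act_mult[OF T] ev(2,4)
        lin_on_add[OF ev(1)] lin_on_scale[OF ev(1)] scaleC_complex_def distrib_right mult.assoc)
    then show ?thesis by blast
  qed
  show ?thesis
    unfolding acts_via_def
  proof (intro ballI)
    fix z :: "'g takiff uea" and v :: complex assume z: "z \<in> takiff_center"
    note zS = takiff_center_gbar[OF z]
    \<comment> \<open>\<open>z - \<chi> z\<close> lies in the radical, which \<open>ev\<close>
      kills; so \<open>ev\<close> extends \<open>\<chi>\<close>.\<close>
    have "ev (z * 1 - \<chi> z *\<^sub>C 1) = 0" by (rule ev(3)[OF center_radical[OF fd ss \<chi> z gbar_algebra_one]])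
    then have "ev z = \<chi> z"
      using lin_on_diff[OF ev(1) gbar_algebra_subspace zS gbar_algebra_scaleC[OF gbar_algebra_one]]
        lin_on_scale[OF ev(1) gbar_algebra_one] ev(2) by (simp add: scaleC_complex_def)
    then show "uea_act trivial_action z v = \<chi> z *\<^sub>C v" using triv[OF zS] by (simp add: scaleC_complex_def)
  qed
qed

end

theorem corollary8:
  fixes \<chi> :: "'g::complex_lie_algebra takiff uea \<Rightarrow> complex"
  assumes "finite_dim (UNIV :: 'g set)"
    and "semisimple TYPE('g)"
    and "takiff_character \<chi>"
  shows "\<exists>(V :: 'g takiff uea set) \<rho>.
    simple_module V \<rho> \<and> contains_trivial V \<rho> \<and> acts_via \<chi> V \<rho> \<and>
    (\<forall>(W :: 'w::complex_vector set) \<sigma>.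
      simple_module W \<sigma> \<and> contains_trivial W \<sigma> \<and> acts_via \<chi> W \<sigma> \<longrightarrow> module_iso V \<rho> W \<sigma>) \<and>
    harish_chandra V \<rho> \<and>
    (\<not> acts_via \<chi> (UNIV :: complex set) trivial_action \<longrightarrow> \<not> finite_dim V)"
proof -
  obtain C \<pi> where Q: "C \<subseteq> gbar_algebra" "Vector_Spaces.linear scaleC scaleC \<pi>"
    "\<And>v. v \<in> gbar_algebra \<Longrightarrow> \<pi> v \<in> C" "\<And>v. v \<in> C \<Longrightarrow> \<pi> v = v" "\<And>v. v \<in> gbar_algebra \<Longrightarrow> v - \<pi> v \<in> radical \<chi>"
    "\<And>v. v \<in> gbar_algebra \<Longrightarrow> \<pi> v = 0 \<longleftrightarrow> v \<in> radical \<chi>" "lie_module C (\<lambda>x v. \<pi> (takiff_act x v))"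
    "\<And>x v. v \<in> gbar_algebra \<Longrightarrow> \<pi> (takiff_act x (\<pi> v)) = \<pi> (takiff_act x v)"
    by (rule quotient_module[OF takiff_act_module radical_submodule[OF assms]]) (rule that)
  \<comment> \<open>\<open>refl\<close> discharges the defining equation of \<open>\<rho>\<close>,
    which becomes the action of the quotient.\<close>
  note R = assms Q(1-6) refl Q(7,8)
  show ?thesis
    using quotient_simple[OF R] quotient_contains_trivial[OF R] quotient_acts_via[OF R]
      quotient_unique[OF R] quotient_harish_chandra[OF R] quotient_infinite_dimensional[OF R]
    by blast
qed

end
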